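(* For every $\kappa\in(0,1)$ there exists an integer $d_0\ge1$ such that for every integer $d\ge d_0$, every real $\delta$ with $1>\delta\ge 3\sqrt{\frac{5\ln(d)}{d}}$ and every $t=(t_1,t_2)\in\mathbb{R}^2$ such that $\delta\le e^{t_1}\le1$ and $\delta\le e^{t_2}\le1$, $$p(t)=\mathbb{P}\left(\mathrm{Log}^{-1}(t)\cap V_P\ne\emptyset\right)\ge 1-14\,\gamma(\kappa)^N,\qquad\text{with } N=\left\lfloor\frac{2\delta\sqrt{d}}{3\sqrt{5\ln(d)}}\right\rfloor^2,$$ where $\gamma(\kappa)=1-\exp\left(-\frac{2^{11}3^3}{\kappa^2}\right)(1-e^{-1/2})$.
   Context: For an integer $d\ge 1$, $H^0(\mathbb{CP}^2,L^d)$ is the space of homogeneous complex polynomials of degree $d$ in $X_0,X_1,X_2$, of dimension $N_d=(d+1)(d+2)/2$, with the Hermitian product for which distinct monomials are orthogonal and $\|X_0^{i_0}X_1^{i_1}X_2^{i_2}\|^2=\frac{2\,i_0!\,i_1!\,i_2!}{(d+2)!}$ when $i_0+i_1+i_2=d$, and with the Gaussian probability measure of density $\pi^{-N_d}e^{-\|P\|^2}$; $\mathbb{P}$ is the probability for $P$ random with this law. $V_P=\{P=0\}\subset\mathbb{CP}^2$, $\mathbb{C}^2$ is identified with $\{X_0\neq0\}$ by $(z_1,z_2)\mapsto[1:z_1:z_2]$, and $\mathrm{Log}:(z_1,z_2)\in(\mathbb{C}^\times)^2\mapsto(\ln|z_1|,\ln|z_2|)\in\mathbb{R}^2$, so that $\mathrm{Log}^{-1}(t)=\{|z_1|=e^{t_1},|z_2|=e^{t_2}\}$.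 *)

theory Defs
  imports "HOL-Probability.Probability"
begin

subsection \<open>Homogeneous polynomials in three variables\<close>

text \<open>
  A homogeneous complex polynomial of degree \<open>d\<close> in \<open>X\<^sub>0, X\<^sub>1, X\<^sub>2\<close> is represented by
  its family of coefficients, indexed by the exponent triples \<open>(i\<^sub>0, i\<^sub>1, i\<^sub>2)\<close> of total degree \<open>d\<close>
  (and extensional, that is \<open>undefined\<close>, off that index set).
\<close>

definition hom_exps :: "nat \<Rightarrow> (nat \<times> nat \<times> nat) set" where
  "hom_exps d = {(i0, i1, i2). i0 + i1 + i2 = d}"

type_synonym hpoly = "nat \<times> nat \<times> nat \<Rightarrow> complex"

definition H0 :: "nat \<Rightarrow> hpoly set" where
  "H0 d = hom_exps d \<rightarrow>\<^sub>E UNIV"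

definition hpoly_eval :: "nat \<Rightarrow> hpoly \<Rightarrow> complex \<times> complex \<times> complex \<Rightarrow> complex" where
  "hpoly_eval d P = (\<lambda>(x0, x1, x2).
     \<Sum>(i0, i1, i2)\<in>hom_exps d. P (i0, i1, i2) * x0 ^ i0 * x1 ^ i1 * x2 ^ i2)"

definition dim_H0 :: "nat \<Rightarrow> nat" where
  "dim_H0 d = (d + 1) * (d + 2) div 2"

subsection \<open>The Hermitian product and the Gaussian measure\<close>

definition monom_sqnorm :: "nat \<Rightarrow> nat \<times> nat \<times> nat \<Rightarrow> real" where
  "monom_sqnorm d = (\<lambda>(i0, i1, i2). 2 * fact i0 * fact i1 * fact i2 / fact (d + 2))"

definition herm_prod :: "nat \<Rightarrow> hpoly \<Rightarrow> hpoly \<Rightarrow> complex" where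
  "herm_prod d P Q = (\<Sum>m\<in>hom_exps d. complex_of_real (monom_sqnorm d m) * P m * cnj (Q m))"

definition herm_norm :: "nat \<Rightarrow> hpoly \<Rightarrow> real" where
  "herm_norm d P = sqrt (Re (herm_prod d P P))"

text \<open>
  The Lebesgue measure on \<open>H0 d\<close> normalised by the Hermitian product: the image of the product
  Lebesgue measure under coordinates in the orthonormal basis of rescaled monomials
  \<open>X\<^sup>m / sqrt (monom_sqnorm d m)\<close>.
\<close>

definition lebesgue_H0 :: "nat \<Rightarrow> hpoly measure" where
  "lebesgue_H0 d =
     distr (\<Pi>\<^sub>M m\<in>hom_exps d. lborel) (\<Pi>\<^sub>M m\<in>hom_exps d. borel)
       (\<lambda>c. \<lambda>m\<in>hom_exps d. c m / complex_of_real (sqrt (monom_sqnorm d m)))"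

definition gauss_H0 :: "nat \<Rightarrow> hpoly measure" where
  "gauss_H0 d =
     density (lebesgue_H0 d) (\<lambda>P. ennreal (exp (- (herm_norm d P)\<^sup>2) / pi ^ dim_H0 d))"

lemma finite_hom_exps [simp]: "finite (hom_exps d)"
  by (rule finite_subset[of _ "{..d} \<times> {..d} \<times> {..d}"]) (auto simp: hom_exps_def)

lemma card_hom_exps: "card (hom_exps d) = dim_H0 d"
proof -
  have eq: "hom_exps d = (\<lambda>(i, j). (i, j, d - i - j)) ` (SIGMA i:{..d}. {..d - i})"
    by (auto simp: hom_exps_def image_iff)
  have "inj_on (\<lambda>(i, j). (i, j, d - i - j)) (SIGMA i:{..d}. {..d - i})"
    by (auto simp: inj_on_def)
  then have "card (hom_exps d) = (\<Sum>i\<le>d. Suc (d - i))"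
    by (simp add: eq card_image)
  also have "\<dots> = (\<Sum>i\<le>d. Suc i)"
    using sum.nat_diff_reindex[of Suc "Suc d"] by (simp add: lessThan_Suc_atMost)
  also have "2 * \<dots> = (d + 1) * (d + 2)"
    by (induction d) auto
  then have "(\<Sum>i\<le>d. Suc i) = dim_H0 d"
    by (simp add: dim_H0_def)
  finally show ?thesis .
qed

lemma monom_sqnorm_pos: "monom_sqnorm d m > 0"
  by (auto simp: monom_sqnorm_def split: prod.splits)

lemma herm_norm_sq:
  "(herm_norm d P)\<^sup>2 = (\<Sum>m\<in>hom_exps d. monom_sqnorm d m * (cmod (P m))\<^sup>2)"
proof -
  have "Re (herm_prod d P P) = (\<Sum>m\<in>hom_exps d. monom_sqnorm d m * (cmod (P m))\<^sup>2)"
    by (simp add: herm_prod_def mult.assoc complex_norm_square [symmetric] del: of_real_power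
        flip: of_real_mult of_real_power)
  moreover have "(\<Sum>m\<in>hom_exps d. monom_sqnorm d m * (cmod (P m))\<^sup>2) \<ge> 0"
    by (intro sum_nonneg mult_nonneg_nonneg) (auto intro: less_imp_le monom_sqnorm_pos)
  ultimately show ?thesis
    by (simp add: herm_norm_def)
qed

lemma space_gauss_H0: "space (gauss_H0 d) = H0 d"
  by (simp add: gauss_H0_def lebesgue_H0_def H0_def space_PiM)

lemma nn_integral_gauss_complex: "(\<integral>\<^sup>+z. ennreal (exp (- (cmod z)\<^sup>2)) \<partial>lborel) = ennreal pi"
proof -
  have "has_bochner_integral lborel (\<lambda>x::real. exp (- x\<^sup>2)) (sqrt pi)"
    using has_bochner_integral_even_function[OF gaussian_moment_0] by simp
  then have 1: "(\<integral>\<^sup>+x. ennreal (exp (- x\<^sup>2)) \<partial>lborel) = ennreal (sqrt pi)"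
    by (subst nn_integral_eq_integral) (auto simp: has_bochner_integral_iff)
  have "(\<integral>\<^sup>+z. ennreal (exp (- (cmod z)\<^sup>2)) \<partial>lborel) =
        (\<integral>\<^sup>+z. (\<Prod>b\<in>Basis. ennreal (exp (- (inner (z::complex) b)\<^sup>2))) \<partial>lborel)"
    by (intro nn_integral_cong)
       (auto simp: Basis_complex_def cmod_power2 ennreal_mult'[symmetric] exp_add[symmetric])
  also have "\<dots> = ennreal (sqrt pi) * ennreal (sqrt pi)"
    by (subst nn_integral_lborel_prod) (auto simp: Basis_complex_def 1)
  also have "\<dots> = ennreal pi"
    by (simp add: ennreal_mult[symmetric])
  finally show ?thesis .
qed

lemma prob_space_gauss_H0: "prob_space (gauss_H0 d)"
proof
  interpret product_sigma_finite "\<lambda>_::nat \<times> nat \<times> nat. lborel :: complex measure" ..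
  let ?I = "hom_exps d"
  let ?g = "\<lambda>c. \<lambda>m\<in>?I. c m / complex_of_real (sqrt (monom_sqnorm d m))"
  have g [measurable]: "?g \<in> (\<Pi>\<^sub>M m\<in>?I. lborel) \<rightarrow>\<^sub>M (\<Pi>\<^sub>M m\<in>?I. borel)"
    by measurable
  have f [measurable]: "(\<lambda>P. ennreal (exp (- (herm_norm d P)\<^sup>2) / pi ^ dim_H0 d))
      \<in> borel_measurable (\<Pi>\<^sub>M m\<in>?I. borel)"
    unfolding herm_norm_sq by measurable
  have "sets (lebesgue_H0 d) = sets (\<Pi>\<^sub>M m\<in>?I. borel)"
    by (simp add: lebesgue_H0_def)
  then have f': "(\<lambda>P. ennreal (exp (- (herm_norm d P)\<^sup>2) / pi ^ dim_H0 d))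
      \<in> borel_measurable (lebesgue_H0 d)"
    using f measurable_cong_sets by blast
  have eq: "exp (- (herm_norm d (?g c))\<^sup>2) / pi ^ dim_H0 d =
      (\<Prod>m\<in>?I. exp (- (cmod (c m))\<^sup>2) / pi)" for c
  proof -
    have "(herm_norm d (?g c))\<^sup>2 = (\<Sum>m\<in>?I. (cmod (c m))\<^sup>2)"
      unfolding herm_norm_sq
      by (intro sum.cong) (use monom_sqnorm_pos[of d] in
        \<open>auto simp: norm_divide power_divide less_imp_le less_imp_neq[THEN not_sym]\<close>)
    then show ?thesis
      by (simp add: exp_sum prod_dividef card_hom_exps sum_negf[symmetric])
  qed
  have "emeasure (gauss_H0 d) (space (gauss_H0 d)) =
      (\<integral>\<^sup>+P. ennreal (exp (- (herm_norm d P)\<^sup>2) / pi ^ dim_H0 d) \<partial>lebesgue_H0 d)"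
    unfolding gauss_H0_def
    by (subst emeasure_density[OF f']) (auto intro!: nn_integral_cong)
  also have "\<dots> = (\<integral>\<^sup>+c. ennreal (exp (- (herm_norm d (?g c))\<^sup>2) / pi ^ dim_H0 d)
      \<partial>(\<Pi>\<^sub>M m\<in>?I. lborel))"
    unfolding lebesgue_H0_def by (rule nn_integral_distr[OF g f'[unfolded lebesgue_H0_def]])
  also have "\<dots> = (\<integral>\<^sup>+c. (\<Prod>m\<in>?I. ennreal (exp (- (cmod (c m))\<^sup>2) / pi)) \<partial>(\<Pi>\<^sub>M m\<in>?I. lborel))"
    unfolding eq by (simp add: prod_ennreal)
  also have "\<dots> = (\<Prod>m\<in>?I. \<integral>\<^sup>+z. ennreal (exp (- (cmod z)\<^sup>2) / pi) \<partial>lborel)"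
    by (rule product_nn_integral_prod) auto
  also have "(\<integral>\<^sup>+z. ennreal (exp (- (cmod z)\<^sup>2) / pi) \<partial>lborel) = 1"
    by (simp add: divide_ennreal[symmetric] nn_integral_divide nn_integral_gauss_complex
        ennreal_divide_self)
  finally show "emeasure (gauss_H0 d) (space (gauss_H0 d)) = 1"
    by simp
qed

subsection \<open>The projective plane, the curve of a polynomial, and the map Log\<close>

definition proj_rel :: "((complex \<times> complex \<times> complex) \<times> (complex \<times> complex \<times> complex)) set" where
  "proj_rel = {((x0, x1, x2), (y0, y1, y2)).
     (x0, x1, x2) \<noteq> (0, 0, 0) \<and> (\<exists>c. c \<noteq> 0 \<and> y0 = c * x0 \<and> y1 = c * x1 \<and> y2 = c * x2)}"

definition CP2 :: "(complex \<times> complex \<times> complex) set set" where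
  "CP2 = (UNIV - {(0, 0, 0)}) // proj_rel"

definition V :: "nat \<Rightarrow> hpoly \<Rightarrow> (complex \<times> complex \<times> complex) set set" where
  "V d P = {p \<in> CP2. \<forall>x\<in>p. hpoly_eval d P x = 0}"

definition affine_chart :: "complex \<times> complex \<Rightarrow> (complex \<times> complex \<times> complex) set" where
  "affine_chart = (\<lambda>(z1, z2). proj_rel `` {(1, z1, z2)})"

lemma proj_rel_equiv: "equiv (UNIV - {(0, 0, 0)}) proj_rel"
proof (rule equivI)
  show "refl_on (UNIV - {(0, 0, 0)}) proj_rel"
    by (auto simp: refl_on_def proj_rel_def intro!: exI[of _ 1])
  show "proj_rel \<subseteq> (UNIV - {(0, 0, 0)}) \<times> (UNIV - {(0, 0, 0)})"
    by (auto simp: proj_rel_def)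
  show "sym proj_rel"
    by (rule symI, clarsimp simp: proj_rel_def) (metis divide_self_if mult.assoc mult.left_neutral divide_inverse mult.commute inverse_nonzero_iff_nonzero)
  show "trans proj_rel"
    by (rule transI, clarsimp simp: proj_rel_def) (metis mult.assoc mult_eq_0_iff)
qed

lemma hpoly_eval_scale:
  "hpoly_eval d P (c * x0, c * x1, c * x2) = c ^ d * hpoly_eval d P (x0, x1, x2)"
  by (auto simp: hpoly_eval_def hom_exps_def sum_distrib_left power_mult_distrib power_add
      intro!: sum.cong)

lemma affine_chart_in_V_iff:
  "affine_chart (z1, z2) \<in> V d P \<longleftrightarrow> hpoly_eval d P (1, z1, z2) = 0"
proof -
  have CP: "proj_rel `` {(1, z1, z2)} \<in> CP2"
    unfolding CP2_def by (rule quotientI) auto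
  have self: "(1, z1, z2) \<in> proj_rel `` {(1, z1, z2)}"
    by (auto simp: proj_rel_def intro!: exI[of _ 1])
  have "hpoly_eval d P y = 0"
    if y: "y \<in> proj_rel `` {(1, z1, z2)}" and 0: "hpoly_eval d P (1, z1, z2) = 0" for y
  proof -
    from y obtain c where "y = (c * 1, c * z1, c * z2)"
      by (auto simp: proj_rel_def)
    then show ?thesis
      by (simp only: hpoly_eval_scale 0 mult_zero_right)
  qed
  with CP self show ?thesis
    unfolding V_def affine_chart_def by auto
qed

definition Log :: "complex \<times> complex \<Rightarrow> real \<times> real" where
  "Log = (\<lambda>(z1, z2). (ln (cmod z1), ln (cmod z2)))"

text \<open>\<open>Log\<close> is only meant on pairs of non-zero numbers, so its fibres are taken there
  (\<open>ln 0 = 0\<close> by convention).\<close>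

definition Log_fibre :: "real \<times> real \<Rightarrow> (complex \<times> complex) set" where
  "Log_fibre t = Log -` {t} \<inter> ((UNIV - {0}) \<times> (UNIV - {0}))"

definition meet_prob :: "nat \<Rightarrow> real \<times> real \<Rightarrow> real" where
  "meet_prob d t = \<P>(P in gauss_H0 d. affine_chart ` Log_fibre t \<inter> V d P \<noteq> {})"

definition gamma_const :: "real \<Rightarrow> real" where
  "gamma_const \<kappa> = 1 - exp (- (2 ^ 11 * 3 ^ 3 / \<kappa>\<^sup>2)) * (1 - exp (- 1 / 2))"

end

theory Submission
  imports Defs
begin

text \<open>
  On the torus \<open>Log\<inverse>(t)\<close>, in angular coordinates, the random polynomial is up to scaling the Gaussian
  trigonometric polynomial \<open>f(\<theta>) = \<Sum>\<^sub>m sqrt(p\<^sub>m) a\<^sub>m e\<^bsup>i m \<theta>\<^esup>\<close>, where \<open>p\<close> is a trinomial law whose correlation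
  function is the \<open>d\<close>-th power of \<open>c(\<theta>) = p0 + p1 e\<^bsup>i \<theta>1\<^esup> + p2 e\<^bsup>i \<theta>2\<^esup>\<close>. On the \<open>n \<times> n\<close> grid of the torus,
  with \<open>n\<^sup>2 = N\<close>, the correlations are at most \<open>d\<^sup>-\<^sup>4\<close>. At each grid point one places the barrier function
  \<open>\<phi> = 2/5 ell c\<^bsup>d-1\<^esup>\<close>, with \<open>ell\<close> vanishing there to first order and non-degenerately. A discrete
  Fourier transform over the residue classes of the exponents modulo \<open>n\<close> and the unitary invariance of
  the Gaussian give an exact decomposition \<open>f = R + \<Sum>\<^sub>j z\<^sub>j \<phi>\<^sub>j\<close> in which the \<open>z\<^sub>j\<close> are independent
  standard Gaussians, independent of \<open>R\<close>.

  If \<open>R\<close> is at most \<open>5\<close> near the \<open>j\<close>-th point and \<open>\<bar>z\<^sub>j\<bar> \<ge> 200\<close>, then \<open>f\<close> has a zero there by Brouwer's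
  theorem. An exponential moment bound for \<open>\<Sum>\<^sub>j sup \<bar>R\<bar>\<^sup>2\<close> shows that, outside an event of probability
  \<open>(2/e)\<^sup>N\<close>, \<open>R\<close> is moderate at half of the grid points; all \<open>\<bar>z\<^sub>j\<bar>\<close> at these points are below \<open>200\<close> with
  probability at most \<open>(1 - P(\<bar>z\<bar> \<ge> 200))\<^bsup>N/2\<^esup>\<close>. Since \<open>200\<^sup>2 < 2\<^bsup>11\<^esup> 3\<^sup>3\<close>, both are below \<open>\<gamma>(\<kappa>)\<^sup>N\<close>.
\<close>

subsection \<open>Gaussian vectors\<close>

text \<open>A zero has to be forced, so a barrier needs a stable zero at its grid point: with a
  large coefficient it dominates everything of moderate size a little away from that zero, whereas a
  function with a peak there would repel zeros. The obstacle is independence. The values of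
  \<open>f\<close> at the grid points are only nearly independent, while the bound is exponentially
  small in \<open>N\<close>, so an approximation by an independent model would have to be that
  accurate. The residue classes avoid any approximation: the Gaussians split off are exactly
  independent as soon as the squared barrier coefficients, before the Fourier transform, sum to at
  most \<open>1\<close> on each class. The decay of correlations serves only to bound such class
  sums and the influence of one barrier at the grid point of another; for the latter, coefficients
  beyond \<open>d\<close> are excluded by a third error event of negligible probability. What is
  known about \<open>R\<close> comes from \<open>f\<close> being \<open>R\<close> plus an
  independent symmetric term, so that convex functionals have a smaller mean at \<open>R\<close>
  than at \<open>f\<close>.\<close>

definition cgauss :: "complex measure" where
  "cgauss = density lborel (\<lambda>z. ennreal (exp (- (cmod z)\<^sup>2) / pi))"

abbreviation gauss_PiM :: "'i set \<Rightarrow> ('i \<Rightarrow> complex) measure" where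
  "gauss_PiM I \<equiv> \<Pi>\<^sub>M i\<in>I. cgauss"

abbreviation lborel_PiM :: "'i set \<Rightarrow> ('i \<Rightarrow> complex) measure" where
  "lborel_PiM I \<equiv> \<Pi>\<^sub>M i\<in>I. lborel"

lemma sets_cgauss [measurable_cong]: "sets cgauss = sets borel"
  by (simp add: cgauss_def)

lemma space_cgauss [simp]: "space cgauss = UNIV"
  by (simp add: cgauss_def)

lemma nn_integral_cgauss:
  assumes [measurable]: "f \<in> borel_measurable borel"
  shows "(\<integral>\<^sup>+z. f z \<partial>cgauss) = (\<integral>\<^sup>+z. ennreal (exp (- (cmod z)\<^sup>2) / pi) * f z \<partial>lborel)"
  unfolding cgauss_def by (rule nn_integral_density) auto

lemma nn_integral_gauss_complex_div_pi:
  "(\<integral>\<^sup>+z. ennreal (exp (- (cmod z)\<^sup>2) / pi) \<partial>lborel) = 1"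
  by (simp add: divide_ennreal[symmetric] nn_integral_divide nn_integral_gauss_complex)

lemma prob_space_cgauss: "prob_space cgauss"
proof
  show "emeasure cgauss (space cgauss) = 1"
    unfolding cgauss_def
    by (subst emeasure_density) (auto simp: nn_integral_gauss_complex_div_pi)
qed

interpretation cgauss: prob_space cgauss
  by (rule prob_space_cgauss)

interpretation gauss_PiM: product_sigma_finite "\<lambda>_. cgauss"
  by unfold_locales

interpretation lborel_PiM: product_sigma_finite "\<lambda>_. lborel :: complex measure"
  by unfold_locales

text \<open>Completing the square, \<open>- |z|^2 + 2 Re (z cnj u) = |u|^2 - |z - u|^2\<close>,
  leaves a translated Gaussian density of total mass \<open>1\<close>.\<close>

lemma nn_integral_cgauss_exp_linear:
  "(\<integral>\<^sup>+z. ennreal (exp (2 * Re (z * cnj u))) \<partial>cgauss) = ennreal (exp ((cmod u)\<^sup>2))"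
proof -
  have "(\<integral>\<^sup>+z. ennreal (exp (2 * Re (z * cnj u))) \<partial>cgauss) =
      (\<integral>\<^sup>+z. ennreal (exp (- (cmod z)\<^sup>2) / pi) * ennreal (exp (2 * Re (z * cnj u))) \<partial>lborel)"
    by (rule nn_integral_cgauss) measurable
  also have "\<dots> = (\<integral>\<^sup>+z. ennreal (exp ((cmod u)\<^sup>2)) * ennreal (exp (- (cmod (- u + z))\<^sup>2) / pi) \<partial>lborel)"
  proof (rule nn_integral_cong)
    fix z
    have "- (cmod z)\<^sup>2 + 2 * Re (z * cnj u) = (cmod u)\<^sup>2 - (cmod (- u + z))\<^sup>2"
      unfolding cmod_power2 by (simp add: power2_eq_square algebra_simps)
    then show "ennreal (exp (- (cmod z)\<^sup>2) / pi) * ennreal (exp (2 * Re (z * cnj u))) =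
        ennreal (exp ((cmod u)\<^sup>2)) * ennreal (exp (- (cmod (- u + z))\<^sup>2) / pi)"
      by (simp add: ennreal_mult[symmetric] exp_add[symmetric] del: times_complex.sel)
  qed
  also have "\<dots> = ennreal (exp ((cmod u)\<^sup>2)) * (\<integral>\<^sup>+z. ennreal (exp (- (cmod (- u + z))\<^sup>2) / pi) \<partial>lborel)"
    by (rule nn_integral_cmult) measurable
  also have "(\<integral>\<^sup>+z. ennreal (exp (- (cmod (- u + z))\<^sup>2) / pi) \<partial>lborel) =
      (\<integral>\<^sup>+z. ennreal (exp (- (cmod z)\<^sup>2) / pi) \<partial>distr lborel borel ((+) (- u)))"
    by (subst nn_integral_distr) auto
  also have "\<dots> = 1"
    by (simp add: lborel_distr_plus nn_integral_gauss_complex_div_pi)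
  finally show ?thesis by simp
qed

text \<open>Rescaling \<open>z\<close> by \<open>c = 1 / sqrt (1 - \<tau>)\<close> turns the
  integrand into the Gaussian density; the plane has real dimension two, hence the Jacobian
  \<open>c^2\<close>.\<close>

lemma nn_integral_cgauss_exp_square:
  assumes "\<tau> < 1"
  shows "(\<integral>\<^sup>+z. ennreal (exp (\<tau> * (cmod z)\<^sup>2)) \<partial>cgauss) = ennreal (1 / (1 - \<tau>))"
proof -
  define c where "c = 1 / sqrt (1 - \<tau>)"
  have c: "c > 0" "c\<^sup>2 = 1 / (1 - \<tau>)"
    using assms by (auto simp: c_def power_divide)
  have "(\<integral>\<^sup>+z. ennreal (exp (\<tau> * (cmod z)\<^sup>2)) \<partial>cgauss) =
      (\<integral>\<^sup>+z. ennreal (exp (- (cmod z)\<^sup>2) / pi) * ennreal (exp (\<tau> * (cmod z)\<^sup>2)) \<partial>lborel)"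
    by (rule nn_integral_cgauss) measurable
  also have "\<dots> = (\<integral>\<^sup>+z. ennreal (exp (- ((1 - \<tau>) * (cmod z)\<^sup>2)) / pi) \<partial>lborel)"
    by (intro nn_integral_cong) (simp add: ennreal_mult[symmetric] exp_add[symmetric] algebra_simps)
  also have "\<dots> = (\<integral>\<^sup>+z. ennreal (exp (- ((1 - \<tau>) * (cmod z)\<^sup>2)) / pi)
      \<partial>density (distr lborel borel (\<lambda>x. 0 + (\<Sum>j\<in>Basis. (c * (x \<bullet> j)) *\<^sub>R j)))
         (\<lambda>_. ennreal (\<Prod>j\<in>(Basis :: complex set). \<bar>c\<bar>)))"
    using c by (subst lborel_affine_euclidean[of "\<lambda>_. c" 0, symmetric]) auto
  also have "\<dots> = (\<integral>\<^sup>+z. ennreal (c\<^sup>2) * ennreal (exp (- ((1 - \<tau>) * (cmod (\<Sum>j\<in>Basis. (c * (z \<bullet> j)) *\<^sub>R j))\<^sup>2)) / pi) \<partial>lborel)"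
    by (subst nn_integral_density, simp, simp, subst nn_integral_distr) (auto simp: power2_eq_square ennreal_mult)
  also have "\<dots> = (\<integral>\<^sup>+z. ennreal (c\<^sup>2) * ennreal (exp (- (cmod z)\<^sup>2) / pi) \<partial>lborel)"
  proof (rule nn_integral_cong)
    fix z :: complex
    have "(\<Sum>j\<in>Basis. (c * (z \<bullet> j)) *\<^sub>R j) = c *\<^sub>R z"
      by (simp add: scaleR_scaleR[symmetric] scaleR_sum_right[symmetric] euclidean_representation del: scaleR_scaleR)
    then show "ennreal (c\<^sup>2) * ennreal (exp (- ((1 - \<tau>) * (cmod (\<Sum>j\<in>Basis. (c * (z \<bullet> j)) *\<^sub>R j))\<^sup>2)) / pi) =
      ennreal (c\<^sup>2) * ennreal (exp (- (cmod z)\<^sup>2) / pi)"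
      using c assms by (simp add: power_mult_distrib)
  qed
  also have "\<dots> = ennreal (c\<^sup>2)"
    by (subst nn_integral_cmult) (auto simp: nn_integral_gauss_complex_div_pi)
  finally show ?thesis using c by simp
qed

text \<open>Chernoff's bound with exponent \<open>1 / 2\<close>, at which the exponential moment of
  \<open>|z|^2\<close> equals \<open>2\<close>.\<close>

lemma emeasure_cgauss_tail_le:
  assumes "t \<ge> 0"
  shows "emeasure cgauss {z. cmod z > t} \<le> ennreal (2 * exp (- t\<^sup>2 / 2))"
proof -
  have "emeasure cgauss {z. cmod z > t} = (\<integral>\<^sup>+z. indicator {z. cmod z > t} z \<partial>cgauss)"
    by (subst nn_integral_indicator) auto
  also have "\<dots> \<le> (\<integral>\<^sup>+z. ennreal (exp (- t\<^sup>2 / 2)) * ennreal (exp (1/2 * (cmod z)\<^sup>2)) \<partial>cgauss)"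
    using assms
    by (intro nn_integral_mono)
      (auto simp: indicator_def ennreal_mult[symmetric] exp_add[symmetric] ennreal_1[symmetric] power_mono simp del: ennreal_1)
  also have "\<dots> = ennreal (exp (- t\<^sup>2 / 2)) * ennreal 2"
    by (subst nn_integral_cmult) (use nn_integral_cgauss_exp_square[of "1/2"] in auto)
  finally show ?thesis by (subst (asm) ennreal_mult[symmetric]) (auto simp: mult.commute)
qed

text \<open>The density is bounded below on the unit square with lower left corner \<open>t\<close>,
  which has area \<open>1\<close> and lies in the tail.\<close>

lemma measure_cgauss_tail_ge:
  assumes "t \<ge> 0"
  shows "measure cgauss {z. cmod z \<ge> t} \<ge> exp (- ((t + 1)\<^sup>2 + 1)) / pi"
proof -
  define B where "B = cbox (Complex t 0) (Complex (t + 1) 1)"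
  have B: "t \<le> cmod z \<and> (cmod z)\<^sup>2 \<le> (t + 1)\<^sup>2 + 1" if "z \<in> B" for z
  proof -
    from that have *: "t \<le> Re z" "Re z \<le> t + 1" "0 \<le> Im z" "Im z \<le> 1"
      by (auto simp: B_def in_cbox_complex_iff)
    have "Re z \<le> cmod z" by (rule complex_Re_le_cmod)
    moreover have "(Re z)\<^sup>2 \<le> (t + 1)\<^sup>2" "(Im z)\<^sup>2 \<le> 1\<^sup>2"
      using * assms by (intro power_mono; simp)+
    ultimately show ?thesis using * by (auto simp: cmod_power2)
  qed
  have "emeasure lborel B = ennreal 1"
    unfolding B_def by (subst emeasure_lborel_cbox) (auto simp: Basis_complex_def)
  then have "ennreal (exp (- ((t + 1)\<^sup>2 + 1)) / pi) = (\<integral>\<^sup>+z. ennreal (exp (- ((t + 1)\<^sup>2 + 1)) / pi) * indicator B z \<partial>lborel)"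
    by (subst nn_integral_cmult_indicator) (auto simp: B_def)
  also have "\<dots> \<le> (\<integral>\<^sup>+z. ennreal (exp (- (cmod z)\<^sup>2) / pi) * indicator {z. cmod z \<ge> t} z \<partial>lborel)"
    using B by (intro nn_integral_mono)
      (auto simp: indicator_def intro!: ennreal_leI divide_right_mono dest!: B)
  also have "\<dots> = emeasure cgauss {z. cmod z \<ge> t}"
    unfolding cgauss_def by (subst emeasure_density) auto
  finally show ?thesis
    by (simp add: cgauss.emeasure_eq_measure)
qed

section \<open>Invariance of Lebesgue and Gaussian product measures\<close>

lemma nn_integral_lborel_PiM_translate:
  fixes h :: "'i \<Rightarrow> complex"
  assumes "finite I" and [measurable]: "f \<in> borel_measurable (lborel_PiM I)"
  shows "(\<integral>\<^sup>+x. f (\<lambda>i\<in>I. x i + h i) \<partial>lborel_PiM I) = (\<integral>\<^sup>+x. f x \<partial>lborel_PiM I)"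
proof -
  have [measurable]: "(\<lambda>x. \<lambda>i\<in>I. x i + h i) \<in> lborel_PiM I \<rightarrow>\<^sub>M lborel_PiM I"
    by measurable
  have "distr (lborel_PiM I) (lborel_PiM I) (\<lambda>x. \<lambda>i\<in>I. x i + h i) = lborel_PiM I"
  proof (rule lborel_PiM.PiM_eqI)
    fix A :: "'i \<Rightarrow> complex set" assume A: "\<And>i. i \<in> I \<Longrightarrow> A i \<in> sets lborel"
    have "emeasure (distr (lborel_PiM I) (lborel_PiM I) (\<lambda>x. \<lambda>i\<in>I. x i + h i)) (Pi\<^sub>E I A) =
        emeasure (lborel_PiM I) ((\<lambda>x. \<lambda>i\<in>I. x i + h i) -` Pi\<^sub>E I A \<inter> space (lborel_PiM I))"
      using A assms by (subst emeasure_distr) (auto intro!: sets_PiM_I_finite)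
    also have "(\<lambda>x. \<lambda>i\<in>I. x i + h i) -` Pi\<^sub>E I A \<inter> space (lborel_PiM I) = Pi\<^sub>E I (\<lambda>i. (+) (h i) -` A i)"
      by (auto simp: space_PiM PiE_iff add.commute)
    also have "emeasure (lborel_PiM I) \<dots> = (\<Prod>i\<in>I. emeasure lborel ((+) (h i) -` A i))"
      using A assms by (subst lborel_PiM.emeasure_PiM) (auto intro!: measurable_sets_borel[of _ borel])
    also have "\<dots> = (\<Prod>i\<in>I. emeasure (distr lborel borel ((+) (h i))) (A i))"
      using A by (intro prod.cong refl) (subst emeasure_distr, auto)
    finally show "emeasure (distr (lborel_PiM I) (lborel_PiM I) (\<lambda>x. \<lambda>i\<in>I. x i + h i)) (Pi\<^sub>E I A) =
        (\<Prod>i\<in>I. emeasure lborel (A i))"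
      unfolding lborel_distr_plus .
  qed (use assms in auto)
  then have "(\<integral>\<^sup>+x. f x \<partial>lborel_PiM I) =
      (\<integral>\<^sup>+x. f x \<partial>distr (lborel_PiM I) (lborel_PiM I) (\<lambda>x. \<lambda>i\<in>I. x i + h i))"
    by simp
  also have "\<dots> = (\<integral>\<^sup>+x. f (\<lambda>i\<in>I. x i + h i) \<partial>lborel_PiM I)"
    by (rule nn_integral_distr) measurable
  finally show ?thesis by simp
qed

lemma gauss_PiM_eq_density:
  assumes "finite I"
  shows "gauss_PiM I = density (lborel_PiM I) (\<lambda>x. ennreal (exp (- (\<Sum>i\<in>I. (cmod (x i))\<^sup>2)) / pi ^ card I))"
    (is "_ = density _ ?D")
proof (rule gauss_PiM.PiM_eqI[symmetric])
  have D: "?D x = (\<Prod>i\<in>I. ennreal (exp (- (cmod (x i))\<^sup>2) / pi))" for x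
    using assms by (simp add: prod_ennreal exp_sum prod_dividef sum_negf[symmetric])
  have D': "?D = (\<lambda>x. \<Prod>i\<in>I. ennreal (exp (- (cmod (x i))\<^sup>2) / pi))"
    by (intro ext D)
  show "sets (density (lborel_PiM I) ?D) = sets (gauss_PiM I)"
    by (simp cong: sets_PiM_cong add: sets_cgauss)
  fix A :: "'a \<Rightarrow> complex set" assume A: "\<And>i. i \<in> I \<Longrightarrow> A i \<in> sets cgauss"
  then have A' [measurable]: "\<And>i. i \<in> I \<Longrightarrow> A i \<in> sets borel" by (simp add: sets_cgauss)
  have "emeasure (density (lborel_PiM I) ?D) (Pi\<^sub>E I A) = (\<integral>\<^sup>+x. ?D x * indicator (Pi\<^sub>E I A) x \<partial>lborel_PiM I)"
    using A' assms by (subst emeasure_density) (auto intro!: sets_PiM_I_finite)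
  also have "\<dots> = (\<integral>\<^sup>+x. (\<Prod>i\<in>I. ennreal (exp (- (cmod (x i))\<^sup>2) / pi) * indicator (A i) (x i)) \<partial>lborel_PiM I)"
  proof (rule nn_integral_cong)
    fix x assume "x \<in> space (lborel_PiM I)"
    then have "indicator (Pi\<^sub>E I A) x = (\<Prod>i\<in>I. indicator (A i) (x i) :: ennreal)"
      using assms by (auto simp: space_PiM PiE_iff indicator_def prod_zero_iff)
    then show "?D x * indicator (Pi\<^sub>E I A) x = (\<Prod>i\<in>I. ennreal (exp (- (cmod (x i))\<^sup>2) / pi) * indicator (A i) (x i))"
      unfolding D by (simp add: prod.distrib)
  qed
  also have "\<dots> = (\<Prod>i\<in>I. \<integral>\<^sup>+z. ennreal (exp (- (cmod z)\<^sup>2) / pi) * indicator (A i) z \<partial>lborel)"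
    using assms by (rule lborel_PiM.product_nn_integral_prod) (use A' in auto)
  also have "\<dots> = (\<Prod>i\<in>I. emeasure cgauss (A i))"
    unfolding cgauss_def by (intro prod.cong refl) (use A' in \<open>subst emeasure_density; auto\<close>)
  finally show "emeasure (density (lborel_PiM I) ?D) (Pi\<^sub>E I A) = (\<Prod>i\<in>I. emeasure cgauss (A i))" .
qed (fact assms)

text \<open>Both sides, multiplied by the integral of a \<open>T\<close>-invariant weight, are turned into each
  other by translating each of the two variables once.\<close>

lemma nn_integral_lborel_PiM_isometry:
  fixes T T' :: "('i \<Rightarrow> complex) \<Rightarrow> 'i \<Rightarrow> complex"
  assumes fin: "finite I"
    and T [measurable]: "T \<in> lborel_PiM I \<rightarrow>\<^sub>M lborel_PiM I"
    and T': "\<And>y. y \<in> extensional I \<Longrightarrow> T' y \<in> extensional I" "\<And>y. y \<in> extensional I \<Longrightarrow> T (T' y) = y"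
    and add: "\<And>x y. x \<in> extensional I \<Longrightarrow> y \<in> extensional I \<Longrightarrow> T (\<lambda>i\<in>I. x i + y i) = (\<lambda>i\<in>I. T x i + T y i)"
    and norm: "\<And>x. x \<in> extensional I \<Longrightarrow> (\<Sum>i\<in>I. (cmod (T x i))\<^sup>2) = (\<Sum>i\<in>I. (cmod (x i))\<^sup>2)"
    and f [measurable]: "f \<in> borel_measurable (lborel_PiM I)"
  shows "(\<integral>\<^sup>+x. f (T x) \<partial>lborel_PiM I) = (\<integral>\<^sup>+x. f x \<partial>lborel_PiM I)"
proof -
  let ?L = "lborel_PiM I"
  interpret L: sigma_finite_measure ?L by (rule lborel_PiM.sigma_finite[OF fin])
  interpret LL: pair_sigma_finite ?L ?L ..
  have [simp]: "space ?L = extensional I" by (auto simp: space_PiM PiE_def)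
  have Text: "T x \<in> extensional I" if "x \<in> extensional I" for x
    using measurable_space[OF T] that by auto
  define w where "w = (\<lambda>x :: 'i \<Rightarrow> complex. ennreal (exp (- (\<Sum>i\<in>I. (cmod (x i))\<^sup>2))))"
  have [measurable]: "w \<in> borel_measurable ?L"
    unfolding w_def by measurable
  have wm: "w (\<lambda>i\<in>I. - T x i) = w x" if "x \<in> extensional I" for x
    using norm[OF that] by (simp add: w_def)
  have [measurable]: "(\<lambda>z. T (fst z) i) \<in> borel_measurable (?L \<Otimes>\<^sub>M ?L)" if "i \<in> I" for i
    using measurable_compose[OF measurable_compose[OF measurable_fst T] measurable_component_singleton[OF that]]
    by simp
  have [measurable]: "(\<lambda>x. T x i) \<in> borel_measurable ?L" if "i \<in> I" for i
    using measurable_compose[OF T measurable_component_singleton[OF that]] by simp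
  have meas1 [measurable]: "(\<lambda>z. f (T (fst z)) * w (\<lambda>i\<in>I. snd z i + - T (fst z) i)) \<in> borel_measurable (?L \<Otimes>\<^sub>M ?L)"
    by measurable
  have meas2 [measurable]: "(\<lambda>z. f (\<lambda>i\<in>I. snd z i + T (fst z) i) * w (fst z)) \<in> borel_measurable (?L \<Otimes>\<^sub>M ?L)"
    by measurable
  have "(\<integral>\<^sup>+x. f (T x) \<partial>?L) * (\<integral>\<^sup>+y. w y \<partial>?L) = (\<integral>\<^sup>+x. f (T x) * (\<integral>\<^sup>+y. w y \<partial>?L) \<partial>?L)"
    by (rule nn_integral_multc[symmetric]) measurable
  also have "\<dots> = (\<integral>\<^sup>+x. f (T x) * (\<integral>\<^sup>+y. w (\<lambda>i\<in>I. y i + - T x i) \<partial>?L) \<partial>?L)"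
    by (subst nn_integral_lborel_PiM_translate[OF fin, where f = w]) auto
  also have "\<dots> = (\<integral>\<^sup>+x. \<integral>\<^sup>+y. f (T x) * w (\<lambda>i\<in>I. y i + - T x i) \<partial>?L \<partial>?L)"
    by (intro nn_integral_cong nn_integral_cmult[symmetric]) measurable
  also have "\<dots> = (\<integral>\<^sup>+y. \<integral>\<^sup>+x. f (T x) * w (\<lambda>i\<in>I. y i + - T x i) \<partial>?L \<partial>?L)"
    using LL.Fubini'[of "\<lambda>x y. f (T x) * w (\<lambda>i\<in>I. y i + - T x i)"] meas1 by (simp add: case_prod_unfold)
  also have "\<dots> = (\<integral>\<^sup>+y. \<integral>\<^sup>+x. f (\<lambda>i\<in>I. y i + T x i) * w x \<partial>?L \<partial>?L)"
  proof (rule nn_integral_cong)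
    fix y assume "y \<in> space ?L"
    then have y: "y \<in> extensional I" by simp
    \<comment> \<open>The right inverse enters here: shifting \<open>x\<close> by
      \<open>T' y\<close> replaces \<open>T x\<close> by \<open>y + T x\<close>, so the argument of
      the weight becomes \<open>- T x\<close>, and norm preservation gives
      \<open>w x\<close>.\<close>
    have "(\<integral>\<^sup>+x. f (T x) * w (\<lambda>i\<in>I. y i + - T x i) \<partial>?L) =
      (\<integral>\<^sup>+x. f (T (\<lambda>i\<in>I. x i + T' y i)) * w (\<lambda>i\<in>I. y i + - T (\<lambda>i\<in>I. x i + T' y i) i) \<partial>?L)"
      using y by (intro nn_integral_lborel_PiM_translate[OF fin, where f = "\<lambda>x. f (T x) * w (\<lambda>i\<in>I. y i + - T x i)", symmetric]) measurable
    also have "\<dots> = (\<integral>\<^sup>+x. f (\<lambda>i\<in>I. y i + T x i) * w x \<partial>?L)"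
    proof (rule nn_integral_cong)
      fix x assume "x \<in> space ?L"
      then have x: "x \<in> extensional I" by simp
      have 1: "T (\<lambda>i\<in>I. x i + T' y i) = (\<lambda>i\<in>I. y i + T x i)"
        by (subst add[OF x T'(1)[OF y]]) (simp add: T'(2)[OF y] add.commute cong: restrict_cong)
      have 2: "(\<lambda>i\<in>I. y i + - T (\<lambda>i\<in>I. x i + T' y i) i) = (\<lambda>i\<in>I. - T x i)"
        unfolding 1 by (auto simp: restrict_def)
      show "f (T (\<lambda>i\<in>I. x i + T' y i)) * w (\<lambda>i\<in>I. y i + - T (\<lambda>i\<in>I. x i + T' y i) i) =
          f (\<lambda>i\<in>I. y i + T x i) * w x"
        unfolding 2 wm[OF x] unfolding 1 ..
    qed
    finally show "(\<integral>\<^sup>+x. f (T x) * w (\<lambda>i\<in>I. y i + - T x i) \<partial>?L) = (\<integral>\<^sup>+x. f (\<lambda>i\<in>I. y i + T x i) * w x \<partial>?L)" .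
  qed
  also have "\<dots> = (\<integral>\<^sup>+x. \<integral>\<^sup>+y. f (\<lambda>i\<in>I. y i + T x i) * w x \<partial>?L \<partial>?L)"
    using LL.Fubini'[of "\<lambda>x y. f (\<lambda>i\<in>I. y i + T x i) * w x"] meas2 by (simp add: case_prod_unfold)
  also have "\<dots> = (\<integral>\<^sup>+x. (\<integral>\<^sup>+y. f (\<lambda>i\<in>I. y i + T x i) \<partial>?L) * w x \<partial>?L)"
    by (intro nn_integral_cong nn_integral_multc) measurable
  also have "\<dots> = (\<integral>\<^sup>+x. (\<integral>\<^sup>+y. f y \<partial>?L) * w x \<partial>?L)"
    by (subst nn_integral_lborel_PiM_translate[OF fin f]) auto
  also have "\<dots> = (\<integral>\<^sup>+y. f y \<partial>?L) * (\<integral>\<^sup>+x. w x \<partial>?L)"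
    by (rule nn_integral_cmult) measurable
  finally have *: "(\<integral>\<^sup>+x. f (T x) \<partial>?L) * (\<integral>\<^sup>+y. w y \<partial>?L) = (\<integral>\<^sup>+y. f y \<partial>?L) * (\<integral>\<^sup>+x. w x \<partial>?L)" .
  \<comment> \<open>The total mass of the weight is \<open>pi ^ card I\<close>, neither zero nor
    infinite, so it cancels from both sides of the identity.\<close>
  have "(\<integral>\<^sup>+y. w y \<partial>?L) = (\<integral>\<^sup>+x. (\<Prod>i\<in>I. ennreal (exp (- (cmod (x i))\<^sup>2))) \<partial>?L)"
    unfolding w_def using fin by (simp add: prod_ennreal exp_sum sum_negf[symmetric])
  also have "\<dots> = (\<Prod>i\<in>I. ennreal pi)"
    using fin by (subst lborel_PiM.product_nn_integral_prod) (auto simp: nn_integral_gauss_complex)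
  also have "\<dots> = ennreal (pi ^ card I)"
    by (simp add: ennreal_power)
  finally show ?thesis
    using * by (simp add: mult.commute[of _ "ennreal _"] ennreal_mult_cancel_left)
qed

text \<open>The Gaussian density depends on the norm alone, which \<open>T\<close> preserves; the
  Lebesgue case is applied to the density times \<open>f\<close>.\<close>

lemma nn_integral_gauss_PiM_isometry:
  fixes T T' :: "('i \<Rightarrow> complex) \<Rightarrow> 'i \<Rightarrow> complex"
  assumes fin: "finite I"
    and T: "T \<in> gauss_PiM I \<rightarrow>\<^sub>M gauss_PiM I"
    and T': "\<And>y. y \<in> extensional I \<Longrightarrow> T' y \<in> extensional I" "\<And>y. y \<in> extensional I \<Longrightarrow> T (T' y) = y"
    and add: "\<And>x y. x \<in> extensional I \<Longrightarrow> y \<in> extensional I \<Longrightarrow> T (\<lambda>i\<in>I. x i + y i) = (\<lambda>i\<in>I. T x i + T y i)"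
    and norm: "\<And>x. x \<in> extensional I \<Longrightarrow> (\<Sum>i\<in>I. (cmod (T x i))\<^sup>2) = (\<Sum>i\<in>I. (cmod (x i))\<^sup>2)"
    and f: "f \<in> borel_measurable (gauss_PiM I)"
  shows "(\<integral>\<^sup>+x. f (T x) \<partial>gauss_PiM I) = (\<integral>\<^sup>+x. f x \<partial>gauss_PiM I)"
proof -
  let ?L = "lborel_PiM I"
  define D where "D = (\<lambda>x :: 'i \<Rightarrow> complex. ennreal (exp (- (\<Sum>i\<in>I. (cmod (x i))\<^sup>2)) / pi ^ card I))"
  have [measurable]: "D \<in> borel_measurable ?L" unfolding D_def by measurable
  have sets: "sets (gauss_PiM I) = sets ?L"
    by (intro sets_PiM_cong) (auto simp: sets_cgauss)
  have T2 [measurable]: "T \<in> ?L \<rightarrow>\<^sub>M ?L"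
    using T by (simp add: measurable_cong_sets[OF sets sets])
  have f2 [measurable]: "f \<in> borel_measurable ?L"
    using f by (simp add: measurable_cong_sets[OF sets refl])
  have "(\<integral>\<^sup>+x. f (T x) \<partial>gauss_PiM I) = (\<integral>\<^sup>+x. D x * f (T x) \<partial>?L)"
    unfolding gauss_PiM_eq_density[OF fin] D_def by (rule nn_integral_density) auto
  also have "\<dots> = (\<integral>\<^sup>+x. D (T x) * f (T x) \<partial>?L)"
    by (intro nn_integral_cong) (auto simp: D_def norm space_PiM PiE_def)
  also have "\<dots> = (\<integral>\<^sup>+x. D x * f x \<partial>?L)"
    by (rule nn_integral_lborel_PiM_isometry[OF fin T2 T' add norm, where f = "\<lambda>x. D x * f x"]) auto
  also have "\<dots> = (\<integral>\<^sup>+x. f x \<partial>gauss_PiM I)"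
    unfolding gauss_PiM_eq_density[OF fin] D_def by (rule nn_integral_density[symmetric]) auto
  finally show ?thesis .
qed

lemma prob_space_gauss_PiM: "prob_space (gauss_PiM I)"
  by (intro prob_space_PiM prob_space_cgauss)

lemma borel_measurable_cnj [measurable]: "cnj \<in> borel_measurable borel"
  by (intro borel_measurable_continuous_onI continuous_intros)

lemma space_gauss_PiM [simp]: "space (gauss_PiM I) = extensional I"
  by (auto simp: space_PiM PiE_def)

lemma sum_norm_square_unitary:
  fixes F :: "'i \<Rightarrow> 'i \<Rightarrow> complex"
  assumes fin: "finite K"
    and F1: "\<And>j l. j \<in> K \<Longrightarrow> l \<in> K \<Longrightarrow> (\<Sum>k\<in>K. F k j * cnj (F k l)) = (if j = l then 1 else 0)"
  shows "(\<Sum>k\<in>K. (cmod (\<Sum>j\<in>K. F k j * x j))\<^sup>2) = (\<Sum>j\<in>K. (cmod (x j))\<^sup>2)"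
proof -
  have "complex_of_real (\<Sum>k\<in>K. (cmod (\<Sum>j\<in>K. F k j * x j))\<^sup>2) =
      (\<Sum>k\<in>K. (\<Sum>j\<in>K. F k j * x j) * (\<Sum>l\<in>K. cnj (F k l) * cnj (x l)))"
    unfolding of_real_sum complex_norm_square by simp
  also have "\<dots> = (\<Sum>k\<in>K. \<Sum>j\<in>K. \<Sum>l\<in>K. x j * cnj (x l) * (F k j * cnj (F k l)))"
    by (simp add: sum_product algebra_simps)
  also have "\<dots> = (\<Sum>j\<in>K. \<Sum>k\<in>K. \<Sum>l\<in>K. x j * cnj (x l) * (F k j * cnj (F k l)))"
    by (rule sum.swap)
  also have "\<dots> = (\<Sum>j\<in>K. \<Sum>l\<in>K. \<Sum>k\<in>K. x j * cnj (x l) * (F k j * cnj (F k l)))"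
    by (intro sum.cong refl sum.swap)
  also have "\<dots> = (\<Sum>j\<in>K. \<Sum>l\<in>K. x j * cnj (x l) * (if j = l then 1 else 0))"
    by (simp add: sum_distrib_left[symmetric] F1)
  also have "\<dots> = complex_of_real (\<Sum>j\<in>K. (cmod (x j))\<^sup>2)"
    unfolding of_real_sum complex_norm_square using fin
    by (simp add: if_distrib[of "\<lambda>x. _ * x"] cong: if_cong)
  finally show ?thesis
    by (simp only: of_real_eq_iff)
qed

text \<open>\<open>F1\<close> makes the map an isometry, and \<open>F2\<close> makes its adjoint a
  right inverse.\<close>

lemma nn_integral_gauss_PiM_unitary:
  fixes F :: "'i \<Rightarrow> 'i \<Rightarrow> complex"
  assumes fin: "finite K"
    and F1: "\<And>j l. j \<in> K \<Longrightarrow> l \<in> K \<Longrightarrow> (\<Sum>k\<in>K. F k j * cnj (F k l)) = (if j = l then 1 else 0)"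
    and F2: "\<And>k l. k \<in> K \<Longrightarrow> l \<in> K \<Longrightarrow> (\<Sum>j\<in>K. F k j * cnj (F l j)) = (if k = l then 1 else 0)"
    and f: "f \<in> borel_measurable (gauss_PiM K)"
  shows "(\<integral>\<^sup>+z. f (\<lambda>k\<in>K. \<Sum>j\<in>K. F k j * z j) \<partial>gauss_PiM K) = (\<integral>\<^sup>+z. f z \<partial>gauss_PiM K)"
proof (rule nn_integral_gauss_PiM_isometry[OF fin, where T' = "\<lambda>y. \<lambda>j\<in>K. \<Sum>k\<in>K. cnj (F k j) * y k"])
  fix y :: "'i \<Rightarrow> complex" assume y: "y \<in> extensional K"
  show "(\<lambda>k\<in>K. \<Sum>j\<in>K. F k j * (\<lambda>j\<in>K. \<Sum>k\<in>K. cnj (F k j) * y k) j) = y"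
  proof (rule extensionalityI[OF restrict_extensional y])
    fix k assume k: "k \<in> K"
    have "(\<Sum>j\<in>K. F k j * (\<Sum>l\<in>K. cnj (F l j) * y l)) = (\<Sum>l\<in>K. \<Sum>j\<in>K. F k j * cnj (F l j) * y l)"
      by (subst sum.swap) (simp add: sum_distrib_left mult.assoc)
    also have "\<dots> = (\<Sum>l\<in>K. (if k = l then 1 else 0) * y l)"
      using k by (simp add: sum_distrib_right[symmetric] F2)
    also have "\<dots> = y k"
      using k fin by (simp add: if_distrib[of "\<lambda>x. x * _"] cong: if_cong)
    finally show "(\<lambda>k\<in>K. \<Sum>j\<in>K. F k j * (\<lambda>j\<in>K. \<Sum>k\<in>K. cnj (F k j) * y k) j) k = y k"
      using k by simp
  qed
next
  fix x :: "'i \<Rightarrow> complex"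
  show "(\<Sum>i\<in>K. (cmod ((\<lambda>k\<in>K. \<Sum>j\<in>K. F k j * x j) i))\<^sup>2) = (\<Sum>i\<in>K. (cmod (x i))\<^sup>2)"
    using sum_norm_square_unitary[OF fin F1, of x] by simp
next
  show "(\<lambda>z. \<lambda>k\<in>K. \<Sum>j\<in>K. F k j * z j) \<in> gauss_PiM K \<rightarrow>\<^sub>M gauss_PiM K"
    by measurable
qed (use f in \<open>auto simp: fun_eq_iff sum.distrib[symmetric] algebra_simps intro!: sum.cong\<close>)

section \<open>Splitting independent Gaussians off a Gaussian vector\<close>

text \<open>On each plane spanned by the coordinate \<open>k\<close> and the unit vector \<open>w / \<nu>\<^sub>k\<close> of the block
  \<open>\<kappa> = k\<close>, the map \<open>W\<close> of the proof is the reflection with matrix \<open>((-c, \<nu>), (\<nu>, c))\<close>.\<close>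

lemma gauss_PiM_block_split:
  fixes I K :: "'i set" and \<kappa> :: "'i \<Rightarrow> 'i" and w :: "'i \<Rightarrow> complex"
  assumes I: "finite I" and K: "finite K" and disj: "I \<inter> K = {}"
    and \<kappa>: "\<And>m. m \<in> I \<Longrightarrow> \<kappa> m \<in> K"
    and w: "\<And>k. k \<in> K \<Longrightarrow> (\<Sum>m | m \<in> I \<and> \<kappa> m = k. (cmod (w m))\<^sup>2) \<le> 1"
  obtains R where "R \<in> gauss_PiM I \<rightarrow>\<^sub>M gauss_PiM I"
    and "\<And>f. f \<in> borel_measurable (gauss_PiM I) \<Longrightarrow> (\<integral>\<^sup>+a. f a \<partial>gauss_PiM I) =
      (\<integral>\<^sup>+a. \<integral>\<^sup>+z. f (\<lambda>m\<in>I. R a m + z (\<kappa> m) * w m) \<partial>gauss_PiM K \<partial>gauss_PiM I)"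
proof -
  define bl where "bl = (\<lambda>k. {m. m \<in> I \<and> \<kappa> m = k})"
  define \<nu> where "\<nu> = (\<lambda>k. sqrt (\<Sum>m\<in>bl k. (cmod (w m))\<^sup>2))"
  define c where "c = (\<lambda>k. sqrt (1 - (\<nu> k)\<^sup>2))"
  \<comment> \<open>Where \<open>\<nu>\<close> is zero, \<open>u\<close> is zero by the convention
    for division; \<open>W\<close> then only changes the sign of the coordinate \<open>k\<close> and
    fixes the block.\<close>
  define u where "u = (\<lambda>m. w m / complex_of_real (\<nu> (\<kappa> m)))"
  define A where "A = (\<lambda>(x :: 'i \<Rightarrow> complex) k. \<Sum>m\<in>bl k. cnj (u m) * x m)"
  \<comment> \<open>The component along \<open>u\<close> is to become
    \<open>c * A + \<nu> * x k\<close>; this is the amount to be added to it.\<close>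
  define \<beta> where "\<beta> = (\<lambda>(x :: 'i \<Rightarrow> complex) k. (c k - 1) * A x k + \<nu> k * x k)"
  define W where "W = (\<lambda>x :: 'i \<Rightarrow> complex. \<lambda>i\<in>I \<union> K. if i \<in> K then \<nu> i * A x i - c i * x i
     else x i + \<beta> x (\<kappa> i) * u i)"
  have bl [simp]: "finite (bl k)" "bl k \<subseteq> I" for k using I by (auto simp: bl_def)
  have \<nu>2: "(\<nu> k)\<^sup>2 = (\<Sum>m\<in>bl k. (cmod (w m))\<^sup>2)" for k
    by (simp add: \<nu>_def sum_nonneg)
  have c2: "(c k)\<^sup>2 + (\<nu> k)\<^sup>2 = 1" if "k \<in> K" for k
    using w[OF that] \<nu>2[of k] by (simp add: c_def bl_def)
  have w0: "w m = 0" if "\<nu> (\<kappa> m) = 0" "m \<in> I" for m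
  proof -
    have "(\<Sum>m\<in>bl (\<kappa> m). (cmod (w m))\<^sup>2) = 0" using \<nu>2[of "\<kappa> m"] that by simp
    then have "\<forall>m'\<in>bl (\<kappa> m). (cmod (w m'))\<^sup>2 = 0"
      by (subst (asm) sum_nonneg_eq_0_iff) auto
    then show ?thesis using that by (simp add: bl_def)
  qed
  have \<nu>u: "\<nu> (\<kappa> m) * u m = w m" if "m \<in> I" for m
    using w0[OF _ that] by (auto simp: u_def)
  have u2: "(\<Sum>m\<in>bl k. (cmod (u m))\<^sup>2) = (if \<nu> k = 0 then 0 else 1)" for k
  proof -
    have "(\<Sum>m\<in>bl k. (cmod (u m))\<^sup>2) = (\<Sum>m\<in>bl k. (cmod (w m))\<^sup>2 / (\<nu> k)\<^sup>2)"
      by (intro sum.cong) (auto simp: u_def bl_def norm_divide power_divide)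
    also have "\<dots> = (\<nu> k)\<^sup>2 / (\<nu> k)\<^sup>2" by (simp add: sum_divide_distrib[symmetric] \<nu>2[symmetric])
    finally show ?thesis by simp
  qed
  have A0: "A x k = 0" if "\<nu> k = 0" for x k
    unfolding A_def using that by (intro sum.neutral) (auto simp: u_def bl_def)
  have c0: "c k = 1" if "\<nu> k = 0" for k using that by (simp add: c_def)
  have AW: "A (W x) k = c k * A x k + \<nu> k * x k" if "k \<in> K" for x :: "'i \<Rightarrow> complex" and k
  proof -
    have "A (W x) k = (\<Sum>m\<in>bl k. cnj (u m) * x m + \<beta> x k * complex_of_real ((cmod (u m))\<^sup>2))"
      unfolding A_def W_def using disj
      by (intro sum.cong refl) (auto simp: bl_def complex_norm_square algebra_simps disjoint_iff simp del: of_real_power)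
    also have "\<dots> = A x k + \<beta> x k * complex_of_real (\<Sum>m\<in>bl k. (cmod (u m))\<^sup>2)"
      by (simp add: sum.distrib A_def sum_distrib_left)
    finally show ?thesis unfolding u2 using A0[of k x] c0[of k]
      by (cases "\<nu> k = 0") (auto simp: \<beta>_def algebra_simps)
  qed
  have WK: "W x k = \<nu> k * A x k - c k * x k" if "k \<in> K" for x :: "'i \<Rightarrow> complex" and k
    using that by (simp add: W_def)
  have WI: "W x m = x m + \<beta> x (\<kappa> m) * u m" if "m \<in> I" for x :: "'i \<Rightarrow> complex" and m
    using that disj by (auto simp: W_def)
  \<comment> \<open>An involution serves as its own right inverse in the isometry lemma.\<close>
  have WW: "W (W x) = x" if x: "x \<in> extensional (I \<union> K)" for x
  proof (rule extensionalityI[OF _ x])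
    show "W (W x) \<in> extensional (I \<union> K)" by (simp add: W_def)
    fix i assume "i \<in> I \<union> K"
    then consider "i \<in> K" | "i \<in> I" "i \<notin> K" by auto
    then show "W (W x) i = x i"
    proof cases
      case 1
      have "(complex_of_real (c i))\<^sup>2 + (complex_of_real (\<nu> i))\<^sup>2 = 1"
        using c2[OF 1] by (simp flip: of_real_power of_real_add)
      then show ?thesis unfolding WK[OF 1, of "W x"] AW[OF 1] WK[OF 1, of x] by algebra
    next
      case 2
      define k where "k = \<kappa> i"
      have k: "k \<in> K" using 2 \<kappa> by (simp add: k_def)
      have "(complex_of_real (c k))\<^sup>2 + (complex_of_real (\<nu> k))\<^sup>2 = 1"
        using c2[OF k] by (simp flip: of_real_power of_real_add)
      then have "\<beta> x k + \<beta> (W x) k = 0"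
        unfolding \<beta>_def AW[OF k] WK[OF k, of x] of_real_diff of_real_1 by algebra
      then show ?thesis unfolding WI[OF 2(1), of "W x"] WI[OF 2(1), of x] k_def[symmetric]
        by (simp add: add.assoc distrib_right[symmetric])
    qed
  qed
  have Wadd: "W (\<lambda>i\<in>I \<union> K. x i + y i) = (\<lambda>i\<in>I \<union> K. W x i + W y i)" for x y :: "'i \<Rightarrow> complex"
  proof -
    have "A (\<lambda>i\<in>I \<union> K. x i + y i) k = A x k + A y k" for k
      unfolding A_def sum.distrib[symmetric]
      by (intro sum.cong refl) (auto simp: algebra_simps bl_def)
    then show ?thesis
      unfolding W_def using \<kappa> by (auto simp: restrict_def \<beta>_def algebra_simps intro!: ext)
  qed
  have Wnorm: "(\<Sum>i\<in>I \<union> K. (cmod (W x i))\<^sup>2) = (\<Sum>i\<in>I \<union> K. (cmod (x i))\<^sup>2)" for x :: "'i \<Rightarrow> complex"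
  proof -
    have split: "(\<Sum>i\<in>I \<union> K. g i) = (\<Sum>k\<in>K. g k + (\<Sum>m\<in>bl k. g m))" for g :: "'i \<Rightarrow> real"
    proof -
      have "(\<Sum>m\<in>I. g m) = (\<Sum>k\<in>K. \<Sum>m\<in>bl k. g m)"
        unfolding bl_def by (rule sum.group[symmetric]) (use I K \<kappa> in auto)
      then show ?thesis using I K disj by (simp add: sum.union_disjoint sum.distrib)
    qed
    have "(cmod (W x k))\<^sup>2 + (\<Sum>m\<in>bl k. (cmod (W x m))\<^sup>2) = (cmod (x k))\<^sup>2 + (\<Sum>m\<in>bl k. (cmod (x m))\<^sup>2)"
      if k: "k \<in> K" for k
    proof -
      have "(\<Sum>m\<in>bl k. (cmod (W x m))\<^sup>2) =
          (\<Sum>m\<in>bl k. (cmod (x m))\<^sup>2 + 2 * Re (cnj (\<beta> x k) * (cnj (u m) * x m)) + (cmod (\<beta> x k))\<^sup>2 * (cmod (u m))\<^sup>2)"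
      proof (rule sum.cong[OF refl])
        fix m assume "m \<in> bl k"
        then have "W x m = x m + \<beta> x k * u m" using WI by (auto simp: bl_def)
        then show "(cmod (W x m))\<^sup>2 = (cmod (x m))\<^sup>2 + 2 * Re (cnj (\<beta> x k) * (cnj (u m) * x m)) + (cmod (\<beta> x k))\<^sup>2 * (cmod (u m))\<^sup>2"
          unfolding cmod_power2 by (simp add: power2_eq_square algebra_simps)
      qed
      also have "\<dots> = (\<Sum>m\<in>bl k. (cmod (x m))\<^sup>2) + 2 * Re (cnj (\<beta> x k) * A x k) + (cmod (\<beta> x k))\<^sup>2 * (if \<nu> k = 0 then 0 else 1)"
        by (simp only: sum.distrib A_def sum_distrib_left[symmetric] Re_sum[symmetric] u2)
      finally have 1: "(\<Sum>m\<in>bl k. (cmod (W x m))\<^sup>2) = (\<Sum>m\<in>bl k. (cmod (x m))\<^sup>2) +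
        2 * Re (cnj (\<beta> x k) * A x k) + (cmod (\<beta> x k))\<^sup>2 * (if \<nu> k = 0 then 0 else 1)" .
      have 2: "(cmod (\<nu> k * A x k - c k * x k))\<^sup>2 + 2 * Re (cnj (\<beta> x k) * A x k) + (cmod (\<beta> x k))\<^sup>2 * (if \<nu> k = 0 then 0 else 1) = (cmod (x k))\<^sup>2"
      proof (cases "\<nu> k = 0")
        case True
        then show ?thesis by (simp add: A0 c0)
      next
        case False
        have r: "(\<nu>' * a - c' * y)\<^sup>2 + 2 * ((c' - 1) * a + \<nu>' * y) * a + ((c' - 1) * a + \<nu>' * y)\<^sup>2 = y\<^sup>2"
          if "c'\<^sup>2 + \<nu>'\<^sup>2 = 1" for a y c' \<nu>' :: real
          using that by algebra
        show ?thesis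
          using False r[OF c2[OF k], of "Re (A x k)" "Re (x k)"] r[OF c2[OF k], of "Im (A x k)" "Im (x k)"]
          unfolding cmod_power2 by (simp add: \<beta>_def algebra_simps)
      qed
      show ?thesis unfolding 1 WK[OF k] using 2 by linarith
    qed
    then show ?thesis unfolding split by (intro sum.cong) auto
  qed
  have Wm: "W \<in> gauss_PiM (I \<union> K) \<rightarrow>\<^sub>M gauss_PiM (I \<union> K)"
    unfolding W_def
  proof (rule measurable_restrict)
    fix i assume i: "i \<in> I \<union> K"
    have comp [measurable]: "(\<lambda>x. x m) \<in> borel_measurable (gauss_PiM (I \<union> K))" if "m \<in> I \<union> K" for m
      using that measurable_component_singleton[OF that, of "\<lambda>_. cgauss"] by (simp cong: measurable_cong_sets add: measurable_cong_sets[OF refl sets_cgauss])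
    have Ak [measurable]: "(\<lambda>x. A x k) \<in> borel_measurable (gauss_PiM (I \<union> K))" for k
      unfolding A_def by (intro borel_measurable_sum borel_measurable_times borel_measurable_const comp)
        (use bl(2)[of k] in blast)
    have [measurable]: "(\<lambda>x. \<beta> x k) \<in> borel_measurable (gauss_PiM (I \<union> K))" if "k \<in> K" for k
      unfolding \<beta>_def
      by (intro borel_measurable_add borel_measurable_times borel_measurable_const Ak comp) (use that in auto)
    show "(\<lambda>x. if i \<in> K then \<nu> i * A x i - c i * x i else x i + \<beta> x (\<kappa> i) * u i) \<in> gauss_PiM (I \<union> K) \<rightarrow>\<^sub>M cgauss"
      unfolding measurable_cong_sets[OF refl sets_cgauss] using i \<kappa> by (cases "i \<in> K") auto
  qed
  \<comment> \<open>This is the part of \<open>W\<close> that does not see the fresh coordinates: in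
    each block it shrinks the component along \<open>u\<close> by the factor \<open>c\<close>. The
    fresh Gaussian restores the lost variance \<open>\<nu>^2\<close>, since
    \<open>\<nu> * u = w\<close>.\<close>
  define R where "R = (\<lambda>a :: 'i \<Rightarrow> complex. \<lambda>m\<in>I. a m + (c (\<kappa> m) - 1) * A a (\<kappa> m) * u m)"
  have Rm: "R \<in> gauss_PiM I \<rightarrow>\<^sub>M gauss_PiM I"
    unfolding R_def
  proof (rule measurable_restrict)
    fix i assume i: "i \<in> I"
    have comp [measurable]: "(\<lambda>x. x m) \<in> borel_measurable (gauss_PiM I)" if "m \<in> I" for m
      using that measurable_component_singleton[OF that, of "\<lambda>_. cgauss"] by (simp add: measurable_cong_sets[OF refl sets_cgauss])
    have [measurable]: "(\<lambda>x. A x k) \<in> borel_measurable (gauss_PiM I)" for k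
      unfolding A_def by (intro borel_measurable_sum borel_measurable_times borel_measurable_const comp)
        (use bl(2)[of k] in blast)
    show "(\<lambda>a. a i + (c (\<kappa> i) - 1) * A a (\<kappa> i) * u i) \<in> gauss_PiM I \<rightarrow>\<^sub>M cgauss"
      unfolding measurable_cong_sets[OF refl sets_cgauss] using i by measurable
  qed
  have split: "(\<integral>\<^sup>+a. f a \<partial>gauss_PiM I) =
      (\<integral>\<^sup>+a. \<integral>\<^sup>+z. f (\<lambda>m\<in>I. R a m + z (\<kappa> m) * w m) \<partial>gauss_PiM K \<partial>gauss_PiM I)"
    if f [measurable]: "f \<in> borel_measurable (gauss_PiM I)" for f
  proof -
    interpret gK: prob_space "gauss_PiM K" by (rule prob_space_gauss_PiM)
    have rm [measurable]: "(\<lambda>x. restrict x I) \<in> gauss_PiM (I \<union> K) \<rightarrow>\<^sub>M gauss_PiM I"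
      by (rule measurable_restrict_subset) auto
    have fr: "(\<lambda>x. f (restrict x I)) \<in> borel_measurable (gauss_PiM (I \<union> K))" by measurable
    have fW: "(\<lambda>x. f (restrict (W x) I)) \<in> borel_measurable (gauss_PiM (I \<union> K))"
      using Wm by measurable
    \<comment> \<open>The coordinates in \<open>K\<close> are adjoined as fresh Gaussians that
      \<open>f\<close> ignores, which gives \<open>W\<close> room to mix them in without changing
      the integral.\<close>
    have "(\<integral>\<^sup>+x. f (restrict x I) \<partial>gauss_PiM (I \<union> K)) =
        (\<integral>\<^sup>+a. \<integral>\<^sup>+z. f (restrict (merge I K (a, z)) I) \<partial>gauss_PiM K \<partial>gauss_PiM I)"
      using gauss_PiM.product_nn_integral_fold[OF disj I K fr] .
    also have "\<dots> = (\<integral>\<^sup>+a. f a \<partial>gauss_PiM I)"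
      using gK.emeasure_space_1 disj
      by (intro nn_integral_cong) (auto simp: extensional_restrict)
    finally have 1: "(\<integral>\<^sup>+a. f a \<partial>gauss_PiM I) = (\<integral>\<^sup>+x. f (restrict x I) \<partial>gauss_PiM (I \<union> K))" ..
    also have "\<dots> = (\<integral>\<^sup>+x. f (restrict (W x) I) \<partial>gauss_PiM (I \<union> K))"
      by (rule nn_integral_gauss_PiM_isometry[symmetric, where T' = W])
        (use I K Wm WW Wadd Wnorm fr in \<open>auto simp: W_def\<close>)
    also have "\<dots> = (\<integral>\<^sup>+a. \<integral>\<^sup>+z. f (restrict (W (merge I K (a, z))) I) \<partial>gauss_PiM K \<partial>gauss_PiM I)"
      using gauss_PiM.product_nn_integral_fold[OF disj I K fW] .
    also have "\<dots> = (\<integral>\<^sup>+a. \<integral>\<^sup>+z. f (\<lambda>m\<in>I. R a m + z (\<kappa> m) * w m) \<partial>gauss_PiM K \<partial>gauss_PiM I)"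
    proof (intro nn_integral_cong arg_cong[where f = f])
      fix a z :: "'i \<Rightarrow> complex"
      have mI: "merge I K (a, z) m = a m" if "m \<in> I" for m using that by (simp add: merge_def)
      have mK: "merge I K (a, z) k = z k" if "k \<in> K" for k using that disj by (auto simp: merge_def)
      have Am: "A (merge I K (a, z)) k = A a k" for k
        unfolding A_def by (intro sum.cong refl) (simp add: bl_def mI)
      show "restrict (W (merge I K (a, z))) I = (\<lambda>m\<in>I. R a m + z (\<kappa> m) * w m)"
      proof (rule restrict_ext)
        fix m assume m: "m \<in> I"
        show "W (merge I K (a, z)) m = R a m + z (\<kappa> m) * w m"
          unfolding WI[OF m] mI[OF m] \<nu>u[OF m, symmetric]
          using m by (simp add: \<beta>_def R_def Am mK[OF \<kappa>[OF m]] algebra_simps)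
      qed
    qed
    finally show ?thesis .
  qed
  show thesis by (rule that[OF Rm split])
qed

text \<open>The block Gaussians may be replaced by their image under the unitary \<open>F\<close>,
  which has the same law. Instead of one Gaussian per block there is then one per column of
  \<open>F\<close>, with coefficients \<open>F (\<kappa> m) j * w m\<close> spread over all blocks;
  no orthogonality of these coefficient vectors has to be checked.\<close>

lemma gauss_PiM_split:
  fixes I K :: "'i set" and \<kappa> :: "'i \<Rightarrow> 'i" and w :: "'i \<Rightarrow> complex" and F :: "'i \<Rightarrow> 'i \<Rightarrow> complex"
  assumes I: "finite I" and K: "finite K" and disj: "I \<inter> K = {}"
    and \<kappa>: "\<And>m. m \<in> I \<Longrightarrow> \<kappa> m \<in> K"
    and w: "\<And>k. k \<in> K \<Longrightarrow> (\<Sum>m | m \<in> I \<and> \<kappa> m = k. (cmod (w m))\<^sup>2) \<le> 1"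
    and F1: "\<And>j l. j \<in> K \<Longrightarrow> l \<in> K \<Longrightarrow> (\<Sum>k\<in>K. F k j * cnj (F k l)) = (if j = l then 1 else 0)"
    and F2: "\<And>k l. k \<in> K \<Longrightarrow> l \<in> K \<Longrightarrow> (\<Sum>j\<in>K. F k j * cnj (F l j)) = (if k = l then 1 else 0)"
  obtains R where "R \<in> gauss_PiM I \<rightarrow>\<^sub>M gauss_PiM I"
    and "\<And>f. f \<in> borel_measurable (gauss_PiM I) \<Longrightarrow> (\<integral>\<^sup>+a. f a \<partial>gauss_PiM I) =
      (\<integral>\<^sup>+a. \<integral>\<^sup>+z. f (\<lambda>m\<in>I. R a m + (\<Sum>j\<in>K. z j * (F (\<kappa> m) j * w m))) \<partial>gauss_PiM K \<partial>gauss_PiM I)"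
proof (rule gauss_PiM_block_split[OF I K disj \<kappa> w])
  fix R assume R: "R \<in> gauss_PiM I \<rightarrow>\<^sub>M gauss_PiM I"
    and split: "\<And>f. f \<in> borel_measurable (gauss_PiM I) \<Longrightarrow> (\<integral>\<^sup>+a. f a \<partial>gauss_PiM I) =
      (\<integral>\<^sup>+a. \<integral>\<^sup>+z. f (\<lambda>m\<in>I. R a m + z (\<kappa> m) * w m) \<partial>gauss_PiM K \<partial>gauss_PiM I)"
  have "(\<integral>\<^sup>+z. f (\<lambda>m\<in>I. R a m + z (\<kappa> m) * w m) \<partial>gauss_PiM K) =
      (\<integral>\<^sup>+z. f (\<lambda>m\<in>I. R a m + (\<Sum>j\<in>K. z j * (F (\<kappa> m) j * w m))) \<partial>gauss_PiM K)"
    if f [measurable]: "f \<in> borel_measurable (gauss_PiM I)" for f and a :: "'i \<Rightarrow> complex"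
  proof -
    have m: "(\<lambda>z. \<lambda>m\<in>I. R a m + z (\<kappa> m) * w m) \<in> gauss_PiM K \<rightarrow>\<^sub>M gauss_PiM I"
    proof (rule measurable_restrict)
      fix m assume "m \<in> I"
      then have [measurable]: "(\<lambda>z. z (\<kappa> m)) \<in> borel_measurable (gauss_PiM K)"
        using measurable_component_singleton[OF \<kappa>, of m "\<lambda>_. cgauss"]
        by (simp add: measurable_cong_sets[OF refl sets_cgauss])
      show "(\<lambda>z. R a m + z (\<kappa> m) * w m) \<in> gauss_PiM K \<rightarrow>\<^sub>M cgauss"
        unfolding measurable_cong_sets[OF refl sets_cgauss] by measurable
    qed
    have "(\<integral>\<^sup>+z. f (\<lambda>m\<in>I. R a m + z (\<kappa> m) * w m) \<partial>gauss_PiM K) =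
        (\<integral>\<^sup>+z. f (\<lambda>m\<in>I. R a m + (\<lambda>k\<in>K. \<Sum>j\<in>K. F k j * z j) (\<kappa> m) * w m) \<partial>gauss_PiM K)"
      by (rule nn_integral_gauss_PiM_unitary[OF K F1 F2,
            where f = "\<lambda>z. f (\<lambda>m\<in>I. R a m + z (\<kappa> m) * w m)", symmetric])
        (use m in measurable)
    also have "\<dots> = (\<integral>\<^sup>+z. f (\<lambda>m\<in>I. R a m + (\<Sum>j\<in>K. z j * (F (\<kappa> m) j * w m))) \<partial>gauss_PiM K)"
      by (intro nn_integral_cong arg_cong[where f = f] restrict_ext)
        (simp add: \<kappa> sum_distrib_right sum_distrib_left algebra_simps)
    finally show ?thesis .
  qed
  then show thesis using that[OF R] split by simp
qed

section \<open>Exponential moments of Gaussian vectors\<close>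

lemma nn_integral_gauss_PiM_exp_linear:
  assumes "finite I"
  shows "(\<integral>\<^sup>+a. ennreal (exp (2 * Re (\<Sum>m\<in>I. a m * cnj (g m)))) \<partial>gauss_PiM I) =
    ennreal (exp (\<Sum>m\<in>I. (cmod (g m))\<^sup>2))"
proof -
  have "(\<integral>\<^sup>+a. ennreal (exp (2 * Re (\<Sum>m\<in>I. a m * cnj (g m)))) \<partial>gauss_PiM I) =
      (\<integral>\<^sup>+a. (\<Prod>m\<in>I. ennreal (exp (2 * Re (a m * cnj (g m))))) \<partial>gauss_PiM I)"
    using assms by (simp add: prod_ennreal exp_sum[symmetric] sum_distrib_left del: times_complex.sel)
  also have "\<dots> = (\<Prod>m\<in>I. \<integral>\<^sup>+z. ennreal (exp (2 * Re (z * cnj (g m)))) \<partial>cgauss)"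
    by (rule gauss_PiM.product_nn_integral_prod[OF assms, where f = "\<lambda>m z. ennreal (exp (2 * Re (z * cnj (g m))))"])
      measurable
  also have "\<dots> = ennreal (exp (\<Sum>m\<in>I. (cmod (g m))\<^sup>2))"
    unfolding nn_integral_cgauss_exp_linear using assms by (simp add: prod_ennreal exp_sum)
  finally show ?thesis .
qed

lemma nn_integral_gauss_PiM_exp_square:
  assumes "finite I" "\<tau> < 1"
  shows "(\<integral>\<^sup>+a. ennreal (exp (\<tau> * (\<Sum>m\<in>I. (cmod (a m))\<^sup>2))) \<partial>gauss_PiM I) =
    ennreal ((1 / (1 - \<tau>)) ^ card I)"
proof -
  have "(\<integral>\<^sup>+a. ennreal (exp (\<tau> * (\<Sum>m\<in>I. (cmod (a m))\<^sup>2))) \<partial>gauss_PiM I) =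
      (\<integral>\<^sup>+a. (\<Prod>m\<in>I. ennreal (exp (\<tau> * (cmod (a m))\<^sup>2))) \<partial>gauss_PiM I)"
    using assms by (simp add: prod_ennreal exp_sum sum_distrib_left)
  also have "\<dots> = (\<Prod>m\<in>I. \<integral>\<^sup>+z. ennreal (exp (\<tau> * (cmod z)\<^sup>2)) \<partial>cgauss)"
    by (rule gauss_PiM.product_nn_integral_prod[OF assms(1), where f = "\<lambda>m z. ennreal (exp (\<tau> * (cmod z)\<^sup>2))"])
      measurable
  also have "\<dots> = ennreal ((1 / (1 - \<tau>)) ^ card I)"
    unfolding nn_integral_cgauss_exp_square[OF assms(2)] using assms by (simp add: ennreal_power)
  finally show ?thesis .
qed

text \<open>The Hubbard--Stratonovich trick \<open>exp \<bar>x\<bar>\<^sup>2 = E exp (2 Re (\<eta> cnj x))\<close> replaces a family of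
  linear forms by its adjoint, so only the operator norm matters.\<close>

lemma nn_integral_gauss_PiM_exp_quadratic_le:
  fixes c :: "'j \<Rightarrow> 'i \<Rightarrow> complex"
  assumes I: "finite I" and J: "finite J" and \<tau>: "0 \<le> \<tau>" "\<tau> * C < 1"
    and op: "\<And>\<eta>. (\<Sum>m\<in>I. (cmod (\<Sum>j\<in>J. \<eta> j * cnj (c j m)))\<^sup>2) \<le> C * (\<Sum>j\<in>J. (cmod (\<eta> j))\<^sup>2)"
  shows "(\<integral>\<^sup>+a. ennreal (exp (\<tau> * (\<Sum>j\<in>J. (cmod (\<Sum>m\<in>I. c j m * a m))\<^sup>2))) \<partial>gauss_PiM I) \<le>
    ennreal ((1 / (1 - \<tau> * C)) ^ card J)"
proof -
  define g where "g = (\<lambda>\<eta> m. sqrt \<tau> * (\<Sum>j\<in>J. \<eta> j * cnj (c j m)))"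
  interpret gI: sigma_finite_measure "gauss_PiM I" by (rule gauss_PiM.sigma_finite[OF I])
  interpret gJ: sigma_finite_measure "gauss_PiM J" by (rule gauss_PiM.sigma_finite[OF J])
  interpret gg: pair_sigma_finite "gauss_PiM J" "gauss_PiM I" ..
  have "(\<integral>\<^sup>+a. ennreal (exp (\<tau> * (\<Sum>j\<in>J. (cmod (\<Sum>m\<in>I. c j m * a m))\<^sup>2))) \<partial>gauss_PiM I) =
      (\<integral>\<^sup>+a. \<integral>\<^sup>+\<eta>. ennreal (exp (2 * Re (\<Sum>m\<in>I. a m * cnj (g \<eta> m)))) \<partial>gauss_PiM J \<partial>gauss_PiM I)"
  proof (rule nn_integral_cong)
    fix a :: "'i \<Rightarrow> complex"
    have "exp (\<tau> * (\<Sum>j\<in>J. (cmod (\<Sum>m\<in>I. c j m * a m))\<^sup>2)) =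
        exp (\<Sum>j\<in>J. (cmod (sqrt \<tau> * (\<Sum>m\<in>I. c j m * a m)))\<^sup>2)"
      using \<tau> by (subst norm_mult) (simp add: power_mult_distrib sum_distrib_left[symmetric])
    also have "ennreal \<dots> = (\<integral>\<^sup>+\<eta>. ennreal (exp (2 * Re (\<Sum>j\<in>J. \<eta> j * cnj (sqrt \<tau> * (\<Sum>m\<in>I. c j m * a m))))) \<partial>gauss_PiM J)"
      by (rule nn_integral_gauss_PiM_exp_linear[OF J, symmetric])
    also have "\<dots> = (\<integral>\<^sup>+\<eta>. ennreal (exp (2 * Re (\<Sum>m\<in>I. a m * cnj (g \<eta> m)))) \<partial>gauss_PiM J)"
    proof (rule nn_integral_cong)
      fix \<eta> :: "'j \<Rightarrow> complex"
      have "cnj (\<Sum>j\<in>J. \<eta> j * cnj (sqrt \<tau> * (\<Sum>m\<in>I. c j m * a m))) = (\<Sum>j\<in>J. \<Sum>m\<in>I. cnj (\<eta> j) * sqrt \<tau> * c j m * a m)"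
        by (simp add: sum_distrib_left mult.assoc)
      also have "\<dots> = (\<Sum>m\<in>I. \<Sum>j\<in>J. cnj (\<eta> j) * sqrt \<tau> * c j m * a m)"
        by (rule sum.swap)
      also have "\<dots> = (\<Sum>m\<in>I. a m * cnj (g \<eta> m))"
        by (simp add: g_def sum_distrib_left mult_ac)
      finally have "Re (\<Sum>j\<in>J. \<eta> j * cnj (sqrt \<tau> * (\<Sum>m\<in>I. c j m * a m))) = Re (\<Sum>m\<in>I. a m * cnj (g \<eta> m))"
        by (drule_tac arg_cong[where f = Re]) (simp only: cnj.sel)
      then show "ennreal (exp (2 * Re (\<Sum>j\<in>J. \<eta> j * cnj (sqrt \<tau> * (\<Sum>m\<in>I. c j m * a m))))) =
          ennreal (exp (2 * Re (\<Sum>m\<in>I. a m * cnj (g \<eta> m))))" by simp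
    qed
    finally show "ennreal (exp (\<tau> * (\<Sum>j\<in>J. (cmod (\<Sum>m\<in>I. c j m * a m))\<^sup>2))) =
        (\<integral>\<^sup>+\<eta>. ennreal (exp (2 * Re (\<Sum>m\<in>I. a m * cnj (g \<eta> m)))) \<partial>gauss_PiM J)" .
  qed
  \<comment> \<open>After the exchange the inner integrand is the exponential of a linear form in
    \<open>a\<close>; its integral involves the adjoint family \<open>g\<close>, to which
    \<open>op\<close> applies.\<close>
  also have "\<dots> = (\<integral>\<^sup>+\<eta>. \<integral>\<^sup>+a. ennreal (exp (2 * Re (\<Sum>m\<in>I. a m * cnj (g \<eta> m)))) \<partial>gauss_PiM I \<partial>gauss_PiM J)"
    by (rule gg.Fubini') (unfold g_def, measurable)
  also have "\<dots> = (\<integral>\<^sup>+\<eta>. ennreal (exp (\<Sum>m\<in>I. (cmod (g \<eta> m))\<^sup>2)) \<partial>gauss_PiM J)"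
    by (simp only: nn_integral_gauss_PiM_exp_linear[OF I])
  also have "\<dots> \<le> (\<integral>\<^sup>+\<eta>. ennreal (exp (\<tau> * C * (\<Sum>j\<in>J. (cmod (\<eta> j))\<^sup>2))) \<partial>gauss_PiM J)"
  proof (intro nn_integral_mono ennreal_leI)
    fix \<eta> :: "'j \<Rightarrow> complex"
    have "(\<Sum>m\<in>I. (cmod (g \<eta> m))\<^sup>2) = \<tau> * (\<Sum>m\<in>I. (cmod (\<Sum>j\<in>J. \<eta> j * cnj (c j m)))\<^sup>2)"
      using \<tau> unfolding g_def by (subst norm_mult) (simp add: power_mult_distrib sum_distrib_left[symmetric])
    also have "\<dots> \<le> \<tau> * (C * (\<Sum>j\<in>J. (cmod (\<eta> j))\<^sup>2))"
      by (rule mult_left_mono[OF op \<tau>(1)])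
    finally show "exp (\<Sum>m\<in>I. (cmod (g \<eta> m))\<^sup>2) \<le> exp (\<tau> * C * (\<Sum>j\<in>J. (cmod (\<eta> j))\<^sup>2))"
      by (simp add: mult.assoc)
  qed
  also have "\<dots> = ennreal ((1 / (1 - \<tau> * C)) ^ card J)"
    by (rule nn_integral_gauss_PiM_exp_square[OF J \<tau>(2)])
  finally show ?thesis .
qed

section \<open>Barrier estimate for Gaussian vectors\<close>

lemma gauss_PiM_subset_eq_PiE:
  "G \<subseteq> K \<Longrightarrow> {z \<in> space (gauss_PiM K). \<forall>j\<in>G. z j \<in> B} = Pi\<^sub>E K (\<lambda>j. if j \<in> G then B else UNIV)"
  by (auto simp: PiE_iff extensional_def split: if_splits)

lemma emeasure_gauss_PiM_subset:
  assumes K: "finite K" and G: "G \<subseteq> K" and B: "B \<in> sets borel"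
  shows "emeasure (gauss_PiM K) {z \<in> space (gauss_PiM K). \<forall>j\<in>G. z j \<in> B} = emeasure cgauss B ^ card G"
proof -
  have "emeasure (gauss_PiM K) (Pi\<^sub>E K (\<lambda>j. if j \<in> G then B else UNIV)) = (\<Prod>j\<in>K. emeasure cgauss (if j \<in> G then B else UNIV))"
    by (rule gauss_PiM.emeasure_PiM) (use K B in \<open>auto simp: sets_cgauss\<close>)
  also have "\<dots> = (\<Prod>j\<in>K. if j \<in> G then emeasure cgauss B else 1)"
    using cgauss.emeasure_space_1 by (intro prod.cong) auto
  also have "\<dots> = emeasure cgauss B ^ card G"
    using K G by (simp add: prod.If_cases Int_absorb1)
  finally show ?thesis unfolding gauss_PiM_subset_eq_PiE[OF G] .
qed

text \<open>Jensen's inequality for the uniform weight on \<open>S\<close>.\<close>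

lemma exp_average_le:
  fixes f :: "'a \<Rightarrow> real"
  assumes "finite S" "S \<noteq> {}"
  shows "exp ((\<Sum>x\<in>S. f x) / card S) \<le> (\<Sum>x\<in>S. exp (f x)) / card S"
proof -
  have "exp (\<Sum>x\<in>S. (1 / card S) *\<^sub>R f x) \<le> (\<Sum>x\<in>S. (1 / card S) * exp (f x))"
    using assms by (intro convex_on_sum[OF _ _ exp_convex]) (auto simp: field_simps)
  then show ?thesis by (simp add: sum_divide_distrib)
qed

text \<open>The independent Gaussians \<open>z\<close> are barriers: a single large \<open>z j\<close> at an index where
  the remainder \<open>R a\<close> is moderate prevents \<open>A\<close>. By convexity the remainder is not larger,
  in exponential moment, than the full Gaussian vector.\<close>

lemma gauss_PiM_barrier_bound:
  fixes I K :: "'i set" and v :: "'i \<Rightarrow> 'i \<Rightarrow> complex" and L :: "'o \<Rightarrow> 'i \<Rightarrow> 'i \<Rightarrow> complex"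
  defines "S \<equiv> \<lambda>\<Omega> D b j. D / real (card \<Omega>) * (\<Sum>\<omega>\<in>\<Omega>. (cmod (\<Sum>m\<in>I. L \<omega> j m * b m))\<^sup>2)"
  assumes I: "finite I" and K: "finite K"
    and R [measurable]: "R \<in> gauss_PiM I \<rightarrow>\<^sub>M gauss_PiM I"
    and split: "\<And>f. f \<in> borel_measurable (gauss_PiM I) \<Longrightarrow> (\<integral>\<^sup>+a. f a \<partial>gauss_PiM I) =
      (\<integral>\<^sup>+a. \<integral>\<^sup>+z. f (\<lambda>m\<in>I. R a m + (\<Sum>j\<in>K. z j * v j m)) \<partial>gauss_PiM K \<partial>gauss_PiM I)"
    and \<Omega>: "finite \<Omega>" "\<Omega> \<noteq> {}" and CD: "C > 0" "D > 0"
    and op: "\<And>\<omega> \<eta>. \<omega> \<in> \<Omega> \<Longrightarrow>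
      (\<Sum>m\<in>I. (cmod (\<Sum>j\<in>K. \<eta> j * cnj (L \<omega> j m)))\<^sup>2) \<le> C * (\<Sum>j\<in>K. (cmod (\<eta> j))\<^sup>2)"
    and s: "4 * D * C \<le> s"
    and A [measurable]: "A \<in> sets (gauss_PiM I)"
    and t: "t \<ge> 0" and q: "0 \<le> q" "q \<le> 1" "measure cgauss {z. cmod z \<ge> M} \<ge> 1 - q\<^sup>2"
    and hit: "\<And>b z j. \<lbrakk>b \<in> extensional I; z \<in> extensional K; j \<in> K; S \<Omega> D b j \<le> s; M \<le> cmod (z j);
        \<And>l. l \<in> K \<Longrightarrow> cmod (z l) \<le> t\<rbrakk> \<Longrightarrow> (\<lambda>m\<in>I. b m + (\<Sum>j\<in>K. z j * v j m)) \<notin> A"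
  shows "emeasure (gauss_PiM I) A \<le>
    ennreal ((2 * exp (-1)) ^ card K + q ^ card K + card K * (2 * exp (- t\<^sup>2 / 2)))"
proof -
  let ?N = "card K"
  define Q where "Q = (\<lambda>b. \<Sum>j\<in>K. S \<Omega> D b j)"
  \<comment> \<open>With \<open>\<tau> * D * C = 1 / 2\<close> the quadratic exponential moment is
    at most \<open>2\<close> per element of \<open>K\<close>.\<close>
  define \<tau> where "\<tau> = 1 / (2 * D * C)"
  define h where "h = (\<lambda>b. ennreal (exp (\<tau> * Q b)))"
  define P where "P = (\<lambda>a z. \<lambda>m\<in>I. R a m + (\<Sum>j\<in>K. z j * v j m))"
  have \<tau>: "\<tau> > 0" "\<tau> * D * C = 1 / 2" using CD by (auto simp: \<tau>_def)
  have s0: "s > 0" using s CD by (smt (verit) mult_pos_pos)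
  interpret gI: prob_space "gauss_PiM I" by (rule prob_space_gauss_PiM)
  interpret gK: prob_space "gauss_PiM K" by (rule prob_space_gauss_PiM)
  have S0: "S \<Omega> D b j \<ge> 0" for b j using CD by (auto simp: S_def intro!: sum_nonneg divide_nonneg_nonneg mult_nonneg_nonneg)
  have Q0: "Q b \<ge> 0" for b unfolding Q_def by (intro sum_nonneg S0)
  have comp [measurable]: "(\<lambda>x. x m) \<in> borel_measurable (gauss_PiM J)" if "m \<in> J" for m :: 'i and J
    using measurable_component_singleton[OF that, of "\<lambda>_. cgauss"] by (simp add: measurable_cong_sets[OF refl sets_cgauss])
  have Qm [measurable]: "Q \<in> borel_measurable (gauss_PiM I)"
    unfolding Q_def S_def by measurable
  have hm [measurable]: "h \<in> borel_measurable (gauss_PiM I)"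
    unfolding h_def by measurable
  have Pm [measurable]: "P a \<in> gauss_PiM K \<rightarrow>\<^sub>M gauss_PiM I" for a
    unfolding P_def by (rule measurable_restrict, unfold measurable_cong_sets[OF refl sets_cgauss]) measurable
  have Rext: "R a \<in> extensional I" if "a \<in> extensional I" for a
    using measurable_space[OF R] that by auto
  have Pm2: "(\<lambda>z. P a (\<lambda>j\<in>K. - z j)) \<in> gauss_PiM K \<rightarrow>\<^sub>M gauss_PiM I" for a
  proof -
    have "(\<lambda>z. \<lambda>j\<in>K. - z j) \<in> gauss_PiM K \<rightarrow>\<^sub>M gauss_PiM K"
      by (rule measurable_restrict, unfold measurable_cong_sets[OF refl sets_cgauss]) measurable
    then show ?thesis by measurable
  qed

  have moment: "(\<integral>\<^sup>+a. h a \<partial>gauss_PiM I) \<le> ennreal (2 ^ ?N)"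
  proof -
    have "(\<integral>\<^sup>+a. h a \<partial>gauss_PiM I) \<le>
      (\<integral>\<^sup>+a. ennreal (1 / card \<Omega>) * (\<Sum>\<omega>\<in>\<Omega>. ennreal (exp (\<tau> * D * (\<Sum>j\<in>K. (cmod (\<Sum>m\<in>I. L \<omega> j m * a m))\<^sup>2)))) \<partial>gauss_PiM I)"
    proof (rule nn_integral_mono)
      fix a :: "'i \<Rightarrow> complex"
      have \<tau>Q: "\<tau> * Q a = (\<Sum>\<omega>\<in>\<Omega>. \<tau> * D * (\<Sum>j\<in>K. (cmod (\<Sum>m\<in>I. L \<omega> j m * a m))\<^sup>2)) / card \<Omega>"
      proof -
        define X where "X = (\<lambda>\<omega> j. (cmod (\<Sum>m\<in>I. L \<omega> j m * a m))\<^sup>2)"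
        have "\<tau> * Q a = \<tau> * D / card \<Omega> * (\<Sum>j\<in>K. \<Sum>\<omega>\<in>\<Omega>. X \<omega> j)"
          unfolding Q_def S_def X_def sum_distrib_left[of "D / _", symmetric] by simp
        also have "(\<Sum>j\<in>K. \<Sum>\<omega>\<in>\<Omega>. X \<omega> j) = (\<Sum>\<omega>\<in>\<Omega>. \<Sum>j\<in>K. X \<omega> j)"
          by (rule sum.swap)
        finally show ?thesis unfolding X_def by (simp add: sum_distrib_left[symmetric])
      qed
      have "exp (\<tau> * Q a) \<le> (\<Sum>\<omega>\<in>\<Omega>. exp (\<tau> * D * (\<Sum>j\<in>K. (cmod (\<Sum>m\<in>I. L \<omega> j m * a m))\<^sup>2))) / card \<Omega>"
        unfolding \<tau>Q by (rule exp_average_le[OF \<Omega>])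
      then have "h a \<le> ennreal ((1 / card \<Omega>) * (\<Sum>\<omega>\<in>\<Omega>. exp (\<tau> * D * (\<Sum>j\<in>K. (cmod (\<Sum>m\<in>I. L \<omega> j m * a m))\<^sup>2))))"
        unfolding h_def by (intro ennreal_leI) simp
      also have "\<dots> = ennreal (1 / card \<Omega>) * (\<Sum>\<omega>\<in>\<Omega>. ennreal (exp (\<tau> * D * (\<Sum>j\<in>K. (cmod (\<Sum>m\<in>I. L \<omega> j m * a m))\<^sup>2))))"
        by (subst ennreal_mult) (auto intro!: sum_nonneg simp: sum_ennreal)
      finally show "h a \<le> \<dots>" .
    qed
    also have "\<dots> = ennreal (1 / card \<Omega>) * (\<Sum>\<omega>\<in>\<Omega>. \<integral>\<^sup>+a. ennreal (exp (\<tau> * D * (\<Sum>j\<in>K. (cmod (\<Sum>m\<in>I. L \<omega> j m * a m))\<^sup>2))) \<partial>gauss_PiM I)"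
      by (subst nn_integral_cmult, measurable, subst nn_integral_sum) auto
    also have "\<dots> \<le> ennreal (1 / card \<Omega>) * (\<Sum>\<omega>\<in>\<Omega>. ennreal (2 ^ ?N))"
    proof (intro mult_left_mono sum_mono)
      fix \<omega> assume "\<omega> \<in> \<Omega>"
      from nn_integral_gauss_PiM_exp_quadratic_le[OF I K _ _ op[OF this], of "\<tau> * D"]
      show "(\<integral>\<^sup>+a. ennreal (exp (\<tau> * D * (\<Sum>j\<in>K. (cmod (\<Sum>m\<in>I. L \<omega> j m * a m))\<^sup>2))) \<partial>gauss_PiM I) \<le> ennreal (2 ^ ?N)"
        using \<tau> CD by (simp add: mult_nonneg_nonneg less_imp_le)
    qed simp
    also have "\<dots> = ennreal (2 ^ ?N)"
      using \<Omega> by (simp add: ennreal_of_nat_eq_real_of_nat ennreal_mult[symmetric] mult.assoc[symmetric])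
    finally show ?thesis .
  qed

  \<comment> \<open>The parallelogram identity makes each squared modulus midpoint convex, hence
    also \<open>Q\<close>.\<close>
  have par: "Q b \<le> (Q (\<lambda>m\<in>I. b m + x m) + Q (\<lambda>m\<in>I. b m - x m)) / 2" for b x
  proof -
    have "S \<Omega> D b j \<le> (S \<Omega> D (\<lambda>m\<in>I. b m + x m) j + S \<Omega> D (\<lambda>m\<in>I. b m - x m) j) / 2" for j
    proof -
      have "(cmod (\<Sum>m\<in>I. L \<omega> j m * b m))\<^sup>2 \<le>
         ((cmod (\<Sum>m\<in>I. L \<omega> j m * (\<lambda>m\<in>I. b m + x m) m))\<^sup>2 + (cmod (\<Sum>m\<in>I. L \<omega> j m * (\<lambda>m\<in>I. b m - x m) m))\<^sup>2) / 2" for \<omega>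
      proof -
        have p: "(cmod y)\<^sup>2 \<le> ((cmod (y + y'))\<^sup>2 + (cmod (y - y'))\<^sup>2) / 2" for y y'
          unfolding cmod_power2 by (simp add: power2_eq_square algebra_simps)
        show ?thesis
          using p[of "\<Sum>m\<in>I. L \<omega> j m * b m" "\<Sum>m\<in>I. L \<omega> j m * x m"]
          by (simp add: sum.distrib[symmetric] sum_subtractf[symmetric] algebra_simps)
      qed
      then have "(\<Sum>\<omega>\<in>\<Omega>. (cmod (\<Sum>m\<in>I. L \<omega> j m * b m))\<^sup>2) \<le>
        (\<Sum>\<omega>\<in>\<Omega>. ((cmod (\<Sum>m\<in>I. L \<omega> j m * (\<lambda>m\<in>I. b m + x m) m))\<^sup>2 + (cmod (\<Sum>m\<in>I. L \<omega> j m * (\<lambda>m\<in>I. b m - x m) m))\<^sup>2) / 2)"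
        by (intro sum_mono)
      then have "(\<Sum>\<omega>\<in>\<Omega>. (cmod (\<Sum>m\<in>I. L \<omega> j m * b m))\<^sup>2) \<le>
        ((\<Sum>\<omega>\<in>\<Omega>. (cmod (\<Sum>m\<in>I. L \<omega> j m * (\<lambda>m\<in>I. b m + x m) m))\<^sup>2) +
         (\<Sum>\<omega>\<in>\<Omega>. (cmod (\<Sum>m\<in>I. L \<omega> j m * (\<lambda>m\<in>I. b m - x m) m))\<^sup>2)) / 2" (is "?X \<le> (?Y + ?Z) / 2")
        unfolding sum_divide_distrib[symmetric] sum.distrib .
      then have "D / card \<Omega> * ?X \<le> D / card \<Omega> * ((?Y + ?Z) / 2)"
        using CD by (intro mult_left_mono) auto
      also have "\<dots> = (D / card \<Omega> * ?Y + D / card \<Omega> * ?Z) / 2"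
        by (simp only: distrib_left times_divide_eq_right)
      finally show ?thesis unfolding S_def .
    qed
    then have "(\<Sum>j\<in>K. S \<Omega> D b j) \<le> (\<Sum>j\<in>K. (S \<Omega> D (\<lambda>m\<in>I. b m + x m) j + S \<Omega> D (\<lambda>m\<in>I. b m - x m) j) / 2)"
      by (intro sum_mono)
    then show ?thesis by (simp add: Q_def sum.distrib[symmetric] sum_divide_distrib[symmetric])
  qed

  have half: "ennreal (x / 2 + y / 2) = ennreal (1/2) * ennreal x + ennreal (1/2) * ennreal y"
    if "0 \<le> x" "0 \<le> y" for x y :: real
    using that by (simp only: ennreal_mult[symmetric] ennreal_plus[symmetric]) simp
  \<comment> \<open>\<open>R a\<close> is the midpoint of \<open>P a z\<close> and
    \<open>P a\<close> at the opposite of \<open>z\<close>, which have the same law; convexity of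
    \<open>Q\<close> and of \<open>exp\<close> gives the inequality after averaging over the
    sign.\<close>
  have hR: "h (R a) \<le> (\<integral>\<^sup>+z. h (P a z) \<partial>gauss_PiM K)" for a
  proof -
    have "h (R a) = (\<integral>\<^sup>+z. h (R a) \<partial>gauss_PiM K)"
      using gK.emeasure_space_1 by simp
    also have "\<dots> \<le> (\<integral>\<^sup>+z. ennreal (1/2) * h (P a z) + ennreal (1/2) * h (P a (\<lambda>j\<in>K. - z j)) \<partial>gauss_PiM K)"
    proof (rule nn_integral_mono)
      fix z :: "'i \<Rightarrow> complex"
      let ?x = "\<lambda>m. \<Sum>j\<in>K. z j * v j m"
      have Pminus: "P a (\<lambda>j\<in>K. - z j) = (\<lambda>m\<in>I. R a m - ?x m)"
        by (auto simp: P_def restrict_def sum_negf)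
      have "exp (\<tau> * Q (R a)) \<le> exp ((\<tau> * Q (P a z) + \<tau> * Q (P a (\<lambda>j\<in>K. - z j))) / 2)"
        using mult_left_mono[OF par[of "R a" ?x] less_imp_le[OF \<tau>(1)]]
        unfolding Pminus by (simp add: P_def algebra_simps add_divide_distrib)
      also have "\<dots> \<le> exp (\<tau> * Q (P a z)) / 2 + exp (\<tau> * Q (P a (\<lambda>j\<in>K. - z j))) / 2"
        using convex_onD[OF exp_convex, of "1/2" "\<tau> * Q (P a z)" "\<tau> * Q (P a (\<lambda>j\<in>K. - z j))"]
        by (simp add: add_divide_distrib)
      finally show "h (R a) \<le> ennreal (1/2) * h (P a z) + ennreal (1/2) * h (P a (\<lambda>j\<in>K. - z j))"
        unfolding h_def half[OF exp_ge_zero exp_ge_zero, symmetric] by (rule ennreal_leI)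
    qed
    also have "\<dots> = ennreal (1/2) * (\<integral>\<^sup>+z. h (P a z) \<partial>gauss_PiM K) +
        ennreal (1/2) * (\<integral>\<^sup>+z. h (P a (\<lambda>j\<in>K. - z j)) \<partial>gauss_PiM K)"
      using Pm2[of a] by (subst nn_integral_add, measurable, subst (1 2) nn_integral_cmult) auto
    also have "(\<integral>\<^sup>+z. h (P a (\<lambda>j\<in>K. - z j)) \<partial>gauss_PiM K) = (\<integral>\<^sup>+z. h (P a z) \<partial>gauss_PiM K)"
    proof (rule nn_integral_gauss_PiM_isometry[OF K, where T' = "\<lambda>z. \<lambda>j\<in>K. - z j"])
      show "(\<lambda>z. \<lambda>j\<in>K. - z j) \<in> gauss_PiM K \<rightarrow>\<^sub>M gauss_PiM K"
        by (rule measurable_restrict, unfold measurable_cong_sets[OF refl sets_cgauss]) measurable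
    qed (auto simp: fun_eq_iff extensional_def)
    also have "ennreal (1/2) * (\<integral>\<^sup>+z. h (P a z) \<partial>gauss_PiM K) + ennreal (1/2) * (\<integral>\<^sup>+z. h (P a z) \<partial>gauss_PiM K) =
        (\<integral>\<^sup>+z. h (P a z) \<partial>gauss_PiM K)"
      unfolding distrib_right[symmetric] by (subst ennreal_plus[symmetric]) auto
    finally show ?thesis .
  qed
  have momentR: "(\<integral>\<^sup>+a. h (R a) \<partial>gauss_PiM I) \<le> ennreal (2 ^ ?N)"
    using nn_integral_mono[of "gauss_PiM I" "\<lambda>a. h (R a)" "\<lambda>a. \<integral>\<^sup>+z. h (P a z) \<partial>gauss_PiM K"] hR
      split[OF hm] moment unfolding P_def by fastforce

  define e where "e = ennreal (q ^ ?N + ?N * (2 * exp (- t\<^sup>2 / 2)))"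
  \<comment> \<open>A pointwise Markov inequality: \<open>\<tau>\<close> times the threshold
    \<open>2 * D * C * card K\<close> equals \<open>card K\<close>, so the term with
    \<open>h\<close> is at least \<open>1\<close> where \<open>Q (R a)\<close> exceeds the
    threshold. Below the threshold the probability is bounded by \<open>e\<close>.\<close>
  have inner: "(\<integral>\<^sup>+z. indicator A (P a z) \<partial>gauss_PiM K) \<le> ennreal (exp (- real ?N)) * h (R a) + e"
    if a: "a \<in> extensional I" for a
  proof (cases "Q (R a) \<le> 2 * D * C * ?N")
    case False
    have "(\<integral>\<^sup>+z. indicator A (P a z) \<partial>gauss_PiM K) \<le> (\<integral>\<^sup>+z. 1 \<partial>gauss_PiM K)"
      by (intro nn_integral_mono) (auto simp: indicator_def)
    also have "\<dots> = 1" using gK.emeasure_space_1 by simp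
    also have "1 \<le> ennreal (exp (- real ?N)) * h (R a)"
    proof -
      have "\<tau> * (2 * D * C * ?N) \<le> \<tau> * Q (R a)" using False \<tau> by (intro mult_left_mono) auto
      moreover have "\<tau> * (2 * D * C * ?N) = ?N" using \<tau> by (simp add: mult.assoc[symmetric])
      ultimately have "1 \<le> exp (- real ?N + \<tau> * Q (R a))" by simp
      then show ?thesis unfolding h_def
        by (simp add: ennreal_mult[symmetric] exp_add[symmetric])
    qed
    finally show ?thesis by (simp add: add_increasing2)
  next
    case True
    define G where "G = {j\<in>K. S \<Omega> D (R a) j \<le> s}"
    have G: "G \<subseteq> K" by (auto simp: G_def)
    then have finG: "finite G" using K finite_subset by auto
    \<comment> \<open>Each index outside \<open>G\<close> contributes more than \<open>s\<close> to
      \<open>Q (R a)\<close>, and the threshold is at most \<open>s * card K / 2\<close> because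
      \<open>4 * D * C <= s\<close>; so at most half of the indices are lost.\<close>
    have "real (card (K - G)) * s = (\<Sum>j\<in>K - G. s)" by simp
    also have "\<dots> \<le> (\<Sum>j\<in>K - G. S \<Omega> D (R a) j)"
      by (intro sum_mono) (auto simp: G_def)
    also have "\<dots> \<le> Q (R a)"
      unfolding Q_def by (rule sum_mono2) (use K S0 in auto)
    also have "\<dots> \<le> ?N / 2 * s"
      using True mult_left_mono[OF s, of "?N / 2"] by (simp add: mult_ac)
    finally have "real (card (K - G)) \<le> ?N / 2" using s0 by simp
    moreover have "card (K - G) + card G = ?N"
      using K G finG by (metis card_Diff_subset card_mono le_add_diff_inverse2)
    ultimately have Ghalf: "?N \<le> 2 * card G" by linarith
    \<comment> \<open>The square of \<open>q\<close> pays for using only half of the indices: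
      \<open>q^2\<close> to the power \<open>card G\<close> is at most
      \<open>q ^ card K\<close>.\<close>
    have x: "emeasure cgauss {z. cmod z < M} \<le> ennreal (q\<^sup>2)"
    proof -
      have "measure cgauss {z. cmod z < M} = 1 - measure cgauss {z. cmod z \<ge> M}"
        using cgauss.prob_compl[of "{z. cmod z \<ge> M}"]
        by (simp add: sets_cgauss not_le Compl_eq_Diff_UNIV[symmetric] Collect_neg_eq[symmetric])
      then show ?thesis using q by (simp add: cgauss.emeasure_eq_measure ennreal_leI)
    qed
    define E where "E = (\<lambda>G B. {z \<in> space (gauss_PiM K). \<forall>j\<in>G. z j \<in> B})"
    have E: "E G' B \<in> sets (gauss_PiM K)" "emeasure (gauss_PiM K) (E G' B) = emeasure cgauss B ^ card G'"
      if "G' \<subseteq> K" "B \<in> sets borel" for G' B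
    proof -
      show "E G' B \<in> sets (gauss_PiM K)"
        unfolding E_def gauss_PiM_subset_eq_PiE[OF that(1)]
        by (rule sets_PiM_I_finite) (use K that(2) in \<open>auto simp: sets_cgauss\<close>)
    qed (use emeasure_gauss_PiM_subset[OF K that] in \<open>simp only: E_def\<close>)
    have borel: "{z. cmod z < M} \<in> sets borel" "{z. cmod z > t} \<in> sets borel" by auto
    have "(\<integral>\<^sup>+z. indicator A (P a z) \<partial>gauss_PiM K) \<le>
      (\<integral>\<^sup>+z. indicator (E G {z. cmod z < M}) z + (\<Sum>l\<in>K. indicator (E {l} {z. cmod z > t}) z) \<partial>gauss_PiM K)"
    proof (rule nn_integral_mono)
      fix z :: "'i \<Rightarrow> complex" assume z: "z \<in> space (gauss_PiM K)"
      consider "\<forall>j\<in>G. cmod (z j) < M" | l where "l \<in> K" "cmod (z l) > t"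
        | j where "j \<in> G" "cmod (z j) \<ge> M" "\<forall>l\<in>K. cmod (z l) \<le> t"
        by (meson not_le)
      then show "(indicator A (P a z) :: ennreal) \<le>
          indicator (E G {z. cmod z < M}) z + (\<Sum>l\<in>K. indicator (E {l} {z. cmod z > t}) z)"
      proof cases
        case 1
        then show ?thesis using z by (auto simp: E_def indicator_def add_increasing2)
      next
        case 2
        then have "1 \<le> (\<Sum>l\<in>K. indicator (E {l} {z. cmod z > t}) z :: ennreal)"
          using z K member_le_sum[of l K "\<lambda>l. indicator (E {l} {z. cmod z > t}) z :: ennreal"]
          by (simp add: E_def)
        then show ?thesis by (intro add_increasing) (auto simp: indicator_def intro: order_trans)
      next
        case 3
        then have "P a z \<notin> A" unfolding P_def
          using z Rext[OF a] by (intro hit[of "R a" z j]) (auto simp: G_def)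
        then show ?thesis by simp
      qed
    qed
    also have "\<dots> = emeasure cgauss {z. cmod z < M} ^ card G + (\<Sum>l\<in>K. emeasure cgauss {z. cmod z > t} ^ card {l})"
      using E[OF G borel(1)] E[OF _ borel(2), of "{_}"]
      by (subst nn_integral_add)
        (auto simp: nn_integral_sum intro!: borel_measurable_sum borel_measurable_indicator sum.cong)
    also have "\<dots> \<le> ennreal ((q\<^sup>2) ^ card G) + (\<Sum>l\<in>K. ennreal (2 * exp (- t\<^sup>2 / 2)))"
    proof (intro add_mono sum_mono)
      show "emeasure cgauss {z. cmod z < M} ^ card G \<le> ennreal ((q\<^sup>2) ^ card G)"
        using power_mono[OF x, of "card G"] by (simp add: ennreal_power)
    qed (use emeasure_cgauss_tail_le[OF t] in simp)
    also have "\<dots> = ennreal ((q\<^sup>2) ^ card G + ?N * (2 * exp (- t\<^sup>2 / 2)))"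
      by (simp add: ennreal_of_nat_eq_real_of_nat[symmetric] ennreal_mult[symmetric] ennreal_plus[symmetric] mult_ac del: ennreal_plus)
        (simp add: ennreal_of_nat_eq_real_of_nat ennreal_mult[symmetric] ennreal_plus[symmetric] mult_ac del: ennreal_plus)
    also have "\<dots> \<le> e"
      unfolding e_def power_mult[symmetric]
      by (intro ennreal_leI add_right_mono power_decreasing Ghalf q)
    finally show ?thesis by (simp add: add_increasing)
  qed
  have "emeasure (gauss_PiM I) A = (\<integral>\<^sup>+a. indicator A a \<partial>gauss_PiM I)"
    by simp
  also have "\<dots> = (\<integral>\<^sup>+a. \<integral>\<^sup>+z. indicator A (P a z) \<partial>gauss_PiM K \<partial>gauss_PiM I)"
    unfolding P_def by (rule split) measurable
  also have "\<dots> \<le> (\<integral>\<^sup>+a. ennreal (exp (- real ?N)) * h (R a) + e \<partial>gauss_PiM I)"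
    by (rule nn_integral_mono) (use inner in auto)
  also have "\<dots> = ennreal (exp (- real ?N)) * (\<integral>\<^sup>+a. h (R a) \<partial>gauss_PiM I) + e"
    using gI.emeasure_space_1 by (subst nn_integral_add, measurable, subst nn_integral_cmult) auto
  also have "\<dots> \<le> ennreal (exp (- real ?N)) * ennreal (2 ^ ?N) + e"
    by (intro add_right_mono mult_left_mono momentR) auto
  also have "\<dots> = ennreal ((2 * exp (-1)) ^ ?N + q ^ ?N + ?N * (2 * exp (- t\<^sup>2 / 2)))"
    unfolding e_def using q
    by (simp add: ennreal_mult[symmetric] ennreal_plus[symmetric] power_mult_distrib exp_of_nat_mult[symmetric] mult_ac add_ac del: ennreal_plus)
  finally show ?thesis .
qed

subsection \<open>Roots of unity and trinomial moments\<close>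

definition unity_root :: "nat \<Rightarrow> complex" where
  "unity_root n = cis (2 * pi / real n)"

lemma norm_unity_root [simp]: "cmod (unity_root n) = 1"
  by (simp add: unity_root_def)

lemma unity_root_pow: "unity_root n ^ k = cis (2 * pi * real k / real n)"
  by (simp add: unity_root_def Complex.DeMoivre mult_ac)

lemma unity_root_pow_eq_iff:
  assumes "n > 0"
  shows "unity_root n ^ a = unity_root n ^ b \<longleftrightarrow> a mod n = b mod n"
proof -
  have e: "unity_root n ^ k = exp (2 * of_real pi * \<i> * of_nat k / of_nat n)" for k
    by (simp add: unity_root_pow cis_conv_exp mult_ac)
  show ?thesis
    unfolding e using complex_root_unity_eq[of n a b] assms by simp
qed

lemma sum_unity_root:
  assumes "n > 0"
  shows "(\<Sum>t<n. unity_root n ^ (t * a) * cnj (unity_root n ^ (t * b))) = (if a mod n = b mod n then of_nat n else 0)"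
proof -
  define z where "z = unity_root n ^ a * cnj (unity_root n ^ b)"
  have c: "u * cnj u = 1" if "cmod u = 1" for u
    using that by (simp add: complex_norm_square[symmetric])
  have s: "(\<Sum>t<n. unity_root n ^ (t * a) * cnj (unity_root n ^ (t * b))) = (\<Sum>t<n. z ^ t)"
    by (simp add: z_def power_mult_distrib power_mult[symmetric] mult.commute)
  show ?thesis
  proof (cases "a mod n = b mod n")
    case True
    then have "unity_root n ^ a = unity_root n ^ b" using assms by (simp add: unity_root_pow_eq_iff)
    then have "z = 1" unfolding z_def by (simp only: c norm_power norm_unity_root power_one)
    then show ?thesis using True s by simp
  next
    case False
    have z1: "z \<noteq> 1"
    proof
      assume "z = 1"
      then have "unity_root n ^ a * (cnj (unity_root n ^ b) * unity_root n ^ b) = unity_root n ^ b"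
        unfolding z_def by (simp add: mult.assoc[symmetric])
      also have "cnj (unity_root n ^ b) * unity_root n ^ b = 1"
        by (subst mult.commute, rule c) (simp add: norm_power)
      finally show False using False assms by (simp add: unity_root_pow_eq_iff)
    qed
    have "unity_root n ^ n = 1"
      using unity_root_pow_eq_iff[OF assms, of n 0] by simp
    then have "z ^ n = 1"
      by (simp add: z_def power_mult_distrib power_mult[symmetric] mult.commute[of _ n])
        (simp add: power_mult complex_cnj_power[symmetric] del: complex_cnj_power)
    then show ?thesis using z1 False s by (simp add: geometric_sum)
  qed
qed

text \<open>The indicator of a residue class is an average of characters, by
  \<open>sum_unity_root\<close> in each coordinate; the triangle inequality then discards the phases
  that distinguish one class from another, so the bound is the same for all classes.\<close>

lemma card_times_class_sum_le:
  fixes h :: "'a \<Rightarrow> real" and \<alpha> \<beta> :: "'a \<Rightarrow> nat"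
  assumes fin: "finite I" and n: "n > 0" and k: "k1 < n" "k2 < n" and h: "\<And>m. m \<in> I \<Longrightarrow> h m \<ge> 0"
  shows "(real n)\<^sup>2 * (\<Sum>m | m \<in> I \<and> \<alpha> m mod n = k1 \<and> \<beta> m mod n = k2. h m) \<le>
    (\<Sum>j1<n. \<Sum>j2<n. cmod (\<Sum>m\<in>I. h m * unity_root n ^ (j1 * \<alpha> m) * unity_root n ^ (j2 * \<beta> m)))"
proof -
  let ?u = "unity_root n"
  have "complex_of_real ((real n)\<^sup>2 * (\<Sum>m | m \<in> I \<and> \<alpha> m mod n = k1 \<and> \<beta> m mod n = k2. h m)) =
      (\<Sum>m\<in>I. complex_of_real (h m) * ((if \<alpha> m mod n = k1 mod n then of_nat n else 0) * (if \<beta> m mod n = k2 mod n then of_nat n else 0)))"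
    unfolding sum_distrib_left sum.inter_filter[OF fin] of_real_sum
    by (rule sum.cong[OF refl]) (use k in \<open>simp add: power2_eq_square\<close>)
  also have "\<dots> = (\<Sum>m\<in>I. h m * ((\<Sum>j1<n. ?u ^ (j1 * \<alpha> m) * cnj (?u ^ (j1 * k1))) * (\<Sum>j2<n. ?u ^ (j2 * \<beta> m) * cnj (?u ^ (j2 * k2)))))"
    by (simp only: sum_unity_root[OF n])
  also have "\<dots> = (\<Sum>m\<in>I. \<Sum>j1<n. \<Sum>j2<n. cnj (?u ^ (j1 * k1)) * cnj (?u ^ (j2 * k2)) * (h m * ?u ^ (j1 * \<alpha> m) * ?u ^ (j2 * \<beta> m)))"
    by (subst sum_product, subst sum_distrib_left, subst sum_distrib_left) (simp only: mult_ac)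
  also have "\<dots> = (\<Sum>j1<n. \<Sum>m\<in>I. \<Sum>j2<n. cnj (?u ^ (j1 * k1)) * cnj (?u ^ (j2 * k2)) * (h m * ?u ^ (j1 * \<alpha> m) * ?u ^ (j2 * \<beta> m)))"
    by (rule sum.swap)
  also have "\<dots> = (\<Sum>j1<n. \<Sum>j2<n. \<Sum>m\<in>I. cnj (?u ^ (j1 * k1)) * cnj (?u ^ (j2 * k2)) * (h m * ?u ^ (j1 * \<alpha> m) * ?u ^ (j2 * \<beta> m)))"
    by (intro sum.cong refl sum.swap)
  also have "\<dots> = (\<Sum>j1<n. \<Sum>j2<n. cnj (?u ^ (j1 * k1)) * cnj (?u ^ (j2 * k2)) * (\<Sum>m\<in>I. h m * ?u ^ (j1 * \<alpha> m) * ?u ^ (j2 * \<beta> m)))"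
    by (simp only: sum_distrib_left)
  finally have eq: "complex_of_real ((real n)\<^sup>2 * (\<Sum>m | m \<in> I \<and> \<alpha> m mod n = k1 \<and> \<beta> m mod n = k2. h m)) = \<dots>" .
  have "(real n)\<^sup>2 * (\<Sum>m | m \<in> I \<and> \<alpha> m mod n = k1 \<and> \<beta> m mod n = k2. h m) =
      cmod (complex_of_real ((real n)\<^sup>2 * (\<Sum>m | m \<in> I \<and> \<alpha> m mod n = k1 \<and> \<beta> m mod n = k2. h m)))"
    unfolding norm_of_real by (rule abs_of_nonneg[symmetric]) (auto intro!: sum_nonneg mult_nonneg_nonneg h)
  also have "\<dots> \<le> (\<Sum>j1<n. \<Sum>j2<n. cmod (cnj (?u ^ (j1 * k1)) * cnj (?u ^ (j2 * k2)) * (\<Sum>m\<in>I. h m * ?u ^ (j1 * \<alpha> m) * ?u ^ (j2 * \<beta> m))))"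
    unfolding eq by (intro order_trans[OF norm_sum] sum_mono order_refl)
  also have "\<dots> = (\<Sum>j1<n. \<Sum>j2<n. cmod (\<Sum>m\<in>I. h m * ?u ^ (j1 * \<alpha> m) * ?u ^ (j2 * \<beta> m)))"
    by (simp add: norm_mult norm_power)
  finally show ?thesis .
qed

text \<open>Cauchy--Schwarz against the Lagrange basis at the \<open>T\<close>-th roots of unity: the exact,
  finite form of the bound of a holomorphic function by its mean square on a circle.\<close>

lemma norm_poly_square_le_mean_roots:
  fixes p :: "complex poly"
  assumes deg: "degree p < T" and r: "r > 0" and w: "cmod w \<le> r / 2"
  shows "(cmod (poly p w))\<^sup>2 \<le> 4 / 3 * ((\<Sum>t<T. (cmod (poly p (r * unity_root T ^ t)))\<^sup>2) / T)"
proof -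
  let ?u = "unity_root T"
  have T: "T > 0" using deg by simp
  define c where "c = (\<lambda>i. coeff p i * r ^ i)"
  have poly: "poly p z = (\<Sum>i<T. coeff p i * z ^ i)" for z
  proof -
    have "(\<Sum>i<T. coeff p i * z ^ i) = (\<Sum>i\<le>degree p. coeff p i * z ^ i)"
      by (rule sum.mono_neutral_right) (use deg in \<open>auto simp: coeff_eq_0 not_le\<close>)
    then show ?thesis by (simp add: poly_altdef)
  qed
  have "complex_of_real (\<Sum>t<T. (cmod (poly p (r * ?u ^ t)))\<^sup>2) =
      (\<Sum>t<T. (\<Sum>i<T. c i * ?u ^ (t * i)) * (\<Sum>l<T. cnj (c l) * cnj (?u ^ (t * l))))"
    unfolding of_real_sum complex_norm_square poly
    by (simp add: c_def power_mult_distrib power_mult mult_ac)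
  also have "\<dots> = (\<Sum>t<T. \<Sum>i<T. \<Sum>l<T. c i * cnj (c l) * (?u ^ (t * i) * cnj (?u ^ (t * l))))"
    by (simp only: sum_product mult_ac)
  also have "\<dots> = (\<Sum>i<T. \<Sum>t<T. \<Sum>l<T. c i * cnj (c l) * (?u ^ (t * i) * cnj (?u ^ (t * l))))"
    by (rule sum.swap)
  also have "\<dots> = (\<Sum>i<T. \<Sum>l<T. \<Sum>t<T. c i * cnj (c l) * (?u ^ (t * i) * cnj (?u ^ (t * l))))"
    by (intro sum.cong refl sum.swap)
  also have "\<dots> = (\<Sum>i<T. \<Sum>l<T. c i * cnj (c l) * (if i mod T = l mod T then of_nat T else 0))"
    by (simp only: sum_distrib_left[symmetric] sum_unity_root[OF T])
  \<comment> \<open>Both indices are below \<open>T\<close>, so congruence means equality and only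
    the diagonal survives: Parseval's identity is exact.\<close>
  also have "\<dots> = (\<Sum>i<T. \<Sum>l<T. if l = i then c i * cnj (c i) * of_nat T else 0)"
    by (intro sum.cong refl) auto
  also have "\<dots> = complex_of_real (T * (\<Sum>i<T. (cmod (c i))\<^sup>2))"
    by (simp add: complex_norm_square sum_distrib_left mult_ac del: of_real_power)
  finally have pars: "(\<Sum>t<T. (cmod (poly p (r * ?u ^ t)))\<^sup>2) = T * (\<Sum>i<T. (cmod (c i))\<^sup>2)"
    by (simp only: of_real_eq_iff)
  have "cmod (poly p w) \<le> (\<Sum>i<T. cmod (c i) * (cmod w / r) ^ i)"
    unfolding poly using r
    by (intro order_trans[OF norm_sum] sum_mono) (auto simp: c_def norm_mult norm_power power_divide)
  then have "(cmod (poly p w))\<^sup>2 \<le> (\<Sum>i<T. cmod (c i) * (cmod w / r) ^ i)\<^sup>2"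
    by (intro power_mono) auto
  also have "\<dots> \<le> (\<Sum>i<T. (cmod (c i))\<^sup>2) * (\<Sum>i<T. ((cmod w / r) ^ i)\<^sup>2)"
    by (rule Cauchy_Schwarz_ineq_sum)
  also have "\<dots> \<le> (\<Sum>i<T. (cmod (c i))\<^sup>2) * (4 / 3)"
  proof (intro mult_left_mono sum_nonneg)
    have x: "0 \<le> (cmod w / r)\<^sup>2" "(cmod w / r)\<^sup>2 \<le> 1 / 4"
      using power_mono[of "cmod w / r" "1 / 2" 2] w r by (auto simp: field_simps power_divide)
    have "(\<Sum>i<T. ((cmod w / r) ^ i)\<^sup>2) = (\<Sum>i<T. ((cmod w / r)\<^sup>2) ^ i)"
      by (simp add: power_mult[symmetric] mult.commute)
    also have "\<dots> \<le> (\<Sum>i<T. (1 / 4) ^ i)"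
      by (intro sum_mono power_mono x)
    also have "\<dots> \<le> 4 / 3"
      by (subst geometric_sum) (auto simp: field_simps)
    finally show "(\<Sum>i<T. ((cmod w / r) ^ i)\<^sup>2) \<le> 4 / 3" .
  qed auto
  finally show ?thesis unfolding pars using T by simp
qed

section \<open>The trinomial law and its moments\<close>

definition trinom :: "nat \<Rightarrow> nat \<times> nat \<times> nat \<Rightarrow> real" where
  "trinom d = (\<lambda>(i0, i1, i2). fact d / (fact i0 * fact i1 * fact i2))"

definition monom3 :: "'a \<Rightarrow> 'a \<Rightarrow> 'a \<Rightarrow> nat \<times> nat \<times> nat \<Rightarrow> 'a::comm_semiring_1" where
  "monom3 x0 x1 x2 = (\<lambda>(i0, i1, i2). x0 ^ i0 * x1 ^ i1 * x2 ^ i2)"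

text \<open>The logarithmic derivative at \<open>t = 0\<close> of a monomial along the curve that
  multiplies each variable by its own \<open>exp (t * b)\<close>; as a function of the exponents, a
  linear statistic of the trinomial law.\<close>

definition lin3 :: "'a \<Rightarrow> 'a \<Rightarrow> 'a \<Rightarrow> nat \<times> nat \<times> nat \<Rightarrow> 'a::comm_semiring_1" where
  "lin3 b0 b1 b2 = (\<lambda>(i0, i1, i2). b0 * of_nat i0 + b1 * of_nat i1 + b2 * of_nat i2)"

lemma sum_hom_exps:
  "(\<Sum>m\<in>hom_exps d. g m) = (\<Sum>i\<le>d. \<Sum>j\<le>d - i. g (i, j, d - i - j))"
proof -
  have eq: "hom_exps d = (\<lambda>(i, j). (i, j, d - i - j)) ` (SIGMA i:{..d}. {..d - i})"
    by (auto simp: hom_exps_def image_iff)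
  have "inj_on (\<lambda>(i, j). (i, j, d - i - j)) (SIGMA i:{..d}. {..d - i})"
    by (auto simp: inj_on_def)
  then show ?thesis
    unfolding eq by (subst sum.reindex) (auto simp: sum.Sigma case_prod_unfold)
qed

lemma trinomial:
  fixes x0 x1 x2 :: "'a :: {real_algebra_1, comm_ring_1}"
  shows "(\<Sum>m\<in>hom_exps d. of_real (trinom d m) * monom3 x0 x1 x2 m) = (x0 + x1 + x2) ^ d"
proof -
  have "(x0 + x1 + x2) ^ d = (x0 + (x1 + x2)) ^ d" by (simp add: add.assoc)
  also have "\<dots> = (\<Sum>i\<le>d. of_nat (d choose i) * x0 ^ i * (\<Sum>j\<le>d - i. of_nat (d - i choose j) * x1 ^ j * x2 ^ (d - i - j)))"
    by (simp add: binomial_ring)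
  also have "\<dots> = (\<Sum>i\<le>d. \<Sum>j\<le>d - i. of_real (trinom d (i, j, d - i - j)) * monom3 x0 x1 x2 (i, j, d - i - j))"
  proof (intro sum.cong refl, subst sum_distrib_left, intro sum.cong refl)
    fix i j assume "i \<in> {..d}" "j \<in> {..d - i}"
    then have "real (d choose i) * real (d - i choose j) = trinom d (i, j, d - i - j)"
      by (simp add: trinom_def binomial_fact field_simps)
    then have *: "(of_nat (d choose i) * of_nat (d - i choose j) :: 'a) = of_real (trinom d (i, j, d - i - j))"
      by (metis of_real_mult of_real_of_nat_eq)
    then show "of_nat (d choose i) * x0 ^ i * (of_nat (d - i choose j) * x1 ^ j * x2 ^ (d - i - j)) =
      of_real (trinom d (i, j, d - i - j)) * monom3 x0 x1 x2 (i, j, d - i - j)"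
      by (simp only: monom3_def prod.case flip: *) (simp only: mult_ac)
  qed
  finally show ?thesis by (simp add: sum_hom_exps)
qed

lemma monom3_exp:
  "monom3 (x0 * exp (t * b0)) (x1 * exp (t * b1)) (x2 * exp (t * b2)) m =
    monom3 x0 x1 x2 m * exp (t * lin3 b0 b1 b2 m :: complex)"
proof -
  obtain i0 i1 i2 where m: "m = (i0, i1, i2)" by (metis prod_cases3)
  have "exp (t * lin3 b0 b1 b2 m) = exp (t * b0) ^ i0 * exp (t * b1) ^ i1 * exp (t * b2) ^ i2"
    by (simp add: m lin3_def exp_of_nat_mult[symmetric] exp_add[symmetric] algebra_simps)
  then show ?thesis by (simp add: m monom3_def power_mult_distrib mult_ac)
qed

text \<open>The trinomial theorem with variables twisted by \<open>exp (t * b)\<close> is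
  differentiated at \<open>t = 0\<close>; \<open>monom3_exp\<close> shows that the left side
  produces \<open>lin3\<close>.\<close>

lemma trinomial_moment1:
  fixes x0 x1 x2 b0 b1 b2 :: complex
  shows "(\<Sum>m\<in>hom_exps d. trinom d m * monom3 x0 x1 x2 m * lin3 b0 b1 b2 m) =
    d * (b0 * x0 + b1 * x1 + b2 * x2) * (x0 + x1 + x2) ^ (d - 1)"
proof -
  have 1: "((\<lambda>t. \<Sum>m\<in>hom_exps d. trinom d m * monom3 x0 x1 x2 m * exp (t * lin3 b0 b1 b2 m)) has_field_derivative
      (\<Sum>m\<in>hom_exps d. trinom d m * monom3 x0 x1 x2 m * lin3 b0 b1 b2 m)) (at 0)"
    by (auto intro!: derivative_eq_intros sum.cong)
  have 2: "(\<lambda>t. \<Sum>m\<in>hom_exps d. trinom d m * monom3 x0 x1 x2 m * exp (t * lin3 b0 b1 b2 m)) =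
      (\<lambda>t. (x0 * exp (t * b0) + x1 * exp (t * b1) + x2 * exp (t * b2)) ^ d)"
    unfolding trinomial[symmetric] monom3_exp by (simp add: mult.assoc)
  have 3: "((\<lambda>t. (x0 * exp (t * b0) + x1 * exp (t * b1) + x2 * exp (t * b2)) ^ d) has_field_derivative
      d * (b0 * x0 + b1 * x1 + b2 * x2) * (x0 + x1 + x2) ^ (d - 1)) (at 0)"
    by (auto intro!: derivative_eq_intros simp: algebra_simps)
  show ?thesis by (rule DERIV_unique[OF 1[unfolded 2] 3])
qed

text \<open>The first moment formula, twisted in the direction \<open>c0, c1, c2\<close> and
  differentiated once more. The product rule separates the diagonal term from the product of the two
  first-order terms.\<close>

lemma trinomial_moment2:
  fixes x0 x1 x2 b0 b1 b2 c0 c1 c2 :: complex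
  shows "(\<Sum>m\<in>hom_exps d. trinom d m * monom3 x0 x1 x2 m * (lin3 b0 b1 b2 m * lin3 c0 c1 c2 m)) =
    d * (b0 * c0 * x0 + b1 * c1 * x1 + b2 * c2 * x2) * (x0 + x1 + x2) ^ (d - 1) +
    of_nat (d * (d - 1)) * (b0 * x0 + b1 * x1 + b2 * x2) * (c0 * x0 + c1 * x1 + c2 * x2) * (x0 + x1 + x2) ^ (d - 2)"
proof -
  have 1: "((\<lambda>t. \<Sum>m\<in>hom_exps d. trinom d m * monom3 x0 x1 x2 m * exp (t * lin3 c0 c1 c2 m) * lin3 b0 b1 b2 m) has_field_derivative
      (\<Sum>m\<in>hom_exps d. trinom d m * monom3 x0 x1 x2 m * (lin3 b0 b1 b2 m * lin3 c0 c1 c2 m))) (at 0)"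
    by (auto intro!: derivative_eq_intros sum.cong)
  have 2: "(\<lambda>t. \<Sum>m\<in>hom_exps d. trinom d m * monom3 x0 x1 x2 m * exp (t * lin3 c0 c1 c2 m) * lin3 b0 b1 b2 m) =
      (\<lambda>t. d * (b0 * (x0 * exp (t * c0)) + b1 * (x1 * exp (t * c1)) + b2 * (x2 * exp (t * c2))) *
        (x0 * exp (t * c0) + x1 * exp (t * c1) + x2 * exp (t * c2)) ^ (d - 1))"
    unfolding trinomial_moment1[symmetric] monom3_exp by (simp add: mult.assoc)
  define X where "X = (\<lambda>t. b0 * (x0 * exp (t * c0)) + b1 * (x1 * exp (t * c1)) + b2 * (x2 * exp (t * c2)))"
  define Y where "Y = (\<lambda>t. x0 * exp (t * c0) + x1 * exp (t * c1) + x2 * exp (t * c2))"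
  have X: "(X has_field_derivative b0 * c0 * x0 + b1 * c1 * x1 + b2 * c2 * x2) (at 0)"
    and Y: "(Y has_field_derivative c0 * x0 + c1 * x1 + c2 * x2) (at 0)"
    unfolding X_def Y_def by (auto intro!: derivative_eq_intros)
  have "((\<lambda>t. of_nat d * X t * Y t ^ (d - 1)) has_field_derivative
      of_nat d * (b0 * c0 * x0 + b1 * c1 * x1 + b2 * c2 * x2) * Y 0 ^ (d - 1) +
      of_nat d * of_nat (d - 1) * X 0 * (c0 * x0 + c1 * x1 + c2 * x2) * Y 0 ^ (d - 1 - 1)) (at 0)"
    by (rule derivative_eq_intros X Y refl | simp)+
  then have 3: "((\<lambda>t. d * (b0 * (x0 * exp (t * c0)) + b1 * (x1 * exp (t * c1)) + b2 * (x2 * exp (t * c2))) *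
        (x0 * exp (t * c0) + x1 * exp (t * c1) + x2 * exp (t * c2)) ^ (d - 1)) has_field_derivative
      d * (b0 * c0 * x0 + b1 * c1 * x1 + b2 * c2 * x2) * (x0 + x1 + x2) ^ (d - 1) +
      d * (d - 1 :: nat) * (b0 * x0 + b1 * x1 + b2 * x2) * (c0 * x0 + c1 * x1 + c2 * x2) * (x0 + x1 + x2) ^ (d - 2)) (at 0)"
    by (simp add: X_def Y_def numeral_2_eq_2)
  have "(\<Sum>m\<in>hom_exps d. trinom d m * monom3 x0 x1 x2 m * (lin3 b0 b1 b2 m * lin3 c0 c1 c2 m)) =
      d * (b0 * c0 * x0 + b1 * c1 * x1 + b2 * c2 * x2) * (x0 + x1 + x2) ^ (d - 1) +
      d * (d - 1 :: nat) * (b0 * x0 + b1 * x1 + b2 * x2) * (c0 * x0 + c1 * x1 + c2 * x2) * (x0 + x1 + x2) ^ (d - 2)"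
    by (rule DERIV_unique[OF 1[unfolded 2] 3])
  then show ?thesis by simp
qed

subsection \<open>Estimates on the torus\<close>

lemma norm_cis_minus_1_le: "cmod (cis x - 1) \<le> \<bar>x\<bar>"
  using iexp_approx1[of x 0] by (simp add: cis_conv_exp)

lemma norm_cis_minus_cis_le: "cmod (cis x - cis y) \<le> \<bar>x\<bar> + \<bar>y\<bar>"
  using norm_triangle_ineq4[of "cis x - 1" "cis y - 1"] norm_cis_minus_1_le[of x] norm_cis_minus_1_le[of y]
  by simp

lemma norm_cis_minus_linear_le: "cmod (cis x - 1 - \<i> * x) \<le> x\<^sup>2 / 2"
  using iexp_approx1[of x 1] by (simp add: cis_conv_exp algebra_simps power2_eq_square)

lemma cos_ge_quadratic: "cos x \<ge> 1 - x\<^sup>2 / 2" for x :: real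
proof -
  have "(sin (x / 2))\<^sup>2 \<le> (x / 2)\<^sup>2"
    using abs_sin_x_le_abs_x[of "x / 2"] by (simp only: abs_le_square_iff)
  then show ?thesis using cos_double_sin[of "x / 2"] by (simp add: power_divide)
qed

text \<open>Jordan's inequality, by concavity on the left half and by reflection at
  \<open>pi / 2\<close> on the right half.\<close>

lemma sin_ge_of_between:
  assumes "0 \<le> \<epsilon>" "\<epsilon> \<le> x" "x \<le> pi - \<epsilon>"
  shows "2 / pi * \<epsilon> \<le> sin x"
proof -
  have jordan: "2 / pi * y \<le> sin y" if y: "0 \<le> y" "y \<le> pi / 2" for y
  proof -
    have conc: "concave_on {0..pi} sin"
      by (intro f''_le0_imp_concave[where f' = cos and f'' = "\<lambda>x. - sin x"])
        (auto intro!: derivative_eq_intros simp: sin_ge_zero)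
    have "(1 - 2 * y / pi) * sin 0 + (2 * y / pi) * sin (pi / 2) \<le>
        sin ((1 - 2 * y / pi) *\<^sub>R 0 + (2 * y / pi) *\<^sub>R (pi / 2))"
      using y by (intro concave_onD[OF conc]) (auto simp: field_simps)
    then show ?thesis by simp
  qed
  show ?thesis
  proof (cases "x \<le> pi / 2")
    case True
    have "2 / pi * \<epsilon> \<le> 2 / pi * x" using assms by (intro mult_left_mono) auto
    also have "\<dots> \<le> sin x" using True assms by (intro jordan) auto
    finally show ?thesis .
  next
    case False
    have "2 / pi * \<epsilon> \<le> 2 / pi * (pi - x)" using assms by (intro mult_left_mono) auto
    also have "\<dots> \<le> sin (pi - x)" using False assms by (intro jordan) auto
    finally show ?thesis by simp
  qed
qed

text \<open>The argument keeps the distance \<open>3 / 4 * pi / n\<close> from all multiples of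
  \<open>pi\<close>, and Jordan's inequality has slope \<open>2 / pi\<close>.\<close>

lemma abs_sin_grid_ge:
  fixes k :: int and n :: nat
  assumes k: "k \<noteq> 0" "\<bar>k\<bar> < int n" and \<tau>: "\<bar>\<tau>\<bar> \<le> pi / (4 * n)"
  shows "\<bar>sin (pi * k / n + \<tau>)\<bar> \<ge> 3 / (2 * n)"
proof -
  have n: "n > 0" using k by auto
  have pos: "sin (pi * k / n + \<tau>) \<ge> 3 / (2 * n)" if k: "0 < k" "k < int n" and \<tau>: "\<bar>\<tau>\<bar> \<le> pi / (4 * n)" for k \<tau>
  proof -
    have "pi * 1 / n \<le> pi * real_of_int k / n" "pi * real_of_int k / n \<le> pi * (real n - 1) / n"
      using k n by (intro divide_right_mono mult_left_mono; simp)+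
    moreover have "pi * (real n - 1) / n = pi - pi / n" "pi / (4 * n) = pi / n / 4"
      using n by (simp_all add: field_simps)
    ultimately have "2 / pi * (3 / 4 * (pi / n)) \<le> sin (pi * k / n + \<tau>)"
      using \<tau> by (intro sin_ge_of_between) (auto simp: abs_le_iff)
    then show ?thesis by (simp add: field_simps)
  qed
  show ?thesis
  proof (cases "k > 0")
    case True
    then show ?thesis using pos[of k \<tau>] k \<tau> by simp
  next
    case False
    then have "sin (pi * real_of_int (- k) / n + - \<tau>) \<ge> 3 / (2 * n)"
      using k \<tau> by (intro pos) auto
    then have "sin (- (pi * k / n + \<tau>)) \<ge> 3 / (2 * n)" by simp
    then show ?thesis unfolding sin_minus by simp
  qed
qed

text \<open>The square is \<open>(q0 + q1 + q2)^2\<close> minus one nonnegative term for each of the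
  three differences of angles, and any single one may be kept. Both versions are needed since a
  nonzero grid vector may vanish in one coordinate.\<close>

lemma norm_sum3_cis_square_le:
  assumes q: "q0 \<ge> 0" "q1 \<ge> 0" "q2 \<ge> 0"
  shows "(cmod (of_real q0 + of_real q1 * cis x + of_real q2 * cis y))\<^sup>2 \<le> (q0 + q1 + q2)\<^sup>2 - 4 * (q0 * q1) * (sin (x / 2))\<^sup>2"
    and "(cmod (of_real q0 + of_real q1 * cis x + of_real q2 * cis y))\<^sup>2 \<le> (q0 + q1 + q2)\<^sup>2 - 4 * (q0 * q2) * (sin (y / 2))\<^sup>2"
proof -
  have half: "2 * (sin (t / 2))\<^sup>2 = 1 - cos t" for t :: real
    using cos_double_sin[of "t / 2"] by simp
  have four: "4 * u * (sin (t / 2))\<^sup>2 = 2 * (u * (1 - cos t))" for t u :: real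
    unfolding half[symmetric] by simp
  have sq: "(cos t)\<^sup>2 = 1 - (sin t)\<^sup>2" for t :: real by (simp add: cos_squared_eq)
  have eq: "(cmod (of_real q0 + of_real q1 * cis x + of_real q2 * cis y))\<^sup>2 =
      (q0 + q1 + q2)\<^sup>2 - 2 * (q0 * q1 * (1 - cos x)) - 2 * (q0 * q2 * (1 - cos y)) - 2 * (q1 * q2 * (1 - cos (x - y)))"
    unfolding cmod_power2 cos_diff
    by (simp add: power2_eq_square algebra_simps) (simp add: power2_eq_square[symmetric] sq algebra_simps)
  have nn: "0 \<le> q0 * q1 * (1 - cos x)" "0 \<le> q0 * q2 * (1 - cos y)" "0 \<le> q1 * q2 * (1 - cos (x - y))"
    using q by auto
  show "(cmod (of_real q0 + of_real q1 * cis x + of_real q2 * cis y))\<^sup>2 \<le> (q0 + q1 + q2)\<^sup>2 - 4 * (q0 * q1) * (sin (x / 2))\<^sup>2"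
    unfolding eq four using nn by linarith
  show "(cmod (of_real q0 + of_real q1 * cis x + of_real q2 * cis y))\<^sup>2 \<le> (q0 + q1 + q2)\<^sup>2 - 4 * (q0 * q2) * (sin (y / 2))\<^sup>2"
    unfolding eq four using nn by linarith
qed

text \<open>In the application \<open>p0, p1, p2\<close> are proportional to
  \<open>1, exp (2 * t1), exp (2 * t2)\<close>. As \<open>exp t1\<close> and \<open>exp t2\<close>
  are at most \<open>1\<close>, \<open>p0\<close> is the largest weight, hence at least
  \<open>1 / 3\<close>; as they are at least \<open>\<delta>\<close>, the other two are at least
  \<open>\<delta>^2 / 3\<close>. The assumption \<open>grid\<close> is the squared form of the bound
  on \<open>n\<close> coming from the floor in the theorem, and says how fine the grid may be while
  correlations stay below \<open>d^-4\<close>.\<close>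

locale torus_grid =
  fixes d n :: nat and p0 p1 p2 \<delta> :: real
  assumes d: "d \<ge> 1000" and n: "n \<ge> 2" and \<delta>: "\<delta> > 0"
    and psum: "p0 + p1 + p2 = 1" and p1_le: "p1 \<le> p0" and p2_le: "p2 \<le> p0"
    and p1_ge: "\<delta>\<^sup>2 / 3 \<le> p1" and p2_ge: "\<delta>\<^sup>2 / 3 \<le> p2"
    and grid: "45 * (real n)\<^sup>2 * ln d \<le> 4 * \<delta>\<^sup>2 * d"
begin

definition "N = n\<^sup>2"
text \<open>The mean exponents of the trinomial law are \<open>a1^2\<close> and \<open>a2^2\<close>;
  angles of order \<open>1 / a1\<close> and \<open>1 / a2\<close> are the local scale on which zeros
  are sought.\<close>

definition "a1 = sqrt (d * p1)"
definition "a2 = sqrt (d * p2)"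

lemma p_pos: "p0 > 0" "p1 > 0" "p2 > 0"
proof -
  have "\<delta>\<^sup>2 > 0" using \<delta> by simp
  then show "p1 > 0" "p2 > 0" using p1_ge p2_ge by linarith+
  then show "p0 > 0" using p1_le by simp
qed

lemma p0_ge: "p0 \<ge> 1 / 3"
  using psum p1_le p2_le by simp

lemma ln_d_ge: "ln d \<ge> 6"
proof -
  have "exp 6 = (exp 1 :: real) ^ 6" by (simp add: exp_of_nat_mult[symmetric])
  also have "\<dots> \<le> 3 ^ 6" by (intro power_mono exp_le) auto
  also have "\<dots> \<le> real d" using d by simp
  finally show ?thesis using d by (subst ln_ge_iff) auto
qed

lemma a_sq: "a1\<^sup>2 = d * p1" "a2\<^sup>2 = d * p2"
  using p_pos by (simp_all add: a1_def a2_def)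

text \<open>\<open>ln d >= 6\<close> turns \<open>grid\<close> into
  \<open>270 * n^2 <= 4 * \<delta>^2 * d\<close>, so \<open>d * p1\<close> and \<open>d * p2\<close>
  are at least \<open>22 * n^2\<close>. The local scale is therefore small against the grid
  spacing.\<close>

lemma a_ge: "a1 \<ge> 4 * n" "a2 \<ge> 4 * n" and a_ge9: "a1 \<ge> 8" "a2 \<ge> 8"
proof -
  have "45 * (real n)\<^sup>2 * 6 \<le> 45 * (real n)\<^sup>2 * ln d"
    by (intro mult_left_mono ln_d_ge) auto
  note n2 = order_trans[OF this grid]
  have "4 * n \<le> sqrt (d * p)" if "\<delta>\<^sup>2 / 3 \<le> p" for p :: real
  proof (rule real_le_rsqrt)
    have "d * (\<delta>\<^sup>2 / 3) \<le> d * p" using that by (intro mult_left_mono) auto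
    then show "(real (4 * n))\<^sup>2 \<le> d * p" 
      using n2 by (simp add: power_mult_distrib) (use zero_le_power2[of "real n"] in linarith)
  qed
  then show "a1 \<ge> 4 * n" "a2 \<ge> 4 * n" using p1_ge p2_ge by (auto simp: a1_def a2_def)
  then show "a1 \<ge> 8" "a2 \<ge> 8" using n by auto
qed

lemma a_pos: "a1 > 0" "a2 > 0" using a_ge9 by auto

lemma p_le_half: "p1 \<le> 1 / 2" "p2 \<le> 1 / 2"
  using psum p1_le p2_le p_pos by auto

lemma a_le: "a1 \<le> d" "a2 \<le> d"
proof -
  have "sqrt (d * p) \<le> d" if "p \<le> 1" for p :: real
  proof (rule real_le_lsqrt)
    have "real d * p \<le> real d * 1" using that by (intro mult_left_mono) auto
    also have "real d * 1 \<le> (real d)\<^sup>2" using d by (simp add: power2_eq_square)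
    finally show "real d * p \<le> (real d)\<^sup>2" .
  qed auto
  then show "a1 \<le> d" "a2 \<le> d" using p_le_half by (auto simp: a1_def a2_def)
qed

lemma N_le: "real N \<le> d"
proof -
  have "45 * (real n)\<^sup>2 * 6 \<le> 45 * (real n)\<^sup>2 * ln d"
    by (intro mult_left_mono ln_d_ge) auto
  also note grid
  also have "4 * \<delta>\<^sup>2 * d \<le> 4 * (3 / 2) * d"
    using p1_ge p_le_half by (intro mult_right_mono) auto
  finally have "(real n)\<^sup>2 \<le> d"
    using zero_le_power2[of "real n"] by linarith
  then show ?thesis by (simp add: N_def)
qed

text \<open>\<open>x ^ k <= exp (- k * y)\<close>, where \<open>grid\<close> gives
  \<open>d * y >= 9 / 2 * ln d\<close>; the loss from \<open>k >= 99 / 100 * d\<close> still leaves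
  the exponent \<open>4\<close>. The range starts at \<open>d - 2\<close> because second moments
  contain that power of the correlation function.\<close>

lemma decay:
  assumes x: "x \<ge> 0" "x\<^sup>2 \<le> 1 - 4 / 5 * \<delta>\<^sup>2 / N" and k: "k \<ge> d - 2"
  shows "x ^ k \<le> 1 / real d ^ 4"
proof -
  define y where "y = 2 / 5 * \<delta>\<^sup>2 / N"
  have N: "real N > 0" using n by (simp add: N_def)
  have y0: "y \<ge> 0" unfolding y_def by simp
  have "x\<^sup>2 \<le> 1 + (- (2 * y))" using x by (simp add: y_def)
  also have "\<dots> \<le> exp (- (2 * y))" by (rule exp_ge_add_one_self)
  also have "\<dots> = (exp (- y))\<^sup>2" by (simp add: power2_eq_square exp_add[symmetric])
  finally have "x \<le> exp (- y)" by (rule power2_le_imp_le) simp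
  then have "x ^ k \<le> exp (- y) ^ k" using x by (intro power_mono)
  also have "\<dots> = exp (- (real k * y))" by (simp add: exp_of_nat_mult[symmetric])
  also have "\<dots> \<le> exp (- (4 * ln d))"
  proof -
    have "real k \<ge> 99 / 100 * d" using k d by simp
    then have "real k * y \<ge> 99 / 100 * d * y" using y0 by (intro mult_right_mono)
    moreover have "d * y \<ge> 45 / 10 * ln d"
      using grid N unfolding y_def by (simp add: field_simps N_def)
    ultimately show ?thesis using ln_d_ge by simp
  qed
  also have "\<dots> = 1 / real d ^ 4"
  proof -
    have "exp (4 * ln d) = exp (ln d) ^ 4" by (simp add: exp_of_nat_mult[symmetric])
    then show ?thesis using d by (simp add: exp_minus field_simps)
  qed
  finally show ?thesis .
qed

text \<open>Some coordinate of the grid vector is nonzero, and there the squared sine is at least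
  \<open>9 / (4 * N)\<close>; times \<open>4 * 4 / 45\<close> this is the \<open>4 / 5\<close> of
  \<open>decay\<close>. Since \<open>p0 * p1\<close> and \<open>p0 * p2\<close> are at least
  \<open>\<delta>^2 / 9\<close>, the constant \<open>4 / 45\<close> leaves room for the perturbed
  weights in \<open>op_norm_le\<close>.\<close>

lemma grid_decay:
  fixes j1 j2 :: int
  assumes q: "q0 \<ge> 0" "q1 \<ge> 0" "q2 \<ge> 0" "q0 + q1 + q2 = 1"
    and q': "4 / 45 * \<delta>\<^sup>2 \<le> q0 * q1" "4 / 45 * \<delta>\<^sup>2 \<le> q0 * q2"
    and j: "\<bar>j1\<bar> < n" "\<bar>j2\<bar> < n" "(j1, j2) \<noteq> (0, 0)"
    and \<theta>: "\<bar>\<theta>1\<bar> \<le> 1 / n" "\<bar>\<theta>2\<bar> \<le> 1 / n" and k: "k \<ge> d - 2"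
  shows "cmod (of_real q0 + of_real q1 * cis (2 * pi * j1 / n + \<theta>1) + of_real q2 * cis (2 * pi * j2 / n + \<theta>2)) ^ k \<le> 1 / real d ^ 4"
proof (rule decay[OF _ _ k])
  let ?c = "cmod (of_real q0 + of_real q1 * cis (2 * pi * j1 / n + \<theta>1) + of_real q2 * cis (2 * pi * j2 / n + \<theta>2))"
  have n0: "real n > 0" using n by simp
  have s: "(sin ((2 * pi * j / n + \<theta>) / 2))\<^sup>2 \<ge> 9 / (4 * N)" if "j \<noteq> 0" "\<bar>j\<bar> < int n" "\<bar>\<theta>\<bar> \<le> 1 / n" for j :: int and \<theta>
  proof -
    have "1 / n / 2 \<le> pi / (4 * n)" using n0 pi_gt3 by (simp add: field_simps)
    then have "\<bar>\<theta> / 2\<bar> \<le> pi / (4 * n)" using that by simp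
    then have "3 / (2 * n) \<le> \<bar>sin (pi * j / n + \<theta> / 2)\<bar>" using that by (intro abs_sin_grid_ge)
    then have "(3 / (2 * n))\<^sup>2 \<le> \<bar>sin (pi * j / n + \<theta> / 2)\<bar>\<^sup>2" by (intro power_mono) auto
    moreover have e: "(2 * pi * j / n + \<theta>) / 2 = pi * j / n + \<theta> / 2" by (simp add: add_divide_distrib)
    ultimately show ?thesis unfolding e by (simp add: N_def power_divide power_mult_distrib)
  qed
  have m: "4 / 5 * \<delta>\<^sup>2 / N \<le> 4 * x * y" if "4 / 45 * \<delta>\<^sup>2 \<le> x" "9 / (4 * N) \<le> y" for x y :: real
  proof -
    have "4 * (4 / 45 * \<delta>\<^sup>2) * (9 / (4 * N)) \<le> 4 * x * y"
      using that zero_le_power2[of \<delta>] by (intro mult_mono; simp; linarith)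
    then show ?thesis by simp
  qed
  show "?c\<^sup>2 \<le> 1 - 4 / 5 * \<delta>\<^sup>2 / N"
  proof (cases "j1 = 0")
    case False
    then show ?thesis
      using norm_sum3_cis_square_le(1)[OF q(1-3), of "2 * pi * j1 / n + \<theta>1" "2 * pi * j2 / n + \<theta>2"]
        m[OF q'(1) s[of j1 \<theta>1]] j \<theta> q(4) by simp
  next
    case True
    then show ?thesis
      using norm_sum3_cis_square_le(2)[OF q(1-3), of "2 * pi * j1 / n + \<theta>1" "2 * pi * j2 / n + \<theta>2"]
        m[OF q'(2) s[of j2 \<theta>2]] j \<theta> q(4) by simp
  qed
qed simp

section \<open>Characters and residue classes of the grid\<close>

text \<open>The grid is indexed by triples of total degree greater than \<open>d\<close>, so that it lives in
  the index type of the coefficients but is disjoint from \<open>hom_exps d\<close>.\<close>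

definition "K = {Suc d} \<times> {..<n} \<times> {..<n}"

definition \<kappa> :: "nat \<times> nat \<times> nat \<Rightarrow> nat \<times> nat \<times> nat" where
  "\<kappa> = (\<lambda>(i0, i1, i2). (Suc d, i1 mod n, i2 mod n))"

definition ch :: "nat \<times> nat \<times> nat \<Rightarrow> nat \<times> nat \<times> nat \<Rightarrow> complex" where
  "ch = (\<lambda>(j0, j1, j2) (i0, i1, i2). unity_root n ^ (j1 * i1) * unity_root n ^ (j2 * i2))"

text \<open>The unitary Fourier matrix of the group of pairs of residues modulo \<open>n\<close>;
  the normalisation is \<open>n\<close> because \<open>K\<close> has \<open>n^2\<close>
  elements.\<close>

definition "F k j = cnj (ch j k) / of_nat n"

lemma n_pos: "n > 0" using n by simp

lemma N_pos: "N > 0" using n by (simp add: N_def)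

lemma finite_K [simp]: "finite K" by (simp add: K_def)

lemma card_K: "card K = N" by (simp add: K_def N_def power2_eq_square card_cartesian_product)

lemma disj_K: "hom_exps d \<inter> K = {}" by (auto simp: hom_exps_def K_def)

lemma \<kappa>_in_K: "\<kappa> m \<in> K" using n by (auto simp: \<kappa>_def K_def split: prod.splits)

lemma sum_K: "(\<Sum>j\<in>K. g j) = (\<Sum>j1<n. \<Sum>j2<n. g (Suc d, j1, j2))"
proof -
  have "K = (\<lambda>(j1, j2). (Suc d, j1, j2)) ` ({..<n} \<times> {..<n})" by (auto simp: K_def)
  then show ?thesis
    by (simp add: sum.reindex inj_on_def sum.cartesian_product case_prod_unfold)
qed

lemma ch_\<kappa>: "ch j (\<kappa> m) = ch j m"
  by (auto simp: ch_def \<kappa>_def unity_root_pow_eq_iff[OF n_pos] mod_mult_right_eq split: prod.splits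
      intro!: arg_cong2[where f = "(*)"])

lemma ch_commute: "ch j k = ch k j"
  by (auto simp: ch_def mult.commute split: prod.splits)

lemma monom3_ch: "monom3 x0 x1 x2 m * ch (j0, j1, j2) m = monom3 x0 (x1 * unity_root n ^ j1) (x2 * unity_root n ^ j2) m"
  by (auto simp: monom3_def ch_def power_mult_distrib power_mult split: prod.splits)

lemma F_orth1:
  assumes "j \<in> K" "l \<in> K"
  shows "(\<Sum>k\<in>K. F k j * cnj (F k l)) = (if j = l then 1 else 0)"
proof -
  obtain j1 j2 l1 l2 where jl: "j = (Suc d, j1, j2)" "l = (Suc d, l1, l2)"
    and lt: "j1 < n" "j2 < n" "l1 < n" "l2 < n" using assms by (auto simp: K_def)
  have "(\<Sum>k\<in>K. F k j * cnj (F k l)) =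
      (\<Sum>k1<n. \<Sum>k2<n. (unity_root n ^ (k1 * l1) * cnj (unity_root n ^ (k1 * j1))) *
         (unity_root n ^ (k2 * l2) * cnj (unity_root n ^ (k2 * j2))) / (of_nat n)\<^sup>2)"
    unfolding sum_K jl F_def ch_def by (simp add: mult_ac power2_eq_square)
  also have "\<dots> = (\<Sum>k1<n. unity_root n ^ (k1 * l1) * cnj (unity_root n ^ (k1 * j1))) *
      (\<Sum>k2<n. unity_root n ^ (k2 * l2) * cnj (unity_root n ^ (k2 * j2))) / (of_nat n)\<^sup>2"
    by (simp only: sum_product sum_divide_distrib)
  also have "\<dots> = (if j = l then 1 else 0)"
    unfolding sum_unity_root[OF n_pos] using lt n_pos by (auto simp: jl power2_eq_square)
  finally show ?thesis .
qed

lemma F_orth2: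
  assumes "k \<in> K" "l \<in> K"
  shows "(\<Sum>j\<in>K. F k j * cnj (F l j)) = (if k = l then 1 else 0)"
  using F_orth1[OF assms] by (simp add: F_def ch_commute)

lemma class_sum_le:
  fixes h :: "nat \<times> nat \<times> nat \<Rightarrow> real"
  assumes h: "\<And>m. m \<in> hom_exps d \<Longrightarrow> h m \<ge> 0" and k: "k \<in> K"
  shows "N * (\<Sum>m | m \<in> hom_exps d \<and> \<kappa> m = k. h m) \<le> (\<Sum>j\<in>K. cmod (\<Sum>m\<in>hom_exps d. h m * ch j m))"
proof -
  obtain k1 k2 where k': "k = (Suc d, k1, k2)" "k1 < n" "k2 < n" using k by (auto simp: K_def)
  have eq: "{m. m \<in> hom_exps d \<and> \<kappa> m = k} = {m. m \<in> hom_exps d \<and> fst (snd m) mod n = k1 \<and> snd (snd m) mod n = k2}"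
    by (auto simp: \<kappa>_def k' split: prod.splits)
  have "(real n)\<^sup>2 * (\<Sum>m | m \<in> hom_exps d \<and> fst (snd m) mod n = k1 \<and> snd (snd m) mod n = k2. h m) \<le>
    (\<Sum>j1<n. \<Sum>j2<n. cmod (\<Sum>m\<in>hom_exps d. h m * unity_root n ^ (j1 * fst (snd m)) * unity_root n ^ (j2 * snd (snd m))))"
    by (rule card_times_class_sum_le) (use n_pos k' h in auto)
  then show ?thesis
    unfolding sum_K eq ch_def by (simp add: N_def case_prod_unfold mult.assoc)
qed

lemma unity_root_cis: "unity_root n ^ j = cis (2 * pi * real_of_int (int j) / n + 0)"
  by (simp add: unity_root_pow)

text \<open>Trinomial mass is almost equidistributed over the residue classes: the trivial character
  contributes \<open>Q ^ d\<close>, and each of the others at most \<open>Q ^ d / d ^ 4\<close>, by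
  \<open>grid_decay\<close> for the weights divided by \<open>Q\<close>.\<close>

lemma class_mass_le:
  assumes q: "q0 \<ge> 0" "q1 \<ge> 0" "q2 \<ge> 0" and Q: "Q = q0 + q1 + q2" "Q > 0"
    and q': "4 / 45 * \<delta>\<^sup>2 * Q\<^sup>2 \<le> q0 * q1" "4 / 45 * \<delta>\<^sup>2 * Q\<^sup>2 \<le> q0 * q2" and k: "k \<in> K"
  shows "N * (\<Sum>m | m \<in> hom_exps d \<and> \<kappa> m = k. trinom d m * monom3 q0 q1 q2 m) \<le> 7 / 6 * Q ^ d"
proof -
  have m3: "complex_of_real (monom3 q0 q1 q2 m) = monom3 (complex_of_real q0) (complex_of_real q1) (complex_of_real q2) m" for m
    by (simp add: monom3_def split: prod.splits)
  have "N * (\<Sum>m | m \<in> hom_exps d \<and> \<kappa> m = k. trinom d m * monom3 q0 q1 q2 m) \<le>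
      (\<Sum>j\<in>K. cmod (\<Sum>m\<in>hom_exps d. (trinom d m * monom3 q0 q1 q2 m) * ch j m))"
    by (rule class_sum_le[OF _ k]) (use q in \<open>auto simp: trinom_def monom3_def\<close>)
  also have "\<dots> = (\<Sum>j\<in>K. cmod (of_real q0 + of_real q1 * unity_root n ^ fst (snd j) + of_real q2 * unity_root n ^ snd (snd j)) ^ d)"
    by (intro sum.cong refl)
      (auto simp: m3 mult.assoc monom3_ch trinomial norm_power[symmetric] split: prod.splits)
  also have "\<dots> \<le> (\<Sum>j\<in>K. Q ^ d * ((if j = (Suc d, 0, 0) then 1 else 0) + 1 / real d ^ 4))"
  proof (rule sum_mono)
    fix j assume "j \<in> K"
    then obtain j1 j2 where j: "j = (Suc d, j1, j2)" "j1 < n" "j2 < n" by (auto simp: K_def)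
    show "cmod (of_real q0 + of_real q1 * unity_root n ^ fst (snd j) + of_real q2 * unity_root n ^ snd (snd j)) ^ d \<le>
        Q ^ d * ((if j = (Suc d, 0, 0) then 1 else 0) + 1 / real d ^ 4)"
    proof (cases "j = (Suc d, 0, 0)")
      case True
      have "cmod (of_real q0 + of_real q1 + of_real q2) = Q"
        using Q q by (simp flip: of_real_add)
      then show ?thesis using True Q by (simp add: distrib_left)
    next
      case False
      define c where "c = cmod (of_real (q0 / Q) + of_real (q1 / Q) * cis (2 * pi * real_of_int (int j1) / n + 0) +
         of_real (q2 / Q) * cis (2 * pi * real_of_int (int j2) / n + 0))"
      have "c ^ d \<le> 1 / real d ^ 4"
        unfolding c_def
      proof (rule grid_decay)
        show "q0 / Q + q1 / Q + q2 / Q = 1" using Q by (simp add: add_divide_distrib[symmetric])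
        show "4 / 45 * \<delta>\<^sup>2 \<le> q0 / Q * (q1 / Q)" "4 / 45 * \<delta>\<^sup>2 \<le> q0 / Q * (q2 / Q)"
          using q' Q(2) by (simp_all add: field_simps power2_eq_square)
      qed (use q Q j False n_pos in auto)
      moreover have "cmod (of_real q0 + of_real q1 * unity_root n ^ fst (snd j) + of_real q2 * unity_root n ^ snd (snd j)) = Q * c"
      proof -
        have "of_real q0 + of_real q1 * unity_root n ^ fst (snd j) + of_real q2 * unity_root n ^ snd (snd j) =
          complex_of_real Q * (of_real (q0 / Q) + of_real (q1 / Q) * cis (2 * pi * real_of_int (int j1) / n + 0) +
         of_real (q2 / Q) * cis (2 * pi * real_of_int (int j2) / n + 0))"
          using Q(2) by (simp add: j unity_root_cis field_simps)
        then show ?thesis using Q(2) by (simp add: c_def norm_mult)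
      qed
      ultimately show ?thesis
        using False mult_left_mono[of "c ^ d" "1 / real d ^ 4" "Q ^ d"] Q(2)
        by (simp add: power_mult_distrib)
    qed
  qed
  also have "\<dots> = Q ^ d * (1 + N / real d ^ 4)"
  proof -
    have "(Suc d, 0, 0) \<in> K" using n_pos by (simp add: K_def)
    then show ?thesis
      by (simp add: sum_distrib_left[symmetric] sum.distrib card_K)
  qed
  also have "\<dots> \<le> Q ^ d * (7 / 6)"
  proof (intro mult_left_mono)
    have "N / real d ^ 4 \<le> d / real d ^ 4" by (intro divide_right_mono N_le) auto
    also have "\<dots> = 1 / real d ^ 3" using d by (simp add: power_numeral_reduce)
    also have "\<dots> \<le> 1 / 1000 ^ 3" using d by (intro divide_left_mono power_mono) auto
    finally show "1 + N / real d ^ 4 \<le> 7 / 6" by simp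
  qed (use Q in auto)
  finally show ?thesis by (simp add: mult.commute)
qed

section \<open>Coefficients of the barrier functions\<close>

definition "pm m = trinom d m * monom3 p0 p1 p2 m"
definition "\<sigma> m = sqrt (pm m)"

lemma pm_nonneg: "pm m \<ge> 0"
  using p_pos by (auto simp: pm_def trinom_def monom3_def split: prod.splits)

lemma \<sigma>_sq: "(\<sigma> m)\<^sup>2 = pm m" and \<sigma>_mult: "\<sigma> m * \<sigma> m = pm m"
  using pm_nonneg[of m] by (simp_all add: \<sigma>_def)

lemma pm_complex: "complex_of_real (pm m) = of_real (trinom d m) * monom3 (complex_of_real p0) (complex_of_real p1) (complex_of_real p2) m"
  by (simp add: pm_def monom3_def split: prod.splits)

text \<open>Determined by \<open>d * (b0 * p0 + b1 * p1 * y1 + b2 * p2 * y2) = a1 * (y1 - 1) + \<i>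
  * a2 * (y2 - 1)\<close>. By \<open>trinomial_moment1\<close>, weighting the trinomial law with
  \<open>lin3 b0 b1 b2\<close> then produces a function vanishing at \<open>(1, 1)\<close>; the
  factor \<open>\<i>\<close> makes its linearisation in the two angles nondegenerate over the
  reals.\<close>

definition "b0 = - (a1 + \<i> * a2) / (d * p0)"
definition "b1 = complex_of_real (a1 / (d * p1))"
definition "b2 = \<i> * a2 / (d * p2)"

lemma b_p: "b0 * p0 = - (a1 + \<i> * a2) / d" "b1 * p1 = a1 / d" "b2 * p2 = \<i> * a2 / d"
  using p_pos d by (simp_all add: b0_def b1_def b2_def)

text \<open>By \<open>trinomial_moment2\<close> each character sum is a diagonal term plus a product
  of first-order factors. At the trivial character the factor \<open>Y\<close> vanishes, because the
  barrier is zero at its grid point, and the diagonal term is at most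
  \<open>d * B = (p1 + p2) / p0 + 2 <= 4\<close>. Every other character contributes at most
  \<open>20 / d^2\<close>, together less than \<open>1\<close>.\<close>

lemma class_lin3_le:
  assumes k: "k \<in> K"
  shows "N * (\<Sum>m | m \<in> hom_exps d \<and> \<kappa> m = k. pm m * (cmod (lin3 b0 b1 b2 m))\<^sup>2) \<le> 5"
proof -
  define B where "B = (cmod b0)\<^sup>2 * p0 + (cmod b1)\<^sup>2 * p1 + (cmod b2)\<^sup>2 * p2"
  have d0: "real d > 0" using d by simp
  have B: "0 \<le> B" "d * B \<le> 4"
  proof -
    show "0 \<le> B" using p_pos by (simp add: B_def)
    have h: "(cmod b1)\<^sup>2 = a1\<^sup>2 / (d * p1)\<^sup>2" "(cmod b2)\<^sup>2 = a2\<^sup>2 / (d * p2)\<^sup>2"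
      using p_pos by (simp_all add: b1_def b2_def norm_mult norm_divide power_divide)
    have h0: "(cmod b0)\<^sup>2 = (a1\<^sup>2 + a2\<^sup>2) / (d * p0)\<^sup>2"
      using p_pos by (simp add: b0_def norm_mult norm_divide power_divide cmod_power2)
    have "d * ((cmod b1)\<^sup>2 * p1) = 1" "d * ((cmod b2)\<^sup>2 * p2) = 1"
      unfolding h a_sq using p_pos d0 by (simp_all add: power2_eq_square)
    moreover have "d * ((cmod b0)\<^sup>2 * p0) = (p1 + p2) / p0"
      unfolding h0 a_sq using p_pos d0 by (simp add: power2_eq_square field_simps)
    ultimately have "d * B = (p1 + p2) / p0 + 1 + 1"
      by (simp add: B_def distrib_left)
    also have "\<dots> \<le> 4" using p_pos p1_le p2_le by (simp add: field_simps)
    finally show "d * B \<le> 4" .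
  qed
  have bp: "cmod (b0 * p0) \<le> 2" "cmod (b1 * p1) \<le> 1" "cmod (b2 * p2) \<le> 1"
  proof -
    show "cmod (b1 * p1) \<le> 1" "cmod (b2 * p2) \<le> 1"
      unfolding b_p using a_le a_pos d0 by (simp_all add: norm_mult norm_divide)
    have "cmod (complex_of_real a1 + \<i> * complex_of_real a2) \<le> a1 + a2"
      using norm_triangle_ineq[of "complex_of_real a1" "\<i> * complex_of_real a2"] a_pos by (simp add: norm_mult)
    also have "\<dots> \<le> 2 * d" using a_le by simp
    finally show "cmod (b0 * p0) \<le> 2"
      unfolding b_p using d0 by (simp only: norm_divide norm_minus_cancel) (simp add: field_simps)
  qed
  have lin: "complex_of_real (pm m * (cmod (lin3 b0 b1 b2 m))\<^sup>2) =
      of_real (trinom d m) * monom3 (complex_of_real p0) (complex_of_real p1) (complex_of_real p2) m * (lin3 b0 b1 b2 m * lin3 (cnj b0) (cnj b1) (cnj b2) m)" for m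
  proof -
    have "lin3 (cnj b0) (cnj b1) (cnj b2) m = cnj (lin3 b0 b1 b2 m)"
      by (simp add: lin3_def split: prod.splits)
    then show ?thesis by (simp only: of_real_mult pm_complex complex_norm_square)
  qed
  have "N * (\<Sum>m | m \<in> hom_exps d \<and> \<kappa> m = k. pm m * (cmod (lin3 b0 b1 b2 m))\<^sup>2) \<le>
      (\<Sum>j\<in>K. cmod (\<Sum>m\<in>hom_exps d. (pm m * (cmod (lin3 b0 b1 b2 m))\<^sup>2) * ch j m))"
    by (rule class_sum_le[OF _ k]) (use pm_nonneg in auto)
  also have "\<dots> \<le> (\<Sum>j\<in>K. (if j = (Suc d, 0, 0) then 4 else 0) + 20 / real d ^ 2)"
  proof (rule sum_mono)
    fix j assume "j \<in> K"
    then obtain j1 j2 where j: "j = (Suc d, j1, j2)" "j1 < n" "j2 < n" by (auto simp: K_def)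
    define y1 y2 where "y1 = unity_root n ^ j1" and "y2 = unity_root n ^ j2"
    have y: "cmod y1 = 1" "cmod y2 = 1" by (simp_all add: y1_def y2_def norm_power)
    define c where "c = of_real p0 + of_real p1 * y1 + of_real p2 * y2"
    define X where "X = b0 * cnj b0 * of_real p0 + b1 * cnj b1 * (of_real p1 * y1) + b2 * cnj b2 * (of_real p2 * y2)"
    define Y where "Y = b0 * of_real p0 + b1 * (of_real p1 * y1) + b2 * (of_real p2 * y2)"
    define Z where "Z = cnj b0 * of_real p0 + cnj b1 * (of_real p1 * y1) + cnj b2 * (of_real p2 * y2)"
    have "(\<Sum>m\<in>hom_exps d. (pm m * (cmod (lin3 b0 b1 b2 m))\<^sup>2) * ch j m) =
      (\<Sum>m\<in>hom_exps d. of_real (trinom d m) * (monom3 (complex_of_real p0) (complex_of_real p1) (complex_of_real p2) m * ch j m) * (lin3 b0 b1 b2 m * lin3 (cnj b0) (cnj b1) (cnj b2) m))"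
      by (intro sum.cong refl) (simp only: lin mult_ac)
    also have "\<dots> = d * X * c ^ (d - 1) + of_nat (d * (d - 1)) * Y * Z * c ^ (d - 2)"
      unfolding j monom3_ch trinomial_moment2 by (simp only: X_def Y_def Z_def c_def y1_def y2_def)
    finally have eq: "(\<Sum>m\<in>hom_exps d. (pm m * (cmod (lin3 b0 b1 b2 m))\<^sup>2) * ch j m) = \<dots>" .
    have X: "cmod X \<le> B"
      unfolding X_def B_def using p_pos y
      by (intro norm_triangle_le add_mono) (auto simp: norm_mult power2_eq_square)
    have bpn: "cmod (b0 * p0) = cmod b0 * p0" "cmod (b1 * p1) = cmod b1 * p1" "cmod (b2 * p2) = cmod b2 * p2"
      using p_pos by (simp_all add: norm_mult)
    have YZ: "cmod Y \<le> 4" "cmod Z \<le> 4"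
    proof -
      have "cmod Y \<le> cmod b0 * p0 + cmod b1 * p1 + cmod b2 * p2"
        unfolding Y_def using p_pos y by (intro norm_triangle_le add_mono) (auto simp: norm_mult)
      then show "cmod Y \<le> 4" using bp bpn by simp
      have "cmod Z \<le> cmod b0 * p0 + cmod b1 * p1 + cmod b2 * p2"
        unfolding Z_def using p_pos y by (intro norm_triangle_le add_mono) (auto simp: norm_mult)
      then show "cmod Z \<le> 4" using bp bpn by simp
    qed
    show "cmod (\<Sum>m\<in>hom_exps d. (pm m * (cmod (lin3 b0 b1 b2 m))\<^sup>2) * ch j m) \<le>
        (if j = (Suc d, 0, 0) then 4 else 0) + 20 / real d ^ 2"
    proof (cases "j = (Suc d, 0, 0)")
      case True
      then have y1: "y1 = 1" "y2 = 1" using j by (simp_all add: y1_def y2_def)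
      have "Y = 0"
        unfolding Y_def y1 mult_1_right b_p using d0 by (simp add: field_simps)
      moreover have "c = 1" unfolding c_def y1 using psum by (simp flip: of_real_add)
      ultimately have "cmod (d * X * c ^ (d - 1) + of_nat (d * (d - 1)) * Y * Z * c ^ (d - 2)) = d * cmod X"
        by (simp add: norm_mult)
      also have "\<dots> \<le> d * B" by (intro mult_left_mono X) auto
      also have "\<dots> \<le> 4" by (rule B)
      finally show ?thesis unfolding eq using True by (simp add: add_increasing2)
    next
      case False
      have decay: "cmod c ^ k \<le> 1 / real d ^ 4" if "k \<ge> d - 2" for k
        unfolding c_def y1_def y2_def unity_root_cis
      proof (rule grid_decay[OF _ _ _ psum _ _ _ _ _ _ _ that])
        show "4 / 45 * \<delta>\<^sup>2 \<le> p0 * p1" "4 / 45 * \<delta>\<^sup>2 \<le> p0 * p2"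
          using mult_mono[OF p0_ge p1_ge] mult_mono[OF p0_ge p2_ge] p_pos zero_le_power2[of \<delta>] by linarith+
      qed (use p_pos j False n_pos in auto)
      have "cmod (d * X * c ^ (d - 1) + of_nat (d * (d - 1)) * Y * Z * c ^ (d - 2)) \<le>
          (d * B) * (1 / real d ^ 4) + (real d * real d) * 4 * 4 * (1 / real d ^ 4)"
      proof (intro order_trans[OF norm_triangle_ineq] add_mono)
        show "cmod (d * X * c ^ (d - 1)) \<le> (d * B) * (1 / real d ^ 4)"
          unfolding norm_mult norm_power using X B(1) decay by (intro mult_mono) auto
        have "real (d * (d - 1)) \<le> real d * real d" by (simp add: mult_left_mono)
        then show "cmod (of_nat (d * (d - 1)) * Y * Z * c ^ (d - 2)) \<le> (real d * real d) * 4 * 4 * (1 / real d ^ 4)"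
          unfolding norm_mult norm_power norm_of_nat using YZ decay
          by (intro mult_mono mult_nonneg_nonneg) auto
      qed
      also have "\<dots> \<le> 4 * (1 / real d ^ 4) + (real d * real d) * 4 * 4 * (1 / real d ^ 4)"
        using B by (intro add_right_mono mult_right_mono) auto
      also have "\<dots> \<le> 20 / real d ^ 2"
      proof -
        have "4 * (1 / real d ^ 4) \<le> 4 * (1 / real d ^ 2)"
          using d by (intro mult_left_mono divide_left_mono power_increasing) auto
        moreover have "(real d * real d) * 4 * 4 * (1 / real d ^ 4) = 16 / real d ^ 2"
          using d0 by (simp add: field_simps power_numeral_reduce)
        ultimately show ?thesis by (simp add: field_simps)
      qed
      finally show ?thesis unfolding eq using False by simp
    qed
  qed
  also have "\<dots> = 4 + N * (20 / real d ^ 2)"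
  proof -
    have "(Suc d, 0, 0) \<in> K" using n_pos by (simp add: K_def)
    then show ?thesis by (simp add: sum.distrib card_K)
  qed
  also have "\<dots> \<le> 4 + d * (20 / real d ^ 2)"
    by (intro add_left_mono mult_right_mono N_le) auto
  also have "\<dots> \<le> 5" using d by (simp add: power2_eq_square field_simps)
  finally show ?thesis .
qed

text \<open>The factor \<open>n\<close> cancels the \<open>1 / n\<close> in \<open>F\<close>;
  \<open>2 / 5\<close> satisfies \<open>4 / 25 * 5 <= 1\<close>, which turns
  \<open>class_lin3_le\<close> into the bound that the splitting requires on each class.\<close>

definition "w m = 2 / 5 * of_nat n * of_real (\<sigma> m) * lin3 b0 b1 b2 m"

lemma class_w_le:
  assumes "k \<in> K"
  shows "(\<Sum>m | m \<in> hom_exps d \<and> \<kappa> m = k. (cmod (w m))\<^sup>2) \<le> 1"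
proof -
  have "(cmod (w m))\<^sup>2 = 4 / 25 * (N * (pm m * (cmod (lin3 b0 b1 b2 m))\<^sup>2))" for m
    by (simp add: w_def norm_mult power_mult_distrib \<sigma>_sq N_def power_divide)
  then have "(\<Sum>m | m \<in> hom_exps d \<and> \<kappa> m = k. (cmod (w m))\<^sup>2) =
      4 / 25 * (N * (\<Sum>m | m \<in> hom_exps d \<and> \<kappa> m = k. pm m * (cmod (lin3 b0 b1 b2 m))\<^sup>2))"
    by (simp only: sum_distrib_left)
  also have "\<dots> \<le> 4 / 25 * 5" by (intro mult_left_mono class_lin3_le assms) auto
  finally show ?thesis by simp
qed

section \<open>Evaluation near grid points and its operator norm\<close>

definition L :: "complex \<Rightarrow> complex \<Rightarrow> complex \<Rightarrow> nat \<times> nat \<times> nat \<Rightarrow> nat \<times> nat \<times> nat \<Rightarrow> complex" where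
  "L s0 s1 s2 j m = of_real (\<sigma> m) * ch j m * monom3 (1 + s0) (1 + s1) (1 + s2) m"

text \<open>\<open>L\<close> evaluates the random polynomial at the grid point \<open>j\<close> with
  all three homogeneous coordinates perturbed. Its dependence on \<open>j\<close> passes only
  through \<open>\<kappa> m\<close>, up to a factor whose squared modulus is a trinomial weight with
  tilted parameters \<open>q = p * |1 + s|^2\<close>. Each class has tilted mass at most
  \<open>7 / 2 / N\<close>, and what remains is the unitary \<open>F\<close>. The hypothesis
  \<open>s\<close> kills the linear term of the total tilted weight, so that
  \<open>Q = 1 + D\<close> and \<open>Q ^ d <= exp (d * D) <= 3\<close>.\<close>

lemma op_norm_le:
  fixes s0 s1 s2 :: complex
  assumes s: "p0 * s0 + p1 * s1 + p2 * s2 = 0"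
    and D: "p0 * (cmod s0)\<^sup>2 + p1 * (cmod s1)\<^sup>2 + p2 * (cmod s2)\<^sup>2 \<le> 24 / 25 / d"
    and small: "cmod s0 \<le> 1 / 20" "cmod s1 \<le> 1 / 20" "cmod s2 \<le> 1 / 20"
  shows "(\<Sum>m\<in>hom_exps d. (cmod (\<Sum>j\<in>K. \<eta> j * cnj (L s0 s1 s2 j m)))\<^sup>2) \<le> 7 / 2 * (\<Sum>j\<in>K. (cmod (\<eta> j))\<^sup>2)"
proof -
  define D where "D = p0 * (cmod s0)\<^sup>2 + p1 * (cmod s1)\<^sup>2 + p2 * (cmod s2)\<^sup>2"
  define q0 q1 q2 where "q0 = p0 * (cmod (1 + s0))\<^sup>2" and "q1 = p1 * (cmod (1 + s1))\<^sup>2" and "q2 = p2 * (cmod (1 + s2))\<^sup>2"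
  define Q where "Q = q0 + q1 + q2"
  define H where "H = (\<lambda>k. \<Sum>j\<in>K. \<eta> j * cnj (ch j k))"
  have d0: "real d > 0" using d by simp
  have D0: "0 \<le> D" using p_pos by (simp add: D_def)
  have q: "q0 \<ge> 0" "q1 \<ge> 0" "q2 \<ge> 0" using p_pos by (simp_all add: q0_def q1_def q2_def)
  have QD: "Q = 1 + D"
  proof -
    have "Re (p0 * s0 + p1 * s1 + p2 * s2) = 0" unfolding s by simp
    then have 1: "p0 * Re s0 + p1 * Re s1 + p2 * Re s2 = 0" by simp
    have sq1: "(cmod (1 + s))\<^sup>2 = 1 + 2 * Re s + (cmod s)\<^sup>2" for s
      unfolding cmod_power2 by (simp add: power2_eq_square algebra_simps)
    have "Q = (p0 + p1 + p2) + 2 * (p0 * Re s0 + p1 * Re s1 + p2 * Re s2) + D"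
      unfolding Q_def q0_def q1_def q2_def D_def sq1 by algebra
    then show ?thesis using 1 psum by simp
  qed
  have Q0: "Q > 0" using QD D0 by simp
  have Q2: "Q\<^sup>2 \<le> 1002 / 1000"
  proof -
    have "24 / 25 / d \<le> 24 / 25 / 1000" using d by (intro divide_left_mono) auto
    then have "Q \<le> 1 + 24 / 25000" using QD D by (simp add: D_def)
    then have "Q\<^sup>2 \<le> (1 + 24 / 25000)\<^sup>2" using Q0 by (intro power_mono) auto
    then show ?thesis by (simp add: power2_eq_square)
  qed
  have Qd: "Q ^ d \<le> 3"
  proof -
    have "Q ^ d \<le> exp D ^ d"
      unfolding QD using D0 by (intro power_mono exp_ge_add_one_self) auto
    also have "\<dots> = exp (d * D)" by (simp add: exp_of_nat_mult)
    also have "\<dots> \<le> exp 1"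
      using mult_left_mono[OF D, of "real d"] d0 by (simp add: D_def)
    also have "\<dots> \<le> 3" by (rule exp_le)
    finally show ?thesis .
  qed
  have low: "(19 / 20)\<^sup>2 \<le> (cmod (1 + s))\<^sup>2" if "cmod s \<le> 1 / 20" for s
    using norm_triangle_ineq2[of 1 "- s"] that by (intro power_mono) auto
  have qq: "4 / 45 * \<delta>\<^sup>2 * Q\<^sup>2 \<le> (p0 * (cmod (1 + s0))\<^sup>2) * (p * (cmod (1 + s))\<^sup>2)"
    if "\<delta>\<^sup>2 / 3 \<le> p" "cmod s \<le> 1 / 20" for p s
  proof -
    have "4 / 45 * \<delta>\<^sup>2 * Q\<^sup>2 \<le> 4 / 45 * \<delta>\<^sup>2 * (1002 / 1000)" using Q2 by (intro mult_left_mono) auto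
    also have "\<dots> \<le> (1 / 3 * (19 / 20)\<^sup>2) * (\<delta>\<^sup>2 / 3 * (19 / 20)\<^sup>2)"
      by (simp add: power2_eq_square)
    also have "\<dots> \<le> (p0 * (cmod (1 + s0))\<^sup>2) * (p * (cmod (1 + s))\<^sup>2)"
    proof (intro mult_mono low p0_ge that small)
      have "0 \<le> \<delta>\<^sup>2 / 3" by simp
      then show "0 \<le> p" using that(1) by linarith
    qed (use p_pos in auto)
    finally show ?thesis .
  qed
  have mass: "N * (\<Sum>m | m \<in> hom_exps d \<and> \<kappa> m = k. trinom d m * monom3 q0 q1 q2 m) \<le> 7 / 2" if "k \<in> K" for k
  proof -
    have "N * (\<Sum>m | m \<in> hom_exps d \<and> \<kappa> m = k. trinom d m * monom3 q0 q1 q2 m) \<le> 7 / 6 * Q ^ d"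
      by (rule class_mass_le[OF q Q_def Q0 _ _ that])
        (use qq[OF p1_ge small(2)] qq[OF p2_ge small(3)] in \<open>simp_all add: q0_def q1_def q2_def\<close>)
    then show ?thesis using Qd by simp
  qed
  have summand: "(cmod (\<Sum>j\<in>K. \<eta> j * cnj (L s0 s1 s2 j m)))\<^sup>2 = (trinom d m * monom3 q0 q1 q2 m) * (cmod (H (\<kappa> m)))\<^sup>2" for m
  proof -
    have "(\<Sum>j\<in>K. \<eta> j * cnj (L s0 s1 s2 j m)) = of_real (\<sigma> m) * cnj (monom3 (1 + s0) (1 + s1) (1 + s2) m) * H (\<kappa> m)"
      by (simp add: L_def H_def ch_\<kappa> sum_distrib_left mult_ac)
    then have "(cmod (\<Sum>j\<in>K. \<eta> j * cnj (L s0 s1 s2 j m)))\<^sup>2 =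
        pm m * (cmod (monom3 (1 + s0) (1 + s1) (1 + s2) m))\<^sup>2 * (cmod (H (\<kappa> m)))\<^sup>2"
      by (simp add: norm_mult power_mult_distrib \<sigma>_sq)
    also have "pm m * (cmod (monom3 (1 + s0) (1 + s1) (1 + s2) m))\<^sup>2 = trinom d m * monom3 q0 q1 q2 m"
      by (simp add: pm_def monom3_def q0_def q1_def q2_def norm_mult norm_power power_mult_distrib
          power_mult[symmetric] mult_ac split: prod.splits)
    finally show ?thesis .
  qed
  have "(\<Sum>m\<in>hom_exps d. (cmod (\<Sum>j\<in>K. \<eta> j * cnj (L s0 s1 s2 j m)))\<^sup>2) =
      (\<Sum>k\<in>K. \<Sum>m | m \<in> hom_exps d \<and> \<kappa> m = k. (trinom d m * monom3 q0 q1 q2 m) * (cmod (H (\<kappa> m)))\<^sup>2)"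
    unfolding summand by (rule sum.group[symmetric]) (use \<kappa>_in_K in auto)
  also have "\<dots> = (\<Sum>k\<in>K. (N * (\<Sum>m | m \<in> hom_exps d \<and> \<kappa> m = k. trinom d m * monom3 q0 q1 q2 m)) * ((cmod (H k))\<^sup>2 / N))"
    using N_pos by (intro sum.cong refl) (simp add: sum_distrib_right)
  also have "\<dots> \<le> (\<Sum>k\<in>K. 7 / 2 * ((cmod (H k))\<^sup>2 / N))"
    by (intro sum_mono mult_right_mono mass) auto
  also have "\<dots> = 7 / 2 * (\<Sum>k\<in>K. (cmod (\<Sum>j\<in>K. F k j * \<eta> j))\<^sup>2)"
  proof -
    have "(cmod (H k))\<^sup>2 / N = (cmod (\<Sum>j\<in>K. F k j * \<eta> j))\<^sup>2" for k
    proof -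
      have "(\<Sum>j\<in>K. F k j * \<eta> j) = H k / of_nat n"
        by (simp add: F_def H_def sum_divide_distrib mult_ac)
      then show ?thesis by (simp add: norm_divide power_divide N_def)
    qed
    then show ?thesis by (simp add: sum_distrib_left)
  qed
  also have "\<dots> = 7 / 2 * (\<Sum>j\<in>K. (cmod (\<eta> j))\<^sup>2)"
    by (simp only: sum_norm_square_unitary[OF finite_K F_orth1])
  finally show ?thesis .
qed

text \<open>Solves \<open>p0 * s0 + p1 * s1 + p2 * s2 = 0\<close>, the condition under which the
  tilted weights grow only to second order.\<close>

definition s0_of :: "complex \<Rightarrow> complex \<Rightarrow> complex" where
  "s0_of s1 s2 = - (of_real p1 * s1 + of_real p2 * s2) / of_real p0"

text \<open>The radii are twice those on which the supremum is wanted, as the mean-square bound for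
  polynomials requires; \<open>d + 1\<close> nodes per circle match degree at most \<open>d\<close>
  in each variable.\<close>

definition node :: "nat \<times> nat \<Rightarrow> complex \<times> complex" where
  "node t = (of_real (2 / (5 * a1)) * unity_root (Suc d) ^ fst t, of_real (2 / (5 * a2)) * unity_root (Suc d) ^ snd t)"

definition "\<Omega> = {..<Suc d} \<times> {..<Suc d}"

definition "LN t j m = L (s0_of (fst (node t)) (snd (node t))) (fst (node t)) (snd (node t)) j m"

text \<open>The radii give \<open>p1 * |s1|^2 = p2 * |s2|^2 = 4 / 25 / d\<close>. For
  \<open>s0\<close>, the inequality \<open>(a1 + a2)^2 <= 2 * (a1^2 + a2^2)\<close> with
  \<open>p0 >= 1 / 3\<close> gives \<open>16 / 25 / d\<close>, so the total is the
  \<open>24 / 25 / d\<close> of \<open>op_norm_le\<close>.\<close>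

lemma LN_op_norm_le:
  "(\<Sum>m\<in>hom_exps d. (cmod (\<Sum>j\<in>K. \<eta> j * cnj (LN t j m)))\<^sup>2) \<le> 7 / 2 * (\<Sum>j\<in>K. (cmod (\<eta> j))\<^sup>2)"
proof -
  define s1 s2 where "s1 = fst (node t)" and "s2 = snd (node t)"
  define s0 where "s0 = s0_of s1 s2"
  have d0: "real d > 0" using d by simp
  have n1: "cmod s1 = 2 / (5 * a1)" "cmod s2 = 2 / (5 * a2)"
    using a_pos by (simp_all add: s1_def s2_def node_def norm_mult norm_power norm_divide)
  have ps: "p1 * cmod s1 = 2 / 5 * a1 / d" "p2 * cmod s2 = 2 / 5 * a2 / d"
    using a_sq a_pos p_pos d0 unfolding n1 by (simp_all add: power2_eq_square field_simps)
  have pss: "p1 * (cmod s1)\<^sup>2 = 4 / 25 / d" "p2 * (cmod s2)\<^sup>2 = 4 / 25 / d"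
    using a_sq a_pos p_pos d0 unfolding n1 by (simp_all add: power2_eq_square field_simps)
  have "p0 * cmod s0 = cmod (p1 * s1 + p2 * s2)"
    unfolding s0_def s0_of_def norm_divide norm_minus_cancel using p_pos by simp
  also have "\<dots> \<le> p1 * cmod s1 + p2 * cmod s2"
    using norm_triangle_ineq[of "p1 * s1" "p2 * s2"] p_pos by (simp add: norm_mult)
  also have "\<dots> = 2 / 5 * (a1 + a2) / d" unfolding ps by (simp add: distrib_left add_divide_distrib)
  finally have "(p0 * cmod s0)\<^sup>2 \<le> (2 / 5 * (a1 + a2) / d)\<^sup>2" using p_pos by (intro power_mono) auto
  also have "\<dots> = 4 / 25 * (a1 + a2)\<^sup>2 / (real d)\<^sup>2"
    unfolding power_divide power_mult_distrib by (simp add: power2_eq_square)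
  also have "\<dots> \<le> 4 / 25 * (2 * (a1\<^sup>2 + a2\<^sup>2)) / (real d)\<^sup>2"
  proof -
    have "(a1 + a2)\<^sup>2 \<le> 2 * (a1\<^sup>2 + a2\<^sup>2)"
      using zero_le_power2[of "a1 - a2"] by (simp add: power2_eq_square algebra_simps)
    then show ?thesis by (intro divide_right_mono mult_left_mono) auto
  qed
  also have "\<dots> = 8 / 25 * (p1 + p2) / d"
    unfolding a_sq using d0 by (simp add: power2_eq_square field_simps)
  also have "\<dots> \<le> 8 / 25 * (2 / 3) / d"
    using psum p0_ge by (intro divide_right_mono mult_left_mono) auto
  finally have p0s: "(p0 * cmod s0)\<^sup>2 \<le> 16 / 75 / d" by simp
  have p0s1: "p0 * (cmod s0)\<^sup>2 \<le> 16 / 25 / d"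
  proof -
    have "1 / 3 * (p0 * (cmod s0)\<^sup>2) \<le> p0 * (p0 * (cmod s0)\<^sup>2)" using p0_ge p_pos by (intro mult_right_mono) auto
    moreover have "(p0 * cmod s0)\<^sup>2 = p0 * (p0 * (cmod s0)\<^sup>2)" by (simp add: power2_eq_square)
    ultimately show ?thesis using p0s by simp
  qed
  have s0: "cmod s0 \<le> 1 / 20"
  proof -
    have "1 / 3 * (cmod s0)\<^sup>2 \<le> p0 * (cmod s0)\<^sup>2" using p0_ge by (intro mult_right_mono) auto
    also note p0s1
    also have "16 / 25 / real d \<le> 16 / 25 / 1000" using d by (intro divide_left_mono) auto
    finally have "(cmod s0)\<^sup>2 \<le> (1 / 20)\<^sup>2" by (simp add: power2_eq_square)
    then show ?thesis by (rule power2_le_imp_le) simp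
  qed
  have "2 / (5 * a) \<le> 1 / 20" if "a \<ge> 8" for a :: real
    using that by (simp add: field_simps)
  then have s12: "cmod s1 \<le> 1 / 20" "cmod s2 \<le> 1 / 20"
    using a_ge9 unfolding n1 by auto
  have z: "p0 * s0 + p1 * s1 + p2 * s2 = 0"
    using p_pos by (simp add: s0_def s0_of_def)
  have Dle: "p0 * (cmod s0)\<^sup>2 + p1 * (cmod s1)\<^sup>2 + p2 * (cmod s2)\<^sup>2 \<le> 24 / 25 / d"
    using p0s1 unfolding pss by (simp add: field_simps)
  show ?thesis
    using op_norm_le[OF z Dle s0 s12] by (simp add: LN_def s0_def s1_def s2_def)
qed

text \<open>A mean square over the nodes, scaled to dominate a squared supremum near the grid point
  \<open>j\<close>: \<open>16 / 9\<close> is \<open>(4 / 3)^2\<close>, one factor per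
  variable.\<close>

definition "S b j = 16 / 9 / real (card \<Omega>) * (\<Sum>t\<in>\<Omega>. (cmod (\<Sum>m\<in>hom_exps d. LN t j m * b m))\<^sup>2)"

text \<open>Since \<open>1 + s0_of s1 s2\<close> is affine in each variable, the function is a
  polynomial of degree at most \<open>d\<close> in either variable separately, and the one-variable
  mean-square bound applies twice.\<close>

lemma interpolation_bound:
  fixes s1 s2 :: complex
  assumes s: "cmod s1 \<le> 1 / (5 * a1)" "cmod s2 \<le> 1 / (5 * a2)"
  shows "(cmod (\<Sum>m\<in>hom_exps d. L (s0_of s1 s2) s1 s2 j m * b m))\<^sup>2 \<le> S b j"
proof -
  let ?u = "unity_root (Suc d)"
  define G where "G = (\<lambda>s1 s2. \<Sum>m\<in>hom_exps d. L (s0_of s1 s2) s1 s2 j m * b m)"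
  define r1 r2 where "r1 = 2 / (5 * a1)" and "r2 = 2 / (5 * a2)"
  have r: "r1 > 0" "r2 > 0" "cmod s1 \<le> r1 / 2" "cmod s2 \<le> r2 / 2"
    using a_pos s by (simp_all add: r1_def r2_def)
  define P1 where "P1 = (\<lambda>s2 :: complex. \<Sum>(i0, i1, i2)\<in>hom_exps d. smult (of_real (\<sigma> (i0, i1, i2)) * ch j (i0, i1, i2) * b (i0, i1, i2) * (1 + s2) ^ i2)
    ([:1 - p2 * s2 / p0, - (p1 / p0):] ^ i0 * [:1, 1:] ^ i1))"
  define P2 where "P2 = (\<lambda>s1 :: complex. \<Sum>(i0, i1, i2)\<in>hom_exps d. smult (of_real (\<sigma> (i0, i1, i2)) * ch j (i0, i1, i2) * b (i0, i1, i2) * (1 + s1) ^ i1)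
    ([:1 - p1 * s1 / p0, - (p2 / p0):] ^ i0 * [:1, 1:] ^ i2))"
  have s0: "1 + s0_of s1 s2 = (1 - p2 * s2 / p0) + s1 * (- (p1 / p0))" "1 + s0_of s1 s2 = (1 - p1 * s1 / p0) + s2 * (- (p2 / p0))" for s1 s2 :: complex
    using p_pos by (simp_all add: s0_of_def field_simps)
  have G1: "G s1 s2 = poly (P1 s2) s1" for s1 s2 :: complex
    unfolding G_def P1_def poly_sum
    by (intro sum.cong refl) (auto simp: L_def monom3_def s0(1) mult_ac)
  have G2: "G s1 s2 = poly (P2 s1) s2" for s1 s2 :: complex
    unfolding G_def P2_def poly_sum
    by (intro sum.cong refl) (auto simp: L_def monom3_def s0(2) mult_ac)
  have deg: "degree (smult c ([:x, y:] ^ i * [:1, 1:] ^ l)) \<le> d" if "i + l \<le> d" for c x y :: complex and i l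
  proof -
    have "degree ([:x, y:] ^ i * [:1, 1:] ^ l) \<le> 1 * i + 1 * l"
      by (intro order_trans[OF degree_mult_le] add_mono order_trans[OF degree_power_le] mult_right_mono) auto
    then show ?thesis using that degree_smult_le[of c "[:x, y:] ^ i * [:1, 1:] ^ l"] by simp
  qed
  have d1: "degree (P1 s2) < Suc d" for s2
    unfolding P1_def less_Suc_eq_le
    by (intro degree_sum_le finite_hom_exps) 
      (rename_tac p, rule_tac y = p in prod_cases3, simp only: prod.case, rule deg, simp add: hom_exps_def)
  have d2: "degree (P2 s1) < Suc d" for s1
    unfolding P2_def less_Suc_eq_le
    by (intro degree_sum_le finite_hom_exps) 
      (rename_tac p, rule_tac y = p in prod_cases3, simp only: prod.case, rule deg, simp add: hom_exps_def)
  have "(cmod (G s1 s2))\<^sup>2 \<le> 4 / 3 * ((\<Sum>t1<Suc d. (cmod (G (r1 * ?u ^ t1) s2))\<^sup>2) / Suc d)"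
    unfolding G1 by (rule norm_poly_square_le_mean_roots[OF d1 r(1) r(3)])
  also have "\<dots> \<le> 4 / 3 * ((\<Sum>t1<Suc d. 4 / 3 * ((\<Sum>t2<Suc d. (cmod (G (r1 * ?u ^ t1) (r2 * ?u ^ t2)))\<^sup>2) / Suc d)) / Suc d)"
  proof (intro mult_left_mono divide_right_mono sum_mono)
    fix t1
    show "(cmod (G (r1 * ?u ^ t1) s2))\<^sup>2 \<le> 4 / 3 * ((\<Sum>t2<Suc d. (cmod (G (r1 * ?u ^ t1) (r2 * ?u ^ t2)))\<^sup>2) / Suc d)"
      unfolding G2 by (rule norm_poly_square_le_mean_roots[OF d2 r(2) r(4)])
  qed auto
  also have "\<dots> = 16 / 9 / (real (Suc d) * real (Suc d)) * (\<Sum>t1<Suc d. \<Sum>t2<Suc d. (cmod (G (r1 * ?u ^ t1) (r2 * ?u ^ t2)))\<^sup>2)"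
    unfolding sum_divide_distrib[symmetric] sum_distrib_left[symmetric] by (simp del: of_nat_Suc sum.lessThan_Suc)
  also have "(\<Sum>t1<Suc d. \<Sum>t2<Suc d. (cmod (G (r1 * ?u ^ t1) (r2 * ?u ^ t2)))\<^sup>2) = (\<Sum>t\<in>\<Omega>. (cmod (\<Sum>m\<in>hom_exps d. LN t j m * b m))\<^sup>2)"
    unfolding \<Omega>_def sum.cartesian_product
    by (intro sum.cong refl) (auto simp: G_def LN_def node_def r1_def r2_def)
  also have "real (Suc d) * real (Suc d) = real (card \<Omega>)"
    unfolding \<Omega>_def card_cartesian_product card_lessThan of_nat_mult ..
  finally show ?thesis by (simp add: G_def S_def)
qed

subsection \<open>Zeros of perturbed barrier functions\<close>

definition G :: "(nat \<times> nat \<times> nat \<Rightarrow> complex) \<Rightarrow> complex \<Rightarrow> complex \<Rightarrow> complex" where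
  "G a x1 x2 = (\<Sum>m\<in>hom_exps d. of_real (\<sigma> m) * a m * monom3 1 x1 x2 m)"

definition v :: "nat \<times> nat \<times> nat \<Rightarrow> nat \<times> nat \<times> nat \<Rightarrow> complex" where
  "v j m = F (\<kappa> m) j * w m"

definition cc :: "complex \<Rightarrow> complex \<Rightarrow> complex" where
  "cc y1 y2 = of_real p0 + of_real p1 * y1 + of_real p2 * y2"

definition ell :: "complex \<Rightarrow> complex \<Rightarrow> complex" where
  "ell y1 y2 = of_real a1 * (y1 - 1) + \<i> * of_real a2 * (y2 - 1)"

text \<open>The conjugate character in \<open>F\<close> rotates the arguments to the grid point, and
  \<open>b_p\<close> identifies the first-order factor with \<open>ell\<close>; this is the identity
  for which \<open>b0, b1, b2\<close> were chosen.\<close>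

lemma G_v:
  "G (v (l0, l1, l2)) x1 x2 = 2 / 5 * ell (x1 * cnj (unity_root n ^ l1)) (x2 * cnj (unity_root n ^ l2)) *
     cc (x1 * cnj (unity_root n ^ l1)) (x2 * cnj (unity_root n ^ l2)) ^ (d - 1)"
proof -
  define y1 y2 where "y1 = x1 * cnj (unity_root n ^ l1)" and "y2 = x2 * cnj (unity_root n ^ l2)"
  have summand: "of_real (\<sigma> m) * v (l0, l1, l2) m * monom3 1 x1 x2 m =
      2 / 5 * (of_real (trinom d m) * monom3 (of_real p0) (of_real p1 * y1) (of_real p2 * y2) m * lin3 b0 b1 b2 m)" for m
  proof -
    have "of_real (\<sigma> m) * v (l0, l1, l2) m * monom3 1 x1 x2 m =
        2 / 5 * (of_real (\<sigma> m * \<sigma> m) * (cnj (ch (l0, l1, l2) m) * monom3 1 x1 x2 m) * lin3 b0 b1 b2 m)"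
      using n_pos by (simp add: v_def F_def w_def ch_\<kappa>)
    also have "of_real (\<sigma> m * \<sigma> m) = complex_of_real (pm m)" by (simp only: \<sigma>_mult)
    also have "cnj (ch (l0, l1, l2) m) * monom3 1 x1 x2 m = monom3 1 y1 y2 m"
      by (auto simp: ch_def monom3_def y1_def y2_def power_mult_distrib power_mult split: prod.splits)
    also have "complex_of_real (pm m) * monom3 1 y1 y2 m =
        of_real (trinom d m) * monom3 (of_real p0) (of_real p1 * y1) (of_real p2 * y2) m"
      unfolding pm_complex by (simp add: monom3_def power_mult_distrib split: prod.splits)
    finally show ?thesis .
  qed
  have "G (v (l0, l1, l2)) x1 x2 = 2 / 5 * (d * (b0 * p0 + b1 * (p1 * y1) + b2 * (p2 * y2)) * cc y1 y2 ^ (d - 1))"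
    unfolding G_def summand sum_distrib_left[symmetric] trinomial_moment1 by (simp add: cc_def)
  also have "d * (b0 * p0 + b1 * (p1 * y1) + b2 * (p2 * y2)) = ell y1 y2"
    using d unfolding mult.assoc[symmetric] b_p ell_def by (simp add: field_simps)
  finally show ?thesis by (simp add: y1_def y2_def)
qed

lemma G_combination:
  "G (\<lambda>m\<in>hom_exps d. b m + (\<Sum>l\<in>K. z l * v l m)) x1 x2 = G b x1 x2 + (\<Sum>l\<in>K. z l * G (v l) x1 x2)"
proof -
  have "G (\<lambda>m\<in>hom_exps d. b m + (\<Sum>l\<in>K. z l * v l m)) x1 x2 =
      (\<Sum>m\<in>hom_exps d. of_real (\<sigma> m) * b m * monom3 1 x1 x2 m + (\<Sum>l\<in>K. z l * (of_real (\<sigma> m) * v l m * monom3 1 x1 x2 m)))"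
    unfolding G_def by (intro sum.cong refl) (simp add: distrib_left distrib_right sum_distrib_left sum_distrib_right mult_ac)
  also have "\<dots> = G b x1 x2 + (\<Sum>m\<in>hom_exps d. \<Sum>l\<in>K. z l * (of_real (\<sigma> m) * v l m * monom3 1 x1 x2 m))"
    by (simp add: sum.distrib G_def)
  also have "(\<Sum>m\<in>hom_exps d. \<Sum>l\<in>K. z l * (of_real (\<sigma> m) * v l m * monom3 1 x1 x2 m)) =
      (\<Sum>l\<in>K. \<Sum>m\<in>hom_exps d. z l * (of_real (\<sigma> m) * v l m * monom3 1 x1 x2 m))"
    by (rule sum.swap)
  finally show ?thesis by (simp add: G_def sum_distrib_left)
qed

lemma norm_cc_le: "cmod y1 = 1 \<Longrightarrow> cmod y2 = 1 \<Longrightarrow> cmod (cc y1 y2) \<le> 1"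
proof -
  assume "cmod y1 = 1" "cmod y2 = 1"
  then have "cmod (cc y1 y2) \<le> p0 + p1 + p2"
    unfolding cc_def using p_pos by (intro norm_triangle_le add_mono) (auto simp: norm_mult)
  then show ?thesis using psum by simp
qed

text \<open>\<open>(1 + s0, 1 + s1, 1 + s2)\<close> is the multiple of \<open>(1, y1, y2)\<close> on the plane
  \<open>p0 X0 + p1 X1 + p2 X2 = 1\<close>, where the weights of the polynomial are flat.\<close>

lemma norm_G_square_le:
  assumes y: "cmod y1 = 1" "cmod y2 = 1" and c0: "cc y1 y2 \<noteq> 0"
    and s: "cmod (y1 / cc y1 y2 - 1) \<le> 1 / (5 * a1)" "cmod (y2 / cc y1 y2 - 1) \<le> 1 / (5 * a2)"
  shows "(cmod (G b (unity_root n ^ j1 * y1) (unity_root n ^ j2 * y2)))\<^sup>2 \<le> S b (Suc d, j1, j2)"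
proof -
  define c where "c = cc y1 y2"
  define s1 s2 where "s1 = y1 / c - 1" and "s2 = y2 / c - 1"
  have c: "c \<noteq> 0" "cmod c \<le> 1" using c0 norm_cc_le[OF y] by (simp_all add: c_def)
  have p0: "complex_of_real p0 \<noteq> 0" using p_pos by simp
  have ps: "complex_of_real p0 + of_real p1 + of_real p2 = 1" using psum by (simp flip: of_real_add)
  have "of_real p0 * (s0_of s1 s2 + 1) = of_real p0 * (1 / c)"
  proof -
    have "of_real p0 * (s0_of s1 s2 + 1) = (of_real p0 + of_real p1 + of_real p2) - (of_real p1 * y1 + of_real p2 * y2) / c"
      using p0 by (simp add: s0_of_def s1_def s2_def add_divide_distrib field_simps)
    also have "\<dots> = (c - (of_real p1 * y1 + of_real p2 * y2)) / c"
      unfolding ps using c(1) by (simp add: diff_divide_distrib)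
    also have "\<dots> = of_real p0 * (1 / c)" by (simp add: c_def cc_def)
    finally show ?thesis .
  qed
  then have "s0_of s1 s2 + 1 = 1 / c" by (rule mult_left_cancel[OF p0, THEN iffD1])
  then have s0: "1 + s0_of s1 s2 = 1 / c" by (simp only: add.commute)
  \<comment> \<open>Homogeneity of degree \<open>d\<close> extracts \<open>c ^ d\<close>, of modulus
    at most \<open>1\<close>, in passing to the flat plane.\<close>
  have "G b (unity_root n ^ j1 * y1) (unity_root n ^ j2 * y2) =
      c ^ d * (\<Sum>m\<in>hom_exps d. L (s0_of s1 s2) s1 s2 (Suc d, j1, j2) m * b m)"
    unfolding G_def sum_distrib_left
  proof (intro sum.cong refl)
    fix m assume "m \<in> hom_exps d"
    then obtain i0 i1 i2 where m: "m = (i0, i1, i2)" "i0 + i1 + i2 = d" by (auto simp: hom_exps_def)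
    have "c ^ d * monom3 (1 / c) (y1 / c) (y2 / c) m = monom3 1 y1 y2 m"
      using c(1) unfolding m(1) monom3_def m(2)[symmetric] by (simp add: power_add power_divide)
    moreover have "monom3 1 (unity_root n ^ j1 * y1) (unity_root n ^ j2 * y2) m = ch (Suc d, j1, j2) m * monom3 1 y1 y2 m"
      by (simp add: m monom3_def ch_def power_mult_distrib power_mult)
    ultimately show "of_real (\<sigma> m) * b m * monom3 1 (unity_root n ^ j1 * y1) (unity_root n ^ j2 * y2) m =
        c ^ d * (L (s0_of s1 s2) s1 s2 (Suc d, j1, j2) m * b m)"
      unfolding L_def s0 by (simp add: s1_def s2_def mult_ac)
  qed
  then have "cmod (G b (unity_root n ^ j1 * y1) (unity_root n ^ j2 * y2)) \<le>
      cmod (\<Sum>m\<in>hom_exps d. L (s0_of s1 s2) s1 s2 (Suc d, j1, j2) m * b m)"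
    using c(2) by (simp add: norm_mult norm_power mult_left_le_one_le power_le_one)
  then have "(cmod (G b (unity_root n ^ j1 * y1) (unity_root n ^ j2 * y2)))\<^sup>2 \<le>
      (cmod (\<Sum>m\<in>hom_exps d. L (s0_of s1 s2) s1 s2 (Suc d, j1, j2) m * b m))\<^sup>2"
    by (rule power_mono) simp
  also have "\<dots> \<le> S b (Suc d, j1, j2)"
    by (rule interpolation_bound) (use s in \<open>simp_all add: s1_def s2_def c_def\<close>)
  finally show ?thesis .
qed

text \<open>In the coordinate \<open>u = a1 \<theta>1 + \<i> a2 \<theta>2\<close> the barrier function \<open>ell\<close> is \<open>\<i> u\<close> up to a
  quadratic error, so a zero persists under perturbations by Brouwer's theorem.\<close>

lemma exists_zero:
  assumes j: "j \<in> K" and Sj: "S b j \<le> 25" and zj: "200 \<le> cmod (z j)" and z: "\<And>l. l \<in> K \<Longrightarrow> cmod (z l) \<le> d"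
  shows "\<exists>\<theta>1 \<theta>2. G (\<lambda>m\<in>hom_exps d. b m + (\<Sum>l\<in>K. z l * v l m)) (cis \<theta>1) (cis \<theta>2) = 0"
proof -
  obtain j1 j2 where jj: "j = (Suc d, j1, j2)" "j1 < n" "j2 < n" using j by (auto simp: K_def)
  have d0: "real d > 0" using d by simp
  define y1 y2 where "y1 = (\<lambda>u. cis (Re u / a1))" and "y2 = (\<lambda>u. cis (Im u / a2))"
  define x1 x2 where "x1 = (\<lambda>u. unity_root n ^ j1 * y1 u)" and "x2 = (\<lambda>u. unity_root n ^ j2 * y2 u)"
  define g where "g = (\<lambda>u. G b (x1 u) (x2 u) + (\<Sum>l\<in>K - {j}. z l * G (v l) (x1 u) (x2 u)))"
  define e where "e = (\<lambda>u. 2 / 5 * z j * cc (y1 u) (y2 u) ^ (d - 1))"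
  have y: "cmod (y1 u) = 1" "cmod (y2 u) = 1" for u by (simp_all add: y1_def y2_def)
  have f: "G (\<lambda>m\<in>hom_exps d. b m + (\<Sum>l\<in>K. z l * v l m)) (x1 u) (x2 u) = g u + e u * ell (y1 u) (y2 u)" for u
  proof -
    have "x1 u * cnj (unity_root n ^ j1) = (unity_root n ^ j1 * cnj (unity_root n ^ j1)) * y1 u"
      "x2 u * cnj (unity_root n ^ j2) = (unity_root n ^ j2 * cnj (unity_root n ^ j2)) * y2 u"
      by (simp_all only: x1_def x2_def mult_ac)
    moreover have "unity_root n ^ i * cnj (unity_root n ^ i) = 1" for i
      by (simp only: complex_norm_square[symmetric] norm_power norm_unity_root) simp
    ultimately have "x1 u * cnj (unity_root n ^ j1) = y1 u" "x2 u * cnj (unity_root n ^ j2) = y2 u"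
      by (simp_all only: mult_1_left)
    then have "G (v j) (x1 u) (x2 u) = 2 / 5 * ell (y1 u) (y2 u) * cc (y1 u) (y2 u) ^ (d - 1)"
      unfolding jj G_v by (simp only:)
    then show ?thesis
      unfolding G_combination g_def e_def using sum.remove[OF finite_K j, of "\<lambda>l. z l * G (v l) (x1 u) (x2 u)"]
      by (simp add: algebra_simps)
  qed

  \<comment> \<open>By \<open>f\<close> the function is \<open>g + e * ell\<close>. The equation
    \<open>u = \<i> * (ell - \<i> * u) + \<i> * (g / e)\<close> says exactly
    \<open>ell + g / e = 0\<close>, so a fixed point of this map is a zero. The claim is that the
    map sends the disc of radius \<open>1 / 10\<close> into itself.\<close>
  have main: "cc (y1 u) (y2 u) \<noteq> 0 \<and> cmod (\<i> * (ell (y1 u) (y2 u) - \<i> * u) + \<i> * (g u / e u)) \<le> 1 / 10"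
    if u: "cmod u \<le> 1 / 10" for u
  proof -
    define \<theta>1 \<theta>2 where "\<theta>1 = Re u / a1" and "\<theta>2 = Im u / a2"
    have u2: "(Re u)\<^sup>2 + (Im u)\<^sup>2 \<le> 1 / 100"
      unfolding cmod_power2[symmetric] using power_mono[OF u, of 2] by (simp add: power_divide)
    have re: "\<bar>Re u\<bar> \<le> 1 / 10" "\<bar>Im u\<bar> \<le> 1 / 10"
      using u abs_Re_le_cmod[of u] abs_Im_le_cmod[of u] by linarith+
    have th: "\<bar>\<theta>1\<bar> \<le> 1 / 10 / a1" "\<bar>\<theta>2\<bar> \<le> 1 / 10 / a2"
      unfolding \<theta>1_def \<theta>2_def abs_divide abs_of_pos[OF a_pos(1)] abs_of_pos[OF a_pos(2)]
      using re a_pos by (intro divide_right_mono; simp)+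
    define c where "c = cc (y1 u) (y2 u)"
    have pth: "p1 * \<theta>1\<^sup>2 = (Re u)\<^sup>2 / d" "p2 * \<theta>2\<^sup>2 = (Im u)\<^sup>2 / d"
      unfolding \<theta>1_def \<theta>2_def power_divide a_sq using p_pos d0 by simp_all
    have c_ge: "cmod c \<ge> 1 - 1 / (200 * d)"
    proof -
      have "((Re u)\<^sup>2 + (Im u)\<^sup>2) / (2 * d) \<le> (1 / 100) / (2 * d)"
        using u2 by (intro divide_right_mono) auto
      then have "1 - 1 / (200 * d) \<le> 1 - ((Re u)\<^sup>2 + (Im u)\<^sup>2) / (2 * d)" by simp
      also have "\<dots> = p0 + p1 * (1 - \<theta>1\<^sup>2 / 2) + p2 * (1 - \<theta>2\<^sup>2 / 2)"
        using pth psum by (simp add: algebra_simps add_divide_distrib)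
      also have "\<dots> \<le> p0 + p1 * cos \<theta>1 + p2 * cos \<theta>2"
        using p_pos by (intro add_mono mult_left_mono cos_ge_quadratic) auto
      also have "\<dots> = Re c" by (simp add: c_def cc_def y1_def y2_def \<theta>1_def \<theta>2_def)
      also have "\<dots> \<le> cmod c" by (rule complex_Re_le_cmod)
      finally show ?thesis .
    qed
    have small: "1 / (200 * real d) \<le> 1 / 100" using d by (simp add: field_simps)
    have c0: "c \<noteq> 0" and c99: "cmod c \<ge> 99 / 100" using c_ge small by auto
    have c_le: "cmod c \<le> 1" unfolding c_def by (rule norm_cc_le[OF y])
    \<comment> \<open>Bernoulli's inequality: \<open>|c|\<close> differs from \<open>1\<close> by at
      most \<open>1 / (200 * d)\<close>, so its power loses at most \<open>1 / 200\<close>.\<close>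
    have cd: "cmod c ^ (d - 1) \<ge> 199 / 200"
    proof -
      have "199 / 200 = 1 + real d * (- (1 / (200 * d)))" using d0 by simp
      also have "\<dots> \<le> (1 + (- (1 / (200 * d)))) ^ d"
        using small by (intro Bernoulli_inequality) auto
      also have "\<dots> \<le> cmod c ^ d" using c_ge small by (intro power_mono) auto
      also have "\<dots> \<le> cmod c ^ (d - 1)" using c_le by (intro power_decreasing) auto
      finally show ?thesis .
    qed
    have ell: "cmod (ell (y1 u) (y2 u) - \<i> * u) \<le> 1 / 1600"
    proof -
      have iu: "complex_of_real a1 * (\<i> * \<theta>1) + \<i> * a2 * (\<i> * \<theta>2) = \<i> * u"
        using a_pos by (simp add: \<theta>1_def \<theta>2_def complex_eq_iff)
      have "ell (y1 u) (y2 u) - \<i> * u = a1 * (cis \<theta>1 - 1 - \<i> * \<theta>1) + \<i> * a2 * (cis \<theta>2 - 1 - \<i> * \<theta>2)"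
        unfolding ell_def y1_def y2_def \<theta>1_def[symmetric] \<theta>2_def[symmetric] iu[symmetric]
        by (simp add: algebra_simps)
      also have "cmod \<dots> \<le> a1 * (\<theta>1\<^sup>2 / 2) + a2 * (\<theta>2\<^sup>2 / 2)"
        using a_pos by (intro norm_triangle_le add_mono) (auto simp: norm_mult intro!: mult_left_mono norm_cis_minus_linear_le[simplified])
      also have "\<dots> = (Re u)\<^sup>2 / (2 * a1) + (Im u)\<^sup>2 / (2 * a2)"
        using a_pos by (simp add: \<theta>1_def \<theta>2_def power2_eq_square field_simps)
      also have "\<dots> \<le> (Re u)\<^sup>2 / 16 + (Im u)\<^sup>2 / 16"
        using a_ge9 by (intro add_mono divide_left_mono) auto
      finally show ?thesis using u2 by simp
    qed
    have a12: "a1 * a2 \<le> d / 3"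
    proof -
      have "2 * (a1 * a2) \<le> a1\<^sup>2 + a2\<^sup>2" using zero_le_power2[of "a1 - a2"] by (simp add: power2_eq_square algebra_simps)
      also have "\<dots> = d * (p1 + p2)" unfolding a_sq by (simp add: distrib_left)
      also have "\<dots> \<le> d * (2 / 3)" using psum p0_ge by (intro mult_left_mono) auto
      finally show ?thesis by simp
    qed
    \<comment> \<open>The two angles live on different scales; \<open>a1 * a2 <= d / 3\<close>
      bounds the effect of each angle on the coordinate of the other.\<close>
    have pa: "p2 / a2 \<le> 1 / 3 / a1" "p1 / a1 \<le> 1 / 3 / a2"
    proof -
      have pd: "p2 / a2 = a2 / d" "p1 / a1 = a1 / d"
        using a_sq a_pos d0 by (simp_all add: frac_eq_eq power2_eq_square mult.commute)
      show "p2 / a2 \<le> 1 / 3 / a1" "p1 / a1 \<le> 1 / 3 / a2"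
        unfolding pd using a12 a_pos d0 by (simp_all add: field_simps)
    qed
    \<comment> \<open>The deviation is at most \<open>(1 / 10 + 1 / 30) / a\<close>; division by
      \<open>|c| >= 99 / 100\<close> keeps it below \<open>1 / (5 * a)\<close>, half the radius of
      the nodes.\<close>
    have close: "cmod (ya / c - 1) \<le> 1 / (5 * a)"
      if "a > 0" "cmod (ya - c) \<le> 1 / 10 / a + p * (1 / 10 / a')" "p / a' \<le> 1 / 3 / a" for ya a a' p
    proof -
      have "cmod (ya - c) \<le> 1 / 10 / a + 1 / 10 * (1 / 3 / a)" using that by simp
      also have "\<dots> \<le> 99 / 100 * (1 / (5 * a))" using that(1) by (simp add: field_simps)
      also have "\<dots> \<le> cmod c * (1 / (5 * a))" using c99 that(1) by (intro mult_right_mono) auto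
      finally have "cmod (ya - c) / cmod c \<le> 1 / (5 * a)"
        using c0 by (simp add: pos_divide_le_eq mult.commute)
      moreover have "ya / c - 1 = (ya - c) / c" using c0 by (simp add: diff_divide_distrib)
      ultimately show ?thesis by (simp add: norm_divide)
    qed
    have s1: "cmod (y1 u / c - 1) \<le> 1 / (5 * a1)"
    proof (rule close[OF a_pos(1) _ pa(1)])
      have "complex_of_real p0 + of_real p1 + of_real p2 = 1" using psum by (simp flip: of_real_add)
      then have "y1 u - c = (of_real p0 + of_real p1 + of_real p2) * y1 u - c" by simp
      also have "\<dots> = of_real p0 * (cis \<theta>1 - 1) + of_real p2 * (cis \<theta>1 - cis \<theta>2)"
        by (simp add: c_def cc_def y1_def y2_def \<theta>1_def \<theta>2_def algebra_simps)
      also have "cmod \<dots> \<le> p0 * \<bar>\<theta>1\<bar> + p2 * (\<bar>\<theta>1\<bar> + \<bar>\<theta>2\<bar>)"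
        using p_pos by (intro norm_triangle_le add_mono)
          (auto simp: norm_mult intro!: mult_left_mono norm_cis_minus_1_le norm_cis_minus_cis_le)
      also have "\<dots> = (p0 + p2) * \<bar>\<theta>1\<bar> + p2 * \<bar>\<theta>2\<bar>" by (simp add: algebra_simps)
      also have "\<dots> \<le> 1 * (1 / 10 / a1) + p2 * (1 / 10 / a2)"
        using p_pos psum th by (intro add_mono mult_mono) auto
      finally show "cmod (y1 u - c) \<le> 1 / 10 / a1 + p2 * (1 / 10 / a2)" by simp
    qed
    have s2: "cmod (y2 u / c - 1) \<le> 1 / (5 * a2)"
    proof (rule close[OF a_pos(2) _ pa(2)])
      have "complex_of_real p0 + of_real p1 + of_real p2 = 1" using psum by (simp flip: of_real_add)
      then have "y2 u - c = (of_real p0 + of_real p1 + of_real p2) * y2 u - c" by simp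
      also have "\<dots> = of_real p0 * (cis \<theta>2 - 1) + of_real p1 * (cis \<theta>2 - cis \<theta>1)"
        by (simp add: c_def cc_def y1_def y2_def \<theta>1_def \<theta>2_def algebra_simps)
      also have "cmod \<dots> \<le> p0 * \<bar>\<theta>2\<bar> + p1 * (\<bar>\<theta>2\<bar> + \<bar>\<theta>1\<bar>)"
        using p_pos by (intro norm_triangle_le add_mono)
          (auto simp: norm_mult intro!: mult_left_mono norm_cis_minus_1_le norm_cis_minus_cis_le)
      also have "\<dots> = (p0 + p1) * \<bar>\<theta>2\<bar> + p1 * \<bar>\<theta>1\<bar>" by (simp add: algebra_simps)
      also have "\<dots> \<le> 1 * (1 / 10 / a2) + p1 * (1 / 10 / a1)"
        using p_pos psum th by (intro add_mono mult_mono) auto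
      finally show "cmod (y2 u - c) \<le> 1 / 10 / a2 + p1 * (1 / 10 / a1)" by simp
    qed
    have Gb: "cmod (G b (x1 u) (x2 u)) \<le> 5"
    proof -
      have "(cmod (G b (x1 u) (x2 u)))\<^sup>2 \<le> 5\<^sup>2"
        using norm_G_square_le[OF y c0[unfolded c_def] s1[unfolded c_def] s2[unfolded c_def], of b j1 j2] Sj
        by (simp add: x1_def x2_def jj)
      then show ?thesis by (rule power2_le_imp_le) simp
    qed
    \<comment> \<open>The factors are at most \<open>d\<close> for the coefficient,
      \<open>4 * d\<close> for \<open>ell\<close> and \<open>d^-4\<close> for the power of
      \<open>cc\<close>; there are at most \<open>d\<close> such terms, so together they stay below
      \<open>1\<close>.\<close>
    have cross: "cmod (z l * G (v l) (x1 u) (x2 u)) \<le> 2 / (real d)\<^sup>2" if l: "l \<in> K - {j}" for l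
    proof -
      obtain l1 l2 where ll: "l = (Suc d, l1, l2)" "l1 < n" "l2 < n" "(l1, l2) \<noteq> (j1, j2)"
        using l jj by (auto simp: K_def)
      define k1 k2 where "k1 = int j1 - int l1" and "k2 = int j2 - int l2"
      define Y1 Y2 where "Y1 = x1 u * cnj (unity_root n ^ l1)" and "Y2 = x2 u * cnj (unity_root n ^ l2)"
      have Y: "Y1 = cis (2 * pi * k1 / n + \<theta>1)" "Y2 = cis (2 * pi * k2 / n + \<theta>2)"
        by (simp_all add: Y1_def Y2_def x1_def x2_def y1_def y2_def \<theta>1_def \<theta>2_def k1_def k2_def
            unity_root_pow cis_cnj cis_mult diff_divide_distrib right_diff_distrib algebra_simps del: complex_cnj_power)
      have thn: "\<bar>\<theta>1\<bar> \<le> 1 / n" "\<bar>\<theta>2\<bar> \<le> 1 / n"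
      proof -
        have "1 / 10 / a \<le> 1 / n" if "a \<ge> 4 * real n" for a
          using that n_pos by (simp add: field_simps)
        then show "\<bar>\<theta>1\<bar> \<le> 1 / n" "\<bar>\<theta>2\<bar> \<le> 1 / n" using th a_ge by (force intro: order_trans)+
      qed
      have "cmod (cc Y1 Y2) ^ (d - 1) \<le> 1 / real d ^ 4"
        unfolding cc_def Y
      proof (rule grid_decay[OF _ _ _ psum])
        show "4 / 45 * \<delta>\<^sup>2 \<le> p0 * p1" "4 / 45 * \<delta>\<^sup>2 \<le> p0 * p2"
          using mult_mono[OF p0_ge p1_ge] mult_mono[OF p0_ge p2_ge] p_pos zero_le_power2[of \<delta>] by linarith+
      qed (use p_pos jj ll thn in \<open>auto simp: k1_def k2_def\<close>)
      moreover have "cmod (ell Y1 Y2) \<le> 4 * real d"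
      proof -
        have "cmod (Y1 - 1) \<le> 2" "cmod (Y2 - 1) \<le> 2"
          using norm_triangle_ineq4[of Y1 1] norm_triangle_ineq4[of Y2 1] by (simp_all add: Y)
        then have "cmod (ell Y1 Y2) \<le> real d * 2 + real d * 2"
          unfolding ell_def using a_le a_pos
          by (intro norm_triangle_le add_mono) (auto simp: norm_mult intro!: mult_mono)
        then show ?thesis by simp
      qed
      ultimately have "cmod (z l) * (2 / 5 * cmod (ell Y1 Y2) * cmod (cc Y1 Y2) ^ (d - 1)) \<le> real d * (2 / 5 * (4 * real d) * (1 / real d ^ 4))"
        using z[of l] l by (intro mult_mono mult_nonneg_nonneg) auto
      also have "\<dots> \<le> 2 / (real d)\<^sup>2"
        using d0 by (simp add: power2_eq_square power_numeral_reduce field_simps)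
      finally show ?thesis
        unfolding ll(1) G_v Y1_def[symmetric] Y2_def[symmetric] by (simp add: norm_mult norm_power)
    qed
    have g: "cmod (g u) \<le> 6"
    proof -
      have "cmod (\<Sum>l\<in>K - {j}. z l * G (v l) (x1 u) (x2 u)) \<le> (\<Sum>l\<in>K - {j}. 2 / (real d)\<^sup>2)"
        by (intro order_trans[OF norm_sum] sum_mono cross)
      also have "\<dots> \<le> (\<Sum>l\<in>K. 2 / (real d)\<^sup>2)" by (intro sum_mono2) auto
      also have "\<dots> = N * (2 / (real d)\<^sup>2)" by (simp add: card_K)
      also have "\<dots> \<le> d * (2 / (real d)\<^sup>2)" by (intro mult_right_mono N_le) auto
      also have "\<dots> \<le> 1" using d by (simp add: power2_eq_square)
      finally show ?thesis
        unfolding g_def using Gb by (intro order_trans[OF norm_triangle_ineq]) simp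
    qed
    have e: "cmod (e u) \<ge> 79"
    proof -
      have "79 \<le> 2 / 5 * 200 * (199 / 200 :: real)" by simp
      also have "\<dots> \<le> 2 / 5 * cmod (z j) * cmod c ^ (d - 1)"
        using zj cd by (intro mult_mono) auto
      finally show ?thesis by (simp add: e_def c_def norm_mult norm_power)
    qed
    \<comment> \<open>The threshold \<open>200\<close> makes \<open>e\<close> at least
      \<open>79\<close> against \<open>g\<close> at most \<open>6\<close>, and
      \<open>1 / 1600 + 6 / 79\<close> is below the radius \<open>1 / 10\<close>.\<close>
    have "cmod (\<i> * (ell (y1 u) (y2 u) - \<i> * u) + \<i> * (g u / e u)) \<le> 1 / 1600 + 6 / 79"
    proof (intro order_trans[OF norm_triangle_ineq] add_mono)
      show "cmod (\<i> * (ell (y1 u) (y2 u) - \<i> * u)) \<le> 1 / 1600" using ell by (simp add: norm_mult)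
      have "cmod (g u) / cmod (e u) \<le> 6 / 79" using g e by (intro frac_le) auto
      then show "cmod (\<i> * (g u / e u)) \<le> 6 / 79" by (simp add: norm_mult norm_divide)
    qed
    then show ?thesis using c0 by (simp add: c_def)
  qed

  have cont: "continuous_on (cball 0 (1 / 10)) (\<lambda>u. \<i> * (ell (y1 u) (y2 u) - \<i> * u) + \<i> * (g u / e u))"
  proof -
    have y_cont: "continuous_on A y1" "continuous_on A y2" for A
      unfolding y1_def y2_def using a_pos by (intro continuous_intros; simp)+
    have x_cont: "continuous_on A x1" "continuous_on A x2" for A
      unfolding x1_def x2_def by (intro continuous_intros y_cont)+
    have G_cont: "continuous_on A (\<lambda>u. G a (x1 u) (x2 u))" for a A
      unfolding G_def monom3_def case_prod_unfold by (intro continuous_intros x_cont)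
    have e0: "e u \<noteq> 0" if "u \<in> cball 0 (1 / 10)" for u
      using main[of u] that zj by (auto simp: e_def)
    show ?thesis
      using e0 unfolding g_def e_def cc_def ell_def
      by (intro continuous_intros y_cont G_cont) auto
  qed
  obtain u where u: "u \<in> cball 0 (1 / 10)" "\<i> * (ell (y1 u) (y2 u) - \<i> * u) + \<i> * (g u / e u) = u"
    by (rule brouwer_ball[OF _ cont]) (use main in auto)
  have "e u \<noteq> 0" using main[of u] u zj by (auto simp: e_def)
  moreover have "\<i> * (ell (y1 u) (y2 u) + g u / e u) = 0"
    using u(2) by (simp add: algebra_simps)
  then have "ell (y1 u) (y2 u) + g u / e u = 0" by simp
  ultimately have "g u + e u * ell (y1 u) (y2 u) = 0"
    by (simp add: field_simps)
  note f[of u, unfolded this]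
  moreover have "x1 u = cis (2 * pi * j1 / n + Re u / a1)" "x2 u = cis (2 * pi * j2 / n + Im u / a2)"
    by (simp_all add: x1_def x2_def y1_def y2_def unity_root_pow cis_mult)
  ultimately show ?thesis by (simp only:) blast
qed

end

subsection \<open>The probability of avoiding the torus\<close>

text \<open>The union over all points is uncountable; by compactness a zero exists exactly if the
  modulus becomes arbitrarily small on a countable dense subset.\<close>

lemma sets_exists_zero_on_compact:
  fixes c :: "'b::euclidean_space \<Rightarrow> 'i \<Rightarrow> complex"
  assumes I: "finite I" and T: "compact T" and c: "\<And>m. m \<in> I \<Longrightarrow> continuous_on T (\<lambda>x. c x m)"
  shows "{a \<in> extensional I. \<exists>x\<in>T. (\<Sum>m\<in>I. a m * c x m) = 0} \<in> sets (\<Pi>\<^sub>M i\<in>I. borel)"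
proof -
  obtain D where D: "countable D" "D \<subseteq> T" "T \<subseteq> closure D"
    by (rule separable[of T])
  define f where "f = (\<lambda>a x. cmod (\<Sum>m\<in>I. a m * c x m))"
  have fc: "continuous_on T (f a)" for a
    unfolding f_def by (intro continuous_intros c)
  have "(\<exists>x\<in>T. (\<Sum>m\<in>I. a m * c x m) = 0) \<longleftrightarrow> (\<forall>k::nat. \<exists>x\<in>D. f a x < 1 / Suc k)" for a
  proof
    assume "\<exists>x\<in>T. (\<Sum>m\<in>I. a m * c x m) = 0"
    then obtain x where x: "x \<in> T" "f a x = 0" by (auto simp: f_def)
    show "\<forall>k::nat. \<exists>x\<in>D. f a x < 1 / Suc k"
    proof
      fix k :: nat
      obtain r where r: "r > 0" "\<And>y. y \<in> T \<Longrightarrow> dist y x < r \<Longrightarrow> dist (f a y) (f a x) < 1 / Suc k"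
        using fc[of a, unfolded continuous_on_iff, rule_format, OF x(1), of "1 / Suc k"] by auto
      have "x \<in> closure D" using D(3) x(1) by blast
      then obtain y where y: "y \<in> D" "dist y x < r"
        using r(1) unfolding closure_approachable by blast
      have "f a y < 1 / Suc k"
        using r(2)[of y] y D(2) x(2) by (auto simp: dist_real_def)
      then show "\<exists>x\<in>D. f a x < 1 / Suc k" using y(1) by blast
    qed
  next
    assume small: "\<forall>k::nat. \<exists>x\<in>D. f a x < 1 / Suc k"
    then have "T \<noteq> {}" using D(2) by blast
    then obtain x where x: "x \<in> T" "\<And>y. y \<in> T \<Longrightarrow> f a x \<le> f a y"
      using continuous_attains_inf[OF T _ fc[of a]] by blast
    have "f a x = 0"
    proof (rule ccontr)
      assume "f a x \<noteq> 0"
      then have "f a x > 0" by (simp add: f_def)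
      then obtain k :: nat where "1 / Suc k < f a x" by (rule nat_approx_posE)
      moreover obtain y where "y \<in> D" "f a y < 1 / Suc k" using small by blast
      ultimately show False using x(2)[of y] D(2) by fastforce
    qed
    then show "\<exists>x\<in>T. (\<Sum>m\<in>I. a m * c x m) = 0" using x(1) by (auto simp: f_def)
  qed
  then have "{a \<in> extensional I. \<exists>x\<in>T. (\<Sum>m\<in>I. a m * c x m) = 0} =
      (\<Inter>k::nat. \<Union>x\<in>D. {a \<in> space (\<Pi>\<^sub>M i\<in>I. borel). f a x < 1 / Suc k})"
    by (auto simp: space_PiM PiE_def)
  also have "\<dots> \<in> sets (\<Pi>\<^sub>M i\<in>I. borel)"
  proof -
    have [measurable]: "(\<lambda>a. f a x) \<in> borel_measurable (\<Pi>\<^sub>M i\<in>I. borel)" for x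
      unfolding f_def by measurable
    have "{a \<in> space (\<Pi>\<^sub>M i\<in>I. borel). f a x < 1 / Suc k} \<in> sets (\<Pi>\<^sub>M i\<in>I. borel)" for k :: nat and x
      by measurable
    then show ?thesis
      by (intro sets.countable_INT sets.countable_UN'[OF D(1)] image_subsetI) auto
  qed
  finally show ?thesis .
qed

text \<open>In the orthonormal basis of rescaled monomials the Hermitian norm is Euclidean, so the
  coordinates are independent standard Gaussians.\<close>

lemma gauss_H0_eq_distr:
  "gauss_H0 d = distr (gauss_PiM (hom_exps d)) (\<Pi>\<^sub>M m\<in>hom_exps d. borel)
     (\<lambda>a. \<lambda>m\<in>hom_exps d. a m / complex_of_real (sqrt (monom_sqnorm d m)))"
proof -
  let ?I = "hom_exps d"
  let ?g = "\<lambda>c. \<lambda>m\<in>?I. c m / complex_of_real (sqrt (monom_sqnorm d m))"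
  have g [measurable]: "?g \<in> (\<Pi>\<^sub>M m\<in>?I. lborel) \<rightarrow>\<^sub>M (\<Pi>\<^sub>M m\<in>?I. borel)"
    by measurable
  have f [measurable]: "(\<lambda>P. ennreal (exp (- (herm_norm d P)\<^sup>2) / pi ^ dim_H0 d)) \<in> borel_measurable (\<Pi>\<^sub>M m\<in>?I. borel)"
    unfolding herm_norm_sq by measurable
  have eq: "exp (- (herm_norm d (?g c))\<^sup>2) / pi ^ dim_H0 d = exp (- (\<Sum>i\<in>?I. (cmod (c i))\<^sup>2)) / pi ^ card ?I" for c
  proof -
    have "(herm_norm d (?g c))\<^sup>2 = (\<Sum>m\<in>?I. (cmod (c m))\<^sup>2)"
      unfolding herm_norm_sq
      by (intro sum.cong) (use monom_sqnorm_pos[of d] in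
        \<open>auto simp: norm_divide power_divide less_imp_le less_imp_neq[THEN not_sym]\<close>)
    then show ?thesis by (simp add: card_hom_exps)
  qed
  show ?thesis
    unfolding gauss_H0_def lebesgue_H0_def gauss_PiM_eq_density[OF finite_hom_exps]
    by (subst density_distr[OF f g]) (simp only: eq)
qed

context torus_grid
begin

definition "nozero = {a \<in> extensional (hom_exps d). \<forall>x1 x2. cmod x1 = 1 \<longrightarrow> cmod x2 = 1 \<longrightarrow> G a x1 x2 \<noteq> 0}"

lemma sets_nozero: "nozero \<in> sets (gauss_PiM (hom_exps d))"
proof -
  let ?T = "sphere (0::complex) 1 \<times> sphere (0::complex) 1"
  let ?c = "\<lambda>x m. of_real (\<sigma> m) * monom3 1 (fst x) (snd x) m"
  let ?Z = "{a \<in> extensional (hom_exps d). \<exists>x\<in>?T. (\<Sum>m\<in>hom_exps d. a m * ?c x m) = 0}"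
  have sets: "sets (gauss_PiM (hom_exps d)) = sets (\<Pi>\<^sub>M m\<in>hom_exps d. borel)"
    by (intro sets_PiM_cong) (auto simp: sets_cgauss)
  have "?Z \<in> sets (gauss_PiM (hom_exps d))"
    unfolding sets by (rule sets_exists_zero_on_compact)
      (auto intro!: compact_Times continuous_intros simp: monom3_def case_prod_unfold)
  then have "space (gauss_PiM (hom_exps d)) - ?Z \<in> sets (gauss_PiM (hom_exps d))"
    by (rule sets.compl_sets)
  also have "space (gauss_PiM (hom_exps d)) - ?Z = nozero"
    by (force simp: nozero_def G_def mult_ac)
  finally show ?thesis .
qed

text \<open>Each of the three terms of the barrier bound is at most \<open>q ^ N\<close>:
  \<open>2 / e\<close> is below \<open>9 / 10 <= q\<close>, the middle term is \<open>q ^ N\<close>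
  itself, and the last is a union of at most \<open>d\<close> Gaussian tails of order
  \<open>exp (- d^2 / 2)\<close>, against \<open>q ^ N >= exp (- d)\<close>.\<close>

lemma emeasure_nozero_le:
  assumes q: "1 - exp (- 50000) \<le> q" "q \<le> 1"
  shows "emeasure (gauss_PiM (hom_exps d)) nozero \<le> ennreal (14 * q ^ N)"
proof (rule gauss_PiM_split[OF finite_hom_exps finite_K disj_K \<kappa>_in_K class_w_le F_orth1 F_orth2])
  fix R assume R: "R \<in> gauss_PiM (hom_exps d) \<rightarrow>\<^sub>M gauss_PiM (hom_exps d)"
    and split: "\<And>f. f \<in> borel_measurable (gauss_PiM (hom_exps d)) \<Longrightarrow>
      (\<integral>\<^sup>+a. f a \<partial>gauss_PiM (hom_exps d)) =
      (\<integral>\<^sup>+a. \<integral>\<^sup>+z. f (\<lambda>m\<in>hom_exps d. R a m + (\<Sum>j\<in>K. z j * (F (\<kappa> m) j * w m))) \<partial>gauss_PiM K \<partial>gauss_PiM (hom_exps d))"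
  have e: "exp (- 50000) \<le> (1/10 :: real)"
  proof -
    have "exp (- 50000) = 1 / exp (50000 :: real)" by (simp add: exp_minus field_simps)
    also have "\<dots> \<le> 1 / (1 + 50000)"
      using exp_ge_add_one_self[of "50000 :: real"] by (intro divide_left_mono) auto
    finally show ?thesis by simp
  qed
  have q0: "9 / 10 \<le> q" using q e by simp
  \<comment> \<open>The tail beyond \<open>200\<close> has probability at least
    \<open>exp (- 40402) / pi\<close>; the bound \<open>2 * exp (- 50000)\<close> for
    \<open>1 - q^2\<close> is smaller by far more than the factor \<open>2 * pi\<close>.\<close>
  have tail: "1 - q\<^sup>2 \<le> measure cgauss {z. cmod z \<ge> 200}"
  proof -
    have "1 - q\<^sup>2 = (1 - q) * (1 + q)" by (simp add: power2_eq_square algebra_simps)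
    also have "\<dots> \<le> exp (- 50000) * 2" using q q0 by (intro mult_mono) auto
    also have "\<dots> \<le> exp (- ((200 + 1)\<^sup>2 + 1)) / pi"
    proof -
      have "pi * 2 \<le> 8" using pi_less_4 by simp
      also have "8 \<le> exp (9598 :: real)" using exp_ge_add_one_self[of "9598 :: real"] by simp
      finally have "exp (- 50000) * (pi * 2) \<le> exp (- 50000) * exp (9598 :: real)" by (intro mult_left_mono) auto
      also have "\<dots> = exp (- ((200 + 1)\<^sup>2 + 1))" by (simp add: exp_add[symmetric])
      finally show ?thesis by (simp add: field_simps)
    qed
    also have "\<dots> \<le> measure cgauss {z. cmod z \<ge> 200}"
      by (rule measure_cgauss_tail_ge) simp
    finally show ?thesis .
  qed
  have "emeasure (gauss_PiM (hom_exps d)) nozero \<le>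
    ennreal ((2 * exp (-1)) ^ card K + q ^ card K + card K * (2 * exp (- (real d)\<^sup>2 / 2)))"
  \<comment> \<open>\<open>C\<close> is the operator norm of the sampling maps and \<open>D\<close>
    the factor in \<open>S\<close>; \<open>4 * D * C = 224 / 9\<close> lies just below
    \<open>25\<close>, the square of the size \<open>5\<close> allowed for the remainder near a good
    grid point.\<close>
  proof (rule gauss_PiM_barrier_bound[where R = R and v = "\<lambda>j m. F (\<kappa> m) j * w m" and L = LN and \<Omega> = \<Omega>
        and C = "7 / 2" and D = "16 / 9" and s = 25 and t = "real d" and q = q and M = 200])
    fix b z j
    assume h: "b \<in> extensional (hom_exps d)" "z \<in> extensional K" "j \<in> K"
      "16 / 9 / real (card \<Omega>) * (\<Sum>\<omega>\<in>\<Omega>. (cmod (\<Sum>m\<in>hom_exps d. LN \<omega> j m * b m))\<^sup>2) \<le> 25"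
      "200 \<le> cmod (z j)" "\<And>l. l \<in> K \<Longrightarrow> cmod (z l) \<le> real d"
    obtain \<theta>1 \<theta>2 where zero: "G (\<lambda>m\<in>hom_exps d. b m + (\<Sum>l\<in>K. z l * v l m)) (cis \<theta>1) (cis \<theta>2) = 0"
      using exists_zero[of j b z] h by (auto simp: S_def)
    show "(\<lambda>m\<in>hom_exps d. b m + (\<Sum>j\<in>K. z j * (F (\<kappa> m) j * w m))) \<notin> nozero"
    proof
      assume "(\<lambda>m\<in>hom_exps d. b m + (\<Sum>j\<in>K. z j * (F (\<kappa> m) j * w m))) \<in> nozero"
      then have "G (\<lambda>m\<in>hom_exps d. b m + (\<Sum>j\<in>K. z j * (F (\<kappa> m) j * w m))) (cis \<theta>1) (cis \<theta>2) \<noteq> 0"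
        unfolding nozero_def mem_Collect_eq using norm_cis by blast
      then show False using zero unfolding v_def by contradiction
    qed
  qed (use R split sets_nozero tail q q0 LN_op_norm_le in \<open>auto simp: \<Omega>_def\<close>)
  also have "\<dots> \<le> ennreal (14 * q ^ N)"
    unfolding card_K
  proof (rule ennreal_leI)
    have "(2 * exp (-1)) ^ N \<le> q ^ N"
    proof (rule power_mono)
      have "(5 / 2 :: real) \<le> exp 1" using exp_lower_Taylor_quadratic[of "1 :: real"] by simp
      then have "2 * exp (-1) \<le> (4 / 5 :: real)" by (simp add: exp_minus field_simps)
      then show "2 * exp (-1) \<le> q" using q0 by simp
    qed simp
    moreover have "N * (2 * exp (- (real d)\<^sup>2 / 2)) \<le> q ^ N"
    proof -
      have "N * (2 * exp (- (real d)\<^sup>2 / 2)) \<le> d * (2 * exp (- (real d)\<^sup>2 / 2))"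
        by (intro mult_right_mono N_le) auto
      also have "\<dots> = 2 * real d * exp (- (real d)\<^sup>2 / 2)" by simp
      also have "\<dots> \<le> exp (2 * real d) * exp (- (real d)\<^sup>2 / 2)"
      proof (rule mult_right_mono)
        show "2 * real d \<le> exp (2 * real d)" using exp_ge_add_one_self[of "2 * real d"] by linarith
      qed simp
      also have "\<dots> = exp (2 * real d - (real d)\<^sup>2 / 2)" by (simp add: exp_add[symmetric])
      also have "\<dots> \<le> exp (- real d)"
      proof -
        have "1000 * real d \<le> (real d)\<^sup>2" using d by (simp add: power2_eq_square)
        then show ?thesis by simp
      qed
      also have "\<dots> \<le> exp (- real N)" using N_le by simp
      also have "\<dots> = exp (-1) ^ N" by (simp add: exp_of_nat_mult[symmetric])
      also have "\<dots> \<le> q ^ N"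
      proof (rule power_mono)
        have "(2 :: real) \<le> exp 1" using exp_ge_add_one_self[of "1 :: real"] by simp
        then have "exp (-1) \<le> (1 / 2 :: real)" by (simp add: exp_minus field_simps)
        then show "exp (-1) \<le> q" using q0 by simp
      qed simp
      finally show ?thesis .
    qed
    moreover have "0 \<le> q ^ N" using q0 by simp
    ultimately show "(2 * exp (-1)) ^ N + q ^ N + N * (2 * exp (- (real d)\<^sup>2 / 2)) \<le> 14 * q ^ N"
      by simp
  qed
  finally show ?thesis .
qed

lemma meet_prob_ge:
  assumes t: "p0 = 1 / (1 + (exp t1)\<^sup>2 + (exp t2)\<^sup>2)" "p1 = (exp t1)\<^sup>2 * p0" "p2 = (exp t2)\<^sup>2 * p0"
    and q: "1 - exp (- 50000) \<le> q" "q \<le> 1"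
  shows "meet_prob d (t1, t2) \<ge> 1 - 14 * q ^ N"
proof -
  let ?I = "hom_exps d"
  let ?r1 = "complex_of_real (exp t1)" and ?r2 = "complex_of_real (exp t2)"
  let ?g = "\<lambda>a. \<lambda>m\<in>?I. a m / complex_of_real (sqrt (monom_sqnorm d m))"
  let ?T = "sphere (0::complex) 1 \<times> sphere (0::complex) 1"
  define E where "E = {P \<in> space (gauss_H0 d). affine_chart ` Log_fibre (t1, t2) \<inter> V d P \<noteq> {}}"
  have space: "space (gauss_H0 d) = extensional ?I"
    by (auto simp: space_gauss_H0 H0_def PiE_def)
  have iff: "affine_chart ` Log_fibre (t1, t2) \<inter> V d P \<noteq> {} \<longleftrightarrow>
      (\<exists>x\<in>?T. (\<Sum>m\<in>?I. P m * monom3 1 (?r1 * fst x) (?r2 * snd x) m) = 0)" for P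
  proof -
    have ev: "hpoly_eval d P (1, z1, z2) = (\<Sum>m\<in>?I. P m * monom3 1 z1 z2 m)" for z1 z2
      by (auto simp: hpoly_eval_def monom3_def mult.assoc intro!: sum.cong)
    have fib: "(z1, z2) \<in> Log_fibre (t1, t2) \<longleftrightarrow> cmod z1 = exp t1 \<and> cmod z2 = exp t2" for z1 z2
      by (auto simp: Log_fibre_def Log_def)
    have "affine_chart ` Log_fibre (t1, t2) \<inter> V d P \<noteq> {} \<longleftrightarrow>
        (\<exists>z1 z2. cmod z1 = exp t1 \<and> cmod z2 = exp t2 \<and> hpoly_eval d P (1, z1, z2) = 0)"
    proof -
      have "affine_chart ` Log_fibre (t1, t2) \<inter> V d P \<noteq> {} \<longleftrightarrow> (\<exists>z\<in>Log_fibre (t1, t2). affine_chart z \<in> V d P)"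
        by blast
      then show ?thesis by (simp add: Bex_def split_paired_Ex fib affine_chart_in_V_iff)
    qed
    also have "\<dots> \<longleftrightarrow> (\<exists>x\<in>?T. hpoly_eval d P (1, ?r1 * fst x, ?r2 * snd x) = 0)"
    proof
      assume "\<exists>z1 z2. cmod z1 = exp t1 \<and> cmod z2 = exp t2 \<and> hpoly_eval d P (1, z1, z2) = 0"
      then obtain z1 z2 where "cmod z1 = exp t1" "cmod z2 = exp t2" "hpoly_eval d P (1, z1, z2) = 0" by blast
      then show "\<exists>x\<in>?T. hpoly_eval d P (1, ?r1 * fst x, ?r2 * snd x) = 0"
        by (intro bexI[of _ "(z1 / ?r1, z2 / ?r2)"]) (auto simp: norm_divide)
    next
      assume "\<exists>x\<in>?T. hpoly_eval d P (1, ?r1 * fst x, ?r2 * snd x) = 0"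
      then obtain x where "x \<in> ?T" "hpoly_eval d P (1, ?r1 * fst x, ?r2 * snd x) = 0" by blast
      then show "\<exists>z1 z2. cmod z1 = exp t1 \<and> cmod z2 = exp t2 \<and> hpoly_eval d P (1, z1, z2) = 0"
        by (intro exI[of _ "?r1 * fst x"] exI[of _ "?r2 * snd x"]) (auto simp: norm_mult)
    qed
    finally show ?thesis unfolding ev .
  qed
  have E: "E = {P \<in> extensional ?I. \<exists>x\<in>?T. (\<Sum>m\<in>?I. P m * monom3 1 (?r1 * fst x) (?r2 * snd x) m) = 0}"
    unfolding E_def space iff ..
  have Es: "E \<in> sets (\<Pi>\<^sub>M m\<in>?I. borel)"
    unfolding E by (rule sets_exists_zero_on_compact)
      (auto intro!: compact_Times continuous_intros simp: monom3_def case_prod_unfold)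
  \<comment> \<open>\<open>C^2\<close> is the ratio of the coefficient variance on the torus,
    \<open>(d + 2)! / (2 * i0! * i1! * i2!) * exp (2 * (t1 * i1 + t2 * i2))\<close>, to the
    trinomial weight \<open>pm m\<close>; it does not depend on \<open>m\<close>, so it can be
    pulled out of the polynomial.\<close>
  define C where "C = sqrt (fact (d + 2) / (2 * fact d) * (1 / p0) ^ d)"
  have C: "C \<noteq> 0" using p_pos by (simp add: C_def)
  have coeff: "1 / sqrt (monom_sqnorm d m) * monom3 1 (exp t1) (exp t2) m = C * \<sigma> m" if mI: "m \<in> ?I" for m
  proof -
    obtain i0 i1 i2 where m: "m = (i0, i1, i2)" "i0 + i1 + i2 = d" using mI by (auto simp: hom_exps_def)
    have "(1 / sqrt (monom_sqnorm d m) * monom3 1 (exp t1) (exp t2) m)\<^sup>2 = (C * \<sigma> m)\<^sup>2"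
    proof -
      have "p0 ^ i0 * p1 ^ i1 * p2 ^ i2 = p0 ^ i0 * ((exp t1)\<^sup>2 * p0) ^ i1 * ((exp t2)\<^sup>2 * p0) ^ i2"
        by (simp only: t(2,3))
      also have "\<dots> = (exp t1 ^ i1 * exp t2 ^ i2)\<^sup>2 * p0 ^ d"
        unfolding m(2)[symmetric] by (simp add: power_mult_distrib power_add power_mult[symmetric] mult_ac)
      finally have "pm m = trinom d m * ((exp t1 ^ i1 * exp t2 ^ i2)\<^sup>2 * p0 ^ d)"
        unfolding pm_def by (simp add: m(1) monom3_def)
      moreover have "C\<^sup>2 = fact (d + 2) / (2 * fact d) * (1 / p0) ^ d"
        unfolding C_def using p_pos by (intro real_sqrt_pow2) simp
      ultimately have "(C * \<sigma> m)\<^sup>2 =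
          (fact (d + 2) / (2 * fact d) * (1 / p0) ^ d) *
          (fact d / (fact i0 * fact i1 * fact i2) * ((exp t1 ^ i1 * exp t2 ^ i2)\<^sup>2 * p0 ^ d))"
        by (simp only: power_mult_distrib \<sigma>_sq m(1) trinom_def prod.case)
      also have "\<dots> = fact (d + 2) / (2 * (fact i0 * fact i1 * fact i2)) * (exp t1 ^ i1 * exp t2 ^ i2)\<^sup>2"
      proof -
        have alg: "(x / (2 * y) * u) * (y / z * (e * w)) = x / (2 * z) * e"
          if "y \<noteq> 0" "z \<noteq> 0" "u * w = 1" for x y z e u w :: real
        proof -
          have "(x / (2 * y) * u) * (y / z * (e * w)) = x / (2 * z) * e * (u * w)"
            using that(1,2) by (simp add: field_simps)
          then show ?thesis using that(3) by simp
        qed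
        show ?thesis by (rule alg) (use p_pos in \<open>simp_all add: power_mult_distrib[symmetric]\<close>)
      qed
      also have "\<dots> = (1 / sqrt (monom_sqnorm d m) * monom3 1 (exp t1) (exp t2) m)\<^sup>2"
      proof -
        have "(sqrt (monom_sqnorm d m))\<^sup>2 = monom_sqnorm d m" using monom_sqnorm_pos[of d m] by simp
        then show ?thesis
          unfolding power_mult_distrib[of "1 / _"] power_divide
          by (simp only: m(1) monom3_def monom_sqnorm_def prod.case) (simp add: mult.assoc)
      qed
      finally show ?thesis ..
    qed
    then show ?thesis
      by (rule power2_eq_imp_eq)
        (use p_pos monom_sqnorm_pos[of d m] pm_nonneg[of m] in \<open>auto simp: C_def \<sigma>_def monom3_def less_imp_le split: prod.splits intro!: mult_nonneg_nonneg divide_nonneg_nonneg\<close>)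
  qed
  have Gg: "(\<Sum>m\<in>?I. ?g a m * monom3 1 (?r1 * x1) (?r2 * x2) m) = C * G a x1 x2" for a x1 x2
    unfolding G_def sum_distrib_left
  proof (intro sum.cong refl)
    fix m assume m: "m \<in> ?I"
    have "monom3 1 (?r1 * x1) (?r2 * x2) m = complex_of_real (monom3 1 (exp t1) (exp t2) m) * monom3 1 x1 x2 m"
      by (auto simp: monom3_def power_mult_distrib split: prod.splits)
    then have "?g a m * monom3 1 (?r1 * x1) (?r2 * x2) m =
        complex_of_real (1 / sqrt (monom_sqnorm d m) * monom3 1 (exp t1) (exp t2) m) * a m * monom3 1 x1 x2 m"
      using m by simp
    also have "\<dots> = C * (of_real (\<sigma> m) * a m * monom3 1 x1 x2 m)"
      unfolding coeff[OF m] by simp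
    finally show "?g a m * monom3 1 (?r1 * x1) (?r2 * x2) m = C * (of_real (\<sigma> m) * a m * monom3 1 x1 x2 m)" .
  qed
  have pre: "?g -` E \<inter> space (gauss_PiM ?I) = space (gauss_PiM ?I) - nozero"
  proof -
    have mem: "?g a \<in> E \<longleftrightarrow> (\<exists>x\<in>?T. C * G a (fst x) (snd x) = 0)" for a
      unfolding E mem_Collect_eq Gg by (simp only: restrict_extensional simp_thms)
    have "a \<in> extensional ?I \<and> ?g a \<in> E \<longleftrightarrow> a \<in> extensional ?I \<and> a \<notin> nozero" for a
      unfolding mem nozero_def using C by fastforce
    then show ?thesis by (auto simp only: vimage_def space_gauss_PiM Int_iff Diff_iff mem_Collect_eq set_eq_iff)
  qed
  interpret gI: prob_space "gauss_PiM ?I" by (rule prob_space_gauss_PiM)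
  have gm: "?g \<in> gauss_PiM ?I \<rightarrow>\<^sub>M (\<Pi>\<^sub>M m\<in>?I. borel)" by measurable
  have "meet_prob d (t1, t2) = measure (gauss_H0 d) E" by (simp add: meet_prob_def E_def)
  also have "\<dots> = measure (gauss_PiM ?I) (space (gauss_PiM ?I) - nozero)"
    unfolding gauss_H0_eq_distr by (subst measure_distr[OF gm Es]) (simp only: pre)
  also have "\<dots> = 1 - measure (gauss_PiM ?I) nozero"
    by (rule gI.prob_compl[OF sets_nozero])
  finally have "meet_prob d (t1, t2) = 1 - measure (gauss_PiM ?I) nozero" .
  moreover have "measure (gauss_PiM ?I) nozero \<le> 14 * q ^ N"
  proof -
    have "0 \<le> q" using q exp_le_one_iff[of "- 50000 :: real"] by linarith
    then show ?thesis
      using emeasure_nozero_le[OF q] by (simp add: gI.emeasure_eq_measure)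
  qed
  ultimately show ?thesis by simp
qed

end

theorem theorem1p3:
  fixes \<kappa> :: real
  assumes "0 < \<kappa>" and "\<kappa> < 1"
  shows "\<exists>d0::nat. d0 \<ge> 1 \<and>
    (\<forall>d::nat. \<forall>\<delta>::real. \<forall>t1 t2 :: real.
       d \<ge> d0 \<longrightarrow>
       3 * sqrt (5 * ln (real d) / real d) \<le> \<delta> \<longrightarrow> \<delta> < 1 \<longrightarrow>
       \<delta> \<le> exp t1 \<longrightarrow> exp t1 \<le> 1 \<longrightarrow>
       \<delta> \<le> exp t2 \<longrightarrow> exp t2 \<le> 1 \<longrightarrow>
       meet_prob d (t1, t2) \<ge>
         1 - 14 * gamma_const \<kappa>
             ^ ((nat \<lfloor>2 * \<delta> * sqrt (real d) / (3 * sqrt (5 * ln (real d)))\<rfloor>) ^ 2))"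
\<comment> \<open>From \<open>1000\<close> on, \<open>ln d >= 6\<close> holds because
  \<open>3 ^ 6 = 729\<close>, and the errors of order \<open>1 / d\<close> are small enough.\<close>
proof (intro exI[of _ 1000] conjI allI impI)
  fix d :: nat and \<delta> t1 t2 :: real
  assume d: "1000 \<le> d" and \<delta>: "3 * sqrt (5 * ln (real d) / real d) \<le> \<delta>" "\<delta> < 1"
    and t1: "\<delta> \<le> exp t1" "exp t1 \<le> 1" and t2: "\<delta> \<le> exp t2" "exp t2 \<le> 1"
  define x where "x = 2 * \<delta> * sqrt (real d) / (3 * sqrt (5 * ln (real d)))"
  define n where "n = nat \<lfloor>x\<rfloor>"
  define p0 where "p0 = 1 / (1 + (exp t1)\<^sup>2 + (exp t2)\<^sup>2)"
  define p1 p2 where "p1 = (exp t1)\<^sup>2 * p0" and "p2 = (exp t2)\<^sup>2 * p0"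
  have d0: "real d > 0" and l0: "ln (real d) > 0" using d by auto
  have \<delta>0: "\<delta> > 0"
  proof -
    have "0 < 3 * sqrt (5 * ln (real d) / real d)" using d0 l0 by simp
    then show ?thesis using \<delta>(1) by linarith
  qed
  \<comment> \<open>The lower bound on \<open>\<delta>\<close> says exactly that \<open>x\<close> is
    at least \<open>2\<close>, so the grid has at least two points in each direction.\<close>
  have x2: "x \<ge> 2"
  proof -
    have "3 * sqrt (5 * ln (real d)) \<le> \<delta> * sqrt (real d)"
      using \<delta>(1) d0 by (simp add: real_sqrt_divide field_simps)
    then show ?thesis using l0 by (simp add: x_def field_simps)
  qed
  have xsq: "45 * x\<^sup>2 * ln d = 4 * \<delta>\<^sup>2 * d"
    using l0 d0 by (simp add: x_def power_divide power_mult_distrib)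
  have nx: "real n \<le> x" "n \<ge> 2"
    using x2 by (auto simp: n_def le_nat_floor of_nat_floor)
  interpret torus_grid d n p0 p1 p2 \<delta>
  proof
    have S: "1 + (exp t1)\<^sup>2 + (exp t2)\<^sup>2 > 0" by (simp add: add_pos_pos)
    have sq: "(exp t1)\<^sup>2 \<le> 1" "(exp t2)\<^sup>2 \<le> 1" "\<delta>\<^sup>2 \<le> (exp t1)\<^sup>2" "\<delta>\<^sup>2 \<le> (exp t2)\<^sup>2"
      using t1 t2 \<delta>0 by (auto simp: power_le_one power_mono)
    have p0: "1 / 3 \<le> p0" unfolding p0_def using sq S by (intro divide_left_mono) auto
    have "p0 + p1 + p2 = (1 + (exp t1)\<^sup>2 + (exp t2)\<^sup>2) * p0" unfolding p1_def p2_def by (simp add: algebra_simps)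
    then show "p0 + p1 + p2 = 1" using S unfolding p0_def by simp
    show "p1 \<le> p0" "p2 \<le> p0" unfolding p1_def p2_def using sq p0 by (auto intro!: mult_left_le_one_le)
    show "\<delta>\<^sup>2 / 3 \<le> p1" "\<delta>\<^sup>2 / 3 \<le> p2"
      unfolding p1_def p2_def using mult_mono[OF sq(3) p0] mult_mono[OF sq(4) p0] by auto
    have "45 * (real n)\<^sup>2 * ln d \<le> 45 * x\<^sup>2 * ln d"
      using nx l0 by (intro mult_right_mono mult_left_mono power_mono) auto
    then show "45 * (real n)\<^sup>2 * ln d \<le> 4 * \<delta>\<^sup>2 * d" unfolding xsq .
  qed (use d nx \<delta>0 in auto)
  \<comment> \<open>\<open>2^11 * 3^3 = 55296\<close> exceeds \<open>50000\<close>, and division by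
    \<open>\<kappa>^2\<close>, which is at most \<open>1\<close>, can only increase it.\<close>
  have q: "1 - exp (- 50000) \<le> gamma_const \<kappa>" "gamma_const \<kappa> \<le> 1"
  proof -
    have "2 ^ 11 * 3 ^ 3 / 1 \<le> 2 ^ 11 * 3 ^ 3 / \<kappa>\<^sup>2"
      using assms by (intro divide_left_mono) (auto simp: power_le_one)
    then have "exp (- (2 ^ 11 * 3 ^ 3 / \<kappa>\<^sup>2)) \<le> exp (- 50000)" by simp
    then have "exp (- (2 ^ 11 * 3 ^ 3 / \<kappa>\<^sup>2)) * (1 - exp (- 1 / 2)) \<le> exp (- 50000) * 1"
      by (intro mult_mono) auto
    then show "1 - exp (- 50000) \<le> gamma_const \<kappa>" by (simp add: gamma_const_def)
    show "gamma_const \<kappa> \<le> 1" by (simp add: gamma_const_def)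
  qed
  show "meet_prob d (t1, t2) \<ge>
         1 - 14 * gamma_const \<kappa>
             ^ ((nat \<lfloor>2 * \<delta> * sqrt (real d) / (3 * sqrt (5 * ln (real d)))\<rfloor>) ^ 2)"
    using meet_prob_ge[OF p0_def p1_def p2_def q] unfolding N_def unfolding n_def x_def .
qed simp

end
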